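(* Let $V=\{2^{k^2},\,2^{k^2}+1:k\ge4\}\subset\mathbb Z$ ($k$ ranging over integers). Then $Z_2(V)=\infty$, whereas $$\alpha_1(V)\le\left(\sqrt{\frac2\pi}-\frac1{\sqrt6}\left(\frac\pi{32768}+\frac\pi{64\sqrt{15}}\right)\right)^{-1}<1.262<\sqrt2 .$$
   Context: For $V\subset\mathbb Z$, $$Z_2(V)=\sup_{h\in\mathbb Z\setminus\{0\}}\#\{(a,b)\in V^2:b-a=h\},$$ and $$\alpha_1(V)=\sup_{0\ne(c_n)\in c_{00}(V)}\frac{\left(\sum_{n\in V}|c_n|^2\right)^{1/2}}{\int_0^1\left|\sum_{n\in V}c_ne^{2\pi int}\right|dt},$$ where $c_{00}(V)$ denotes the finitely supported complex scalar families indexed by $V$. *)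

theory Defs
  imports "HOL-Analysis.Analysis" "HOL-Library.Extended_Nat"
begin

(* Extended cardinality: card alone would give 0 on infinite sets. *)
definition ecard :: "'a set \<Rightarrow> enat" where
  "ecard A = (if finite A then enat (card A) else \<infinity>)"

definition Z2 :: "int set \<Rightarrow> enat" where
  "Z2 V = (SUP h \<in> UNIV - {0}. ecard {(a, b). a \<in> V \<and> b \<in> V \<and> b - a = h})"

(* Families indexed by V are represented by functions on all integers vanishing outside V. *)
definition c00 :: "int set \<Rightarrow> (int \<Rightarrow> complex) set" where
  "c00 V = {c. (\<forall>n. n \<notin> V \<longrightarrow> c n = 0) \<and> finite {n. c n \<noteq> 0}}"

(* For c in c00 V the support of c is a finite subset of V, and a sum over V is a sum over it. *)
definition l2_norm :: "(int \<Rightarrow> complex) \<Rightarrow> real" where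
  "l2_norm c = sqrt (\<Sum>n | c n \<noteq> 0. (cmod (c n))\<^sup>2)"

definition trig_poly :: "(int \<Rightarrow> complex) \<Rightarrow> real \<Rightarrow> complex" where
  "trig_poly c t = (\<Sum>n | c n \<noteq> 0. c n * exp (2 * of_real pi * \<i> * of_int n * of_real t))"

(* The quotient is formed in ennreal, where a vanishing denominator would give infinity. *)
definition alpha1 :: "int set \<Rightarrow> ennreal" where
  "alpha1 V = (SUP c \<in> c00 V - {\<lambda>_. 0}.
     ennreal (l2_norm c) / ennreal (integral {0..1} (\<lambda>t. cmod (trig_poly c t))))"

definition V_sq :: "int set" where
  "V_sq = {2 ^ (k\<^sup>2) | k :: nat. k \<ge> 4} \<union> {2 ^ (k\<^sup>2) + 1 | k :: nat. k \<ge> 4}"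

end

(* On each block the polynomial is (a_k + b_k e(t)) e(2^(k^2) t), with e(t) = exp(2 pi i t).
   The frequencies 2^(k^2) grow so fast that, block by block, e(2^(k^2) t) may be replaced by independent
   uniform points of the unit circle (Steinhaus variables) while t in the slow factors is frozen, at
   the cost of the two small terms in the constant. The sharp L1 Khintchine inequality for Steinhaus
   variables contributes sqrt pi / 2, and averaging (sum_k |a_k + b_k e(t)|^2)^(1/2) over t
   contributes 2 sqrt 2 / pi; their product is sqrt (2 / pi).

   The Khintchine inequality follows Haagerup: E |X| is the integral of (1 - prod_k J0(|a_k| s)) / s^2
   over s > 0. If 2 |a_k|^2 <= sum_j |a_j|^2 for all k, weighted AM-GM reduces it to one
   Bessel integral for each exponent p >= 2. A single coefficient violating this condition is
   treated directly: in the range up to 62 / 100 of the sum by decoupling it from the rest through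
   2xy <= x^2 + y^2, and beyond that by moments of the rest. *)
theory Submission
  imports Defs "HOL-Probability.Sinc_Integral"
begin

section \<open>Averages over the circle and Steinhaus means\<close>

text \<open>The obstacle is the Bessel inequality for exponents \<open>p \<ge> 2\<close>: it
  compares J0 with its Gaussian approximation, with ratio tending to 1 as p grows and with sides
  about 1.253 and 1.273 at p = 2, so there is little room anywhere. What makes one computation cover
  all p is a common scale. Below 11/5 the quartic term of ln J0 is a gain over the Gaussian, beyond
  11/5 the power of J0 is a loss, and relative to exponent 2 the gain shrinks by at most the factor
  \<open>sqrt (2 / p)\<close> and the loss by at least that factor. The exponent attached to a
  coefficient is the reciprocal of its share of the square sum, hence the separate treatment of
  shares above one half. In the claimed constant, 1 / sqrt 6 is the root mean square distance of two
  independent uniform points of [0,1], the cost of a decoupling step measured in L2. Here the fast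
  phases are decoupled in L1, where the mean distance 1/3 appears; this leaves enough room to
  estimate the slow factor by the trivial distance 1.\<close>

lemma continuous_integrable_Icc:
  fixes f :: "real \<Rightarrow> 'a::banach"
  assumes "continuous_on UNIV f"
  shows "f integrable_on {a..b}"
  using assms continuous_on_subset integrable_continuous_interval by blast

lemma integral_periodic_shift:
  fixes g :: "real \<Rightarrow> real"
  assumes g: "continuous_on UNIV g" and per: "\<And>u. g (u + 1) = g u"
  shows "integral {0..1} (\<lambda>u. g (u + c)) = integral {0..1} g"
proof -
  \<comment> \<open>A base point to the left of both windows: all integrals are then split at points
    in increasing order.\<close>
  obtain a where a: "a \<le> 0" "a + 1 \<le> 0" "a \<le> c" "a + 1 \<le> c"
    by (rule that[of "min 0 c - 1"]) auto
  have int: "g integrable_on {x..y}" for x y by (rule continuous_integrable_Icc[OF g])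
  have comb: "integral {x..y} g + integral {y..z} g = integral {x..z} g" if "x \<le> y" "y \<le> z" for x y z
    by (rule Henstock_Kurzweil_Integration.integral_combine[OF that int])
  have shift1: "integral {x..y} g = integral {x+1..y+1} g" for x y
    using integral_shift_Icc_real[of x y g 1] per by (simp add: o_def add.commute)
  have period: "integral {x..x+1} g = integral {a..a+1} g" if "a + 1 \<le> x" for x
    using comb[of a x "x+1"] comb[of a "a+1" "x+1"] shift1[of a x] that by simp
  have "integral {0..1} (\<lambda>u. g (u + c)) = integral {c..c+1} g"
    using integral_shift_Icc_real[of 0 1 g c] by (simp add: o_def add.commute)
  thus ?thesis using period[of c] period[of 0] a by simp
qed

section \<open>Phases on the unit circle and iterated circle averages\<close>

definition ee :: "real \<Rightarrow> complex" where "ee u = cis (2 * pi * u)"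

lemma norm_ee [simp]: "cmod (ee u) = 1"
  by (simp add: ee_def)

lemma ee_nonzero [simp]: "ee u \<noteq> 0"
  by (simp add: ee_def)

lemma ee_add: "ee (u + v) = ee u * ee v"
  by (simp add: ee_def cis_mult distrib_left)

lemma ee_of_nat [simp]: "ee (real n) = 1"
  unfolding ee_def by (rule cis_multiple_2pi) simp

lemma ee_add_of_nat [simp]: "ee (u + real n) = ee u"
  by (subst ee_add) simp

lemma ee_add_1 [simp]: "ee (u + 1) = ee u"
  using ee_add_of_nat[of u 1] by simp

text \<open>The sign change under a half-period shift is what makes the odd circle means below
  vanish.\<close>

lemma ee_half: "ee (u + 1 / 2) = - ee u"
  by (simp add: ee_add) (simp add: ee_def)

lemma continuous_on_ee [continuous_intros]:
  "continuous_on S f \<Longrightarrow> continuous_on S (\<lambda>x. ee (f x))"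
  unfolding ee_def by (intro continuous_intros)

lemma cmod_ee_diff_le: "cmod (ee u - ee v) \<le> 2 * pi * \<bar>u - v\<bar>"
proof -
  have "ee u - ee v = ee v * (cis (2 * pi * (u - v)) - 1)"
    by (simp add: ee_def ring_distribs cis_mult)
  hence "cmod (ee u - ee v) = cmod (cis (2 * pi * (u - v)) - 1)"
    by (simp only: norm_mult norm_ee mult_1)
  also have "\<dots> = cmod (exp (\<i> * complex_of_real (2 * pi * (u - v))) - 1)"
    by (simp only: cis_conv_exp)
  also have "\<dots> = 2 * \<bar>sin (pi * (u - v))\<bar>"
    using dist_exp_i_1[of "2 * pi * (u - v)"] by (simp add: mult.commute)
  also have "\<dots> \<le> 2 * \<bar>pi * (u - v)\<bar>" by (intro mult_left_mono abs_sin_x_le_abs_x) auto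
  finally show ?thesis by (simp add: abs_mult)
qed

text \<open>The phase of A only shifts u by \<open>Arg A / (2 * pi)\<close>, and a mean over a full
  period is invariant under shifts.\<close>

lemma integral_circle_rotate:
  fixes h :: "complex \<Rightarrow> real"
  assumes h: "continuous_on UNIV h"
  shows "integral {0..1} (\<lambda>u. h (A * ee u)) = integral {0..1} (\<lambda>u. h (cmod A * ee u))"
proof -
  define c where "c = Arg A / (2 * pi)"
  have A: "A = cmod A * ee c" using rcis_cmod_Arg[of A] by (simp add: c_def rcis_def ee_def)
  have "A * ee u = cmod A * ee (u + c)" for u
    by (subst A) (simp only: ee_add mult_ac)
  hence "integral {0..1} (\<lambda>u. h (A * ee u)) = integral {0..1} (\<lambda>u. h (cmod A * ee (u + c)))"
    by (simp only:)
  also have "\<dots> = integral {0..1} (\<lambda>u. h (cmod A * ee u))"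
  proof (rule integral_periodic_shift[of "\<lambda>u. h (cmod A * ee u)"])
    show "continuous_on UNIV (\<lambda>u. h (cmod A * ee u))"
      by (intro continuous_on_compose2[OF h] continuous_intros) auto
    show "h (cmod A * ee (u + 1)) = h (cmod A * ee u)" for u
      by (simp only: ee_add_1)
  qed
  finally show ?thesis .
qed

text \<open>The expectation of f at z plus the A's multiplied by independent uniform phases, encoded
  as iterated integrals over one period. The start z collects the phases already fixed; the
  inductions generalise over it.\<close>

fun steinhaus_mean :: "(complex \<Rightarrow> real) \<Rightarrow> complex list \<Rightarrow> complex \<Rightarrow> real" where
  "steinhaus_mean f [] z = f z"
| "steinhaus_mean f (A # As) z = integral {0..1} (\<lambda>u. steinhaus_mean f As (z + A * ee u))"

lemma continuous_circle_mean:
  fixes h :: "complex \<Rightarrow> real"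
  assumes h: "continuous_on UNIV h"
  shows "continuous_on UNIV (\<lambda>z. integral {0..1} (\<lambda>u. h (z + A * ee u)))"
proof -
  have "continuous_on (UNIV \<times> cbox 0 1) (\<lambda>(z, u). h (z + A * ee u))"
    unfolding case_prod_beta
    by (intro continuous_on_compose2[OF h] continuous_intros) auto
  from integral_continuous_on_param[OF this] show ?thesis by simp
qed

lemma continuous_steinhaus_mean:
  assumes "continuous_on UNIV f"
  shows "continuous_on UNIV (steinhaus_mean f As)"
proof (induction As)
  case Nil
  then show ?case using assms by simp
next
  case (Cons A As)
  then show ?case using continuous_circle_mean[OF Cons.IH] by simp
qed

lemma continuous_on_circle:
  fixes h :: "complex \<Rightarrow> 'a::topological_space"
  assumes h: "continuous_on UNIV h"
  shows "continuous_on S (\<lambda>u. h (z + A * ee u))"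
  by (intro continuous_on_compose2[OF h] continuous_intros) auto

lemma steinhaus_mean_integrable:
  assumes "continuous_on UNIV f"
  shows "(\<lambda>u. steinhaus_mean f As (z + A * ee u)) integrable_on {0..1}"
  by (intro integrable_continuous_interval continuous_on_circle continuous_steinhaus_mean assms)

lemma steinhaus_mean_mono:
  assumes "continuous_on UNIV f" "continuous_on UNIV g" "\<And>z. f z \<le> g z"
  shows "steinhaus_mean f As z \<le> steinhaus_mean g As z"
  using assms
proof (induction As arbitrary: z)
  case (Cons A As)
  show ?case
    by (auto intro!: integral_le steinhaus_mean_integrable Cons)
qed simp

lemma steinhaus_mean_lin:
  assumes "continuous_on UNIV f" "continuous_on UNIV g"
  shows "steinhaus_mean (\<lambda>z. a * f z + b * g z) As z
       = a * steinhaus_mean f As z + b * steinhaus_mean g As z"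
proof (induction As arbitrary: z)
  case (Cons A As)
  have "integral {0..1} (\<lambda>u. a * steinhaus_mean f As (z + A * ee u) + b * steinhaus_mean g As (z + A * ee u))
     = a * integral {0..1} (\<lambda>u. steinhaus_mean f As (z + A * ee u)) 
       + b * integral {0..1} (\<lambda>u. steinhaus_mean g As (z + A * ee u))"
    by (subst integral_add)
       (auto intro!: integrable_on_mult_right steinhaus_mean_integrable assms)
  thus ?case using Cons by simp
qed simp

lemma steinhaus_mean_const [simp]: "steinhaus_mean (\<lambda>z. c) As z = c"
  by (induction As arbitrary: z) auto

lemma steinhaus_mean_swap:
  assumes f: "continuous_on UNIV f"
  shows "steinhaus_mean f (A # B # As) z = steinhaus_mean f (B # A # As) z"
proof -
  let ?h = "steinhaus_mean f As"
  have "continuous_on (cbox (0,0) (1,1::real)) (\<lambda>(u, v). ?h (z + A * ee u + B * ee v))"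
    unfolding case_prod_beta
    by (intro continuous_on_compose2[OF continuous_steinhaus_mean[OF f]] continuous_intros) auto
  from integral_swap_continuous[OF this] show ?thesis
    by (simp add: add_ac)
qed

text \<open>By Fubini the coefficients may be permuted, so a coefficient that outweighs the others
  can be assumed to come first.\<close>

lemma steinhaus_mean_front:
  assumes f: "continuous_on UNIV f"
  shows "steinhaus_mean f (Bs @ A # As) z = steinhaus_mean f (A # Bs @ As) z"
proof (induction Bs arbitrary: z)
  case (Cons B Bs)
  have "steinhaus_mean f ((B # Bs) @ A # As) z = steinhaus_mean f (B # A # Bs @ As) z"
    using Cons by simp
  thus ?case using steinhaus_mean_swap[OF f] by simp
qed simp

lemma steinhaus_mean_minus:
  assumes f: "continuous_on UNIV f"
  shows "steinhaus_mean (\<lambda>z. f (- z)) As z = steinhaus_mean f As (- z)"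
proof (induction As arbitrary: z)
  case (Cons A As)
  have "steinhaus_mean (\<lambda>z. f (- z)) (A # As) z
      = integral {0..1} (\<lambda>u. steinhaus_mean f As (- z + A * ee (u + 1 / 2)))"
    by (simp add: Cons ee_half)
  also have "\<dots> = integral {0..1} (\<lambda>u. steinhaus_mean f As (- z + A * ee u))"
    by (rule integral_periodic_shift[of "\<lambda>u. steinhaus_mean f As (- z + A * ee u)"])
       (simp_all only: ee_add_1 continuous_on_circle continuous_steinhaus_mean f)
  finally show ?case by simp
qed simp

section \<open>Lacunary sums and independent phases\<close>

text \<open>On each cell v runs over a full unit: a function of period 1 / n does not see j, while a
  slow factor moves little.\<close>

lemma integral_split_periods:
  fixes h :: "real \<Rightarrow> real"
  assumes h: "continuous_on UNIV h" and n: "n > 0"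
  shows "integral {0..1} h = (\<Sum>j<n. integral {0..1} (\<lambda>v. h ((real j + v) / real n))) / real n"
proof -
  have int: "h integrable_on {x..y}" for x y by (rule continuous_integrable_Icc[OF h])
  have piece: "integral {0..1} (\<lambda>v. h ((real j + v) / real n)) 
      = real n * integral {real j / real n..real (Suc j) / real n} h" for j
  proof -
    have "(h has_integral integral {real j / real n..real (Suc j) / real n} h)
        (cbox (real j / real n) (real (Suc j) / real n))"
      using integrable_integral[OF int] by simp
    from has_integral_affinity'[OF this, of "1 / real n" "real j / real n"] n
    have "((\<lambda>v. h ((1 / real n) *\<^sub>R v + real j / real n)) has_integral
        real n * integral {real j / real n..real (Suc j) / real n} h)
        (cbox 0 ((real (Suc j) / real n - real j / real n) * real n))"
      by (simp add: mult.commute)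
    moreover have "(1 / real n) *\<^sub>R v + real j / real n = (real j + v) / real n" for v
      by (simp add: add_divide_distrib)
    moreover have "(real (Suc j) / real n - real j / real n) * real n = 1"
      using n by (simp add: diff_divide_distrib[symmetric])
    ultimately have "((\<lambda>v. h ((real j + v) / real n)) has_integral
        real n * integral {real j / real n..real (Suc j) / real n} h) {0..1}"
      by simp
    thus ?thesis by (rule integral_unique)
  qed
  have "(\<Sum>j<m. integral {real j / real n..real (Suc j) / real n} h) = integral {0..real m / real n} h" for m
  proof (induction m)
    case (Suc m)
    show ?case
      using Suc Henstock_Kurzweil_Integration.integral_combine[OF _ _ int, of 0 "real m / real n" "real (Suc m) / real n"]
      by (simp add: divide_right_mono)
  qed simp
  from this[of n] show ?thesis using n by (simp add: piece sum_distrib_left[symmetric])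
qed

lemma has_integral_abs_diff_unit:
  assumes "v \<in> {0..1::real}"
  shows "((\<lambda>w. \<bar>w - v\<bar>) has_integral v\<^sup>2 - v + 1 / 2) {0..1}"
proof -
  have "((\<lambda>w. v - w) has_integral (v * v - v\<^sup>2 / 2) - (v * 0 - 0\<^sup>2 / 2)) {0..v}"
    using assms by (intro fundamental_theorem_of_calculus)
      (auto intro!: derivative_eq_intros simp: has_real_derivative_iff_has_vector_derivative[symmetric])
  hence 1: "((\<lambda>w. \<bar>w - v\<bar>) has_integral v\<^sup>2 / 2) {0..v}"
    by (subst has_integral_cong[where g = "\<lambda>w. v - w"]) (auto simp: power2_eq_square)
  have "((\<lambda>w. w - v) has_integral (1\<^sup>2 / 2 - v * 1) - (v\<^sup>2 / 2 - v * v)) {v..1}"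
    using assms by (intro fundamental_theorem_of_calculus)
      (auto intro!: derivative_eq_intros simp: has_real_derivative_iff_has_vector_derivative[symmetric])
  hence 2: "((\<lambda>w. \<bar>w - v\<bar>) has_integral 1 / 2 - v + v\<^sup>2 / 2) {v..1}"
    by (subst has_integral_cong[where g = "\<lambda>w. w - v"]) (auto simp: power2_eq_square)
  have "((\<lambda>w. \<bar>w - v\<bar>) has_integral v\<^sup>2 / 2 + (1 / 2 - v + v\<^sup>2 / 2)) {0..1}"
    using assms by (intro has_integral_combine[OF _ _ 1 2]) auto
  thus ?thesis by (simp add: field_simps)
qed

text \<open>F lives on the diagonal v = w, G on the square; 1 / 3 is the mean distance of two
  independent uniform points of [0,1].\<close>

lemma decoupling_error:
  fixes F :: "real \<Rightarrow> real" and G :: "real \<Rightarrow> real \<Rightarrow> real"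
  assumes F: "continuous_on UNIV F" and G: "continuous_on UNIV (\<lambda>(v, w). G v w)"
    and close: "\<And>v w. \<bar>F w - G v w\<bar> \<le> C * \<bar>w - v\<bar>"
  shows "\<bar>integral {0..1} F - integral {0..1} (\<lambda>v. integral {0..1} (G v))\<bar> \<le> C / 3"
proof -
  have Gv: "G v integrable_on {0..1}" for v
    by (rule continuous_integrable_Icc, rule continuous_on_compose2[OF G, of UNIV "\<lambda>w. (v, w)", simplified])
       (intro continuous_intros)
  have Fi: "F integrable_on {0..1}" by (rule continuous_integrable_Icc[OF F])
  have inner: "\<bar>integral {0..1} F - integral {0..1} (G v)\<bar> \<le> C * (v\<^sup>2 - v + 1 / 2)" if v: "v \<in> {0..1}" for v
  proof -
    have "integral {0..1} F - integral {0..1} (G v) = integral {0..1} (\<lambda>w. F w - G v w)"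
      by (rule integral_diff[OF Fi Gv, symmetric])
    also have "norm \<dots> \<le> integral {0..1} (\<lambda>w. C * \<bar>w - v\<bar>)"
      using close by (intro integral_norm_bound_integral integrable_diff Fi Gv)
        (auto intro!: integrable_on_mult_right has_integral_integrable[OF has_integral_abs_diff_unit[OF v]])
    also have "\<dots> = C * (v\<^sup>2 - v + 1 / 2)"
      using has_integral_abs_diff_unit[OF v] by (simp add: integral_unique)
    finally show ?thesis by simp
  qed
  have "continuous_on (UNIV \<times> cbox 0 1) (\<lambda>(v, w). G v w)"
    by (rule continuous_on_subset[OF G]) simp
  from integral_continuous_on_param[OF this]
  have outer: "(\<lambda>v. integral {0..1} (G v)) integrable_on {0..1}"
    by (intro continuous_integrable_Icc) simp
  have poly: "((\<lambda>v::real. C * (v\<^sup>2 - v + 1 / 2)) has_integral C / 3) {0..1}"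
    by (rule fundamental_theorem_of_calculus[where f = "\<lambda>v. C * (v ^ 3 / 3 - v\<^sup>2 / 2 + v / 2)" and a = 0 and b = 1, THEN has_integral_eq_rhs])
      (auto intro!: derivative_eq_intros simp: has_real_derivative_iff_has_vector_derivative[symmetric] power2_eq_square)
  have "integral {0..1} F - integral {0..1} (\<lambda>v. integral {0..1} (G v))
      = integral {0..1} (\<lambda>v. integral {0..1} F - integral {0..1} (G v))"
    using outer by (subst integral_diff) auto
  also have "norm \<dots> \<le> integral {0..1} (\<lambda>v. C * (v\<^sup>2 - v + 1 / 2))"
    using inner by (intro integral_norm_bound_integral integrable_diff outer has_integral_integrable[OF poly]) auto
  also have "\<dots> = C / 3" using poly by (rule integral_unique)
  finally show ?thesis by simp
qed

text \<open>A Horner scheme for the frequencies 1, \<open>q k\<close>,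
  \<open>q k * q (Suc k)\<close>, and so on. Storing ratios instead of frequencies makes the tail a
  sum of the same kind in the variable \<open>real (q k) * v\<close>.\<close>

fun lacunary_sum :: "(nat \<Rightarrow> nat) \<Rightarrow> nat \<Rightarrow> complex list \<Rightarrow> real \<Rightarrow> complex" where
  "lacunary_sum q k [] v = 0"
| "lacunary_sum q k (A # As) v = A * ee v + lacunary_sum q (Suc k) As (real (q k) * v)"

text \<open>Each coefficient is charged its Lipschitz constant \<open>2 * pi * cmod A / q k\<close>
  on a cell, times the mean distance 1 / 3.\<close>

fun lacunary_error :: "(nat \<Rightarrow> nat) \<Rightarrow> nat \<Rightarrow> complex list \<Rightarrow> real" where
  "lacunary_error q k [] = 0"
| "lacunary_error q k (A # As) = cmod A * (2 * pi / (3 * real (q k))) + lacunary_error q (Suc k) As"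

lemma lacunary_sum_periodic [simp]: "lacunary_sum q k As (v + real n) = lacunary_sum q k As v"
proof (induction As arbitrary: k v n)
  case (Cons A As)
  show ?case using Cons[of "Suc k" "real (q k) * v" "q k * n"] by (simp add: distrib_left)
qed simp

lemma continuous_on_lacunary_sum [continuous_intros]:
  "continuous_on S f \<Longrightarrow> continuous_on S (\<lambda>x. lacunary_sum q k As (f x))"
proof (induction As arbitrary: k f)
  case (Cons A As)
  show ?case using Cons.prems by (auto intro!: continuous_intros Cons.IH)
qed simp

lemma lacunary_decoupling:
  assumes q: "\<And>k. q k > 0"
  shows "\<bar>integral {0..1} (\<lambda>v. cmod (z + lacunary_sum q k As v)) - steinhaus_mean cmod As z\<bar> 
    \<le> lacunary_error q k As"
proof (induction As arbitrary: z k)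
  case (Cons A As)
  let ?n = "real (q k)" and ?S = "lacunary_sum q (Suc k) As"
  have cn: "continuous_on UNIV cmod" by (intro continuous_intros)
  \<comment> \<open>v is the variable of the head and w that of the tail; \<open>D\<close> is the
    true diagonal mean, \<open>M\<close> the mean with an independent tail.\<close>
  define X where "X j v w = cmod (z + A * ee ((real j + v) / ?n) + ?S w)" for j :: nat and v w
  define D where "D j = integral {0..1} (\<lambda>w. X j w w)" for j
  define M where "M j = integral {0..1} (\<lambda>v. steinhaus_mean cmod As (z + A * ee ((real j + v) / ?n)))" for j
  have "integral {0..1} (\<lambda>v. cmod (z + lacunary_sum q k (A # As) v)) = (\<Sum>j<q k. D j) / ?n"
  proof (subst integral_split_periods[of _ "q k"])
    have "?S (?n * ((real j + v) / ?n)) = ?S v" for j v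
      using q[of k] lacunary_sum_periodic[of q "Suc k" As v j] by (simp add: add.commute)
    thus "(\<Sum>j<q k. integral {0..1} (\<lambda>v. cmod (z + lacunary_sum q k (A # As) ((real j + v) / ?n)))) / ?n
      = (\<Sum>j<q k. D j) / ?n"
      by (simp only: D_def X_def lacunary_sum.simps add.assoc)
  qed (use q[of k] in \<open>auto intro!: continuous_intros simp del: lacunary_sum.simps\<close>)
  moreover have "steinhaus_mean cmod (A # As) z = (\<Sum>j<q k. M j) / ?n"
    unfolding M_def steinhaus_mean.simps
    by (subst integral_split_periods[of _ "q k"])
      (use q[of k] in \<open>auto intro!: continuous_on_circle continuous_steinhaus_mean cn\<close>)
  moreover have DM: "\<bar>D j - M j\<bar> \<le> lacunary_error q k (A # As)" for j
  proof -
    \<comment> \<open>The intermediate quantity: head and tail have separate variables, but the tail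
      is still lacunary.\<close>
    define I where "I = integral {0..1} (\<lambda>v. integral {0..1} (X j v))"
    have "\<bar>D j - I\<bar> \<le> cmod A * (2 * pi / ?n) / 3"
      unfolding D_def I_def
    proof (rule decoupling_error)
      show "continuous_on UNIV (\<lambda>w. X j w w)" "continuous_on UNIV (\<lambda>(v, w). X j v w)"
        unfolding X_def case_prod_beta using q[of k] by (intro continuous_intros; simp)+
      fix v w
      have "\<bar>X j w w - X j v w\<bar> \<le> cmod (A * (ee ((real j + w) / ?n) - ee ((real j + v) / ?n)))"
        unfolding X_def by (rule order_trans[OF norm_triangle_ineq3]) (simp add: ring_distribs)
      also have "\<dots> \<le> cmod A * (2 * pi * \<bar>(real j + w) / ?n - (real j + v) / ?n\<bar>)"
        unfolding norm_mult by (intro mult_left_mono cmod_ee_diff_le) auto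
      also have "(real j + w) / ?n - (real j + v) / ?n = (w - v) / ?n"
        by (simp add: diff_divide_distrib add_divide_distrib)
      finally show "\<bar>X j w w - X j v w\<bar> \<le> cmod A * (2 * pi / ?n) * \<bar>w - v\<bar>"
        by (simp add: abs_divide)
    qed
    moreover have "\<bar>I - M j\<bar> \<le> lacunary_error q (Suc k) As"
    proof -
      have "continuous_on (UNIV \<times> cbox 0 1) (\<lambda>(v, w). X j v w)"
        unfolding X_def case_prod_beta using q[of k] by (intro continuous_intros; simp)
      from integral_continuous_on_param[OF this]
      have i1: "(\<lambda>v. integral {0..1} (X j v)) integrable_on {0..1}"
        by (intro continuous_integrable_Icc) simp
      have i2: "(\<lambda>v. steinhaus_mean cmod As (z + A * ee ((real j + v) / ?n))) integrable_on {0..1}"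
        by (intro continuous_integrable_Icc continuous_on_compose2[OF continuous_steinhaus_mean[OF cn]])
          (use q[of k] in \<open>auto intro!: continuous_intros\<close>)
      have "I - M j = integral {0..1} (\<lambda>v. integral {0..1} (X j v)
          - steinhaus_mean cmod As (z + A * ee ((real j + v) / ?n)))"
        unfolding I_def M_def using i1 i2 by (simp add: integral_diff)
      also have "norm \<dots> \<le> integral {0..1} (\<lambda>v::real. lacunary_error q (Suc k) As)"
        by (intro integral_norm_bound_integral integrable_diff i1 i2)
          (use Cons.IH in \<open>auto simp: X_def[abs_def]\<close>)
      finally show ?thesis by simp
    qed
    ultimately show ?thesis by simp
  qed
  ultimately have "\<bar>integral {0..1} (\<lambda>v. cmod (z + lacunary_sum q k (A # As) v)) - steinhaus_mean cmod (A # As) z\<bar>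
      = \<bar>\<Sum>j<q k. D j - M j\<bar> / ?n"
    by (simp only: sum_subtractf diff_divide_distrib[symmetric] abs_divide abs_of_nat)
  also have "\<dots> \<le> (\<Sum>j<q k. lacunary_error q k (A # As)) / ?n"
    using DM by (intro divide_right_mono order_trans[OF sum_abs] sum_mono) auto
  also have "\<dots> = lacunary_error q k (A # As)" using q[of k] by simp
  finally show ?case .
qed simp

section \<open>Bessel functions\<close>

definition bessel_J0 :: "real \<Rightarrow> real" where
  "bessel_J0 x = integral {0..1} (\<lambda>u. cos (x * cos (2 * pi * u)))"

definition bessel_J1 :: "real \<Rightarrow> real" where
  "bessel_J1 x = integral {0..1} (\<lambda>u. cos (2 * pi * u) * sin (x * cos (2 * pi * u)))"

lemma Re_ee [simp]: "Re (ee u) = cos (2 * pi * u)"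
  by (simp add: ee_def)

lemma has_derivative_bessel_J0: "(bessel_J0 has_real_derivative - bessel_J1 x) (at x)"
proof -
  have "((\<lambda>x. integral (cbox 0 1) (\<lambda>u. cos (x * cos (2 * pi * u)))) has_field_derivative
     integral (cbox 0 1) (\<lambda>u. - (cos (2 * pi * u) * sin (x * cos (2 * pi * u))))) (at x within UNIV)"
    by (rule leibniz_rule_field_derivative)
      (auto intro!: derivative_eq_intros continuous_integrable_Icc continuous_intros simp: case_prod_beta)
  thus ?thesis by (simp add: bessel_J0_def[abs_def] bessel_J1_def integral_neg)
qed

text \<open>Integration by parts on the circle: boundary terms cancel. It yields the Bessel equation
  and the cosine moments.\<close>

lemma has_integral_periodic_derivative:
  assumes "\<And>u. (F has_real_derivative f u) (at u)" "F 1 = F 0"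
  shows "(f has_integral 0) {0..1}"
  using fundamental_theorem_of_calculus[of 0 1 F f] assms
  by (auto simp: has_real_derivative_iff_has_vector_derivative[symmetric] intro: has_field_derivative_at_within)

lemma has_derivative_bessel_J1:
  assumes "x \<noteq> 0"
  shows "(bessel_J1 has_real_derivative bessel_J0 x - bessel_J1 x / x) (at x)"
proof -
  let ?c = "\<lambda>u. cos (2 * pi * u)" and ?s = "\<lambda>u. sin (2 * pi * u)"
  have der: "((\<lambda>x. integral (cbox 0 1) (\<lambda>u. ?c u * sin (x * ?c u))) has_field_derivative
     integral (cbox 0 1) (\<lambda>u. (?c u)\<^sup>2 * cos (x * ?c u))) (at x within UNIV)"
    by (rule leibniz_rule_field_derivative)
      (auto intro!: derivative_eq_intros continuous_integrable_Icc continuous_intros simp: case_prod_beta power2_eq_square)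
  \<comment> \<open>Integrating the derivative of \<open>?s u * sin (x * ?c u)\<close> turns
    \<open>bessel_J1 x\<close> into x times the sine-squared part of \<open>bessel_J0 x\<close>; the
    cosine-squared part is the derivative of \<open>bessel_J1\<close>.\<close>
  have "((\<lambda>u. 2 * pi * (?c u * sin (x * ?c u) - x * ((?s u)\<^sup>2 * cos (x * ?c u)))) has_integral 0) {0..1}"
    by (rule has_integral_periodic_derivative[where F = "\<lambda>u. ?s u * sin (x * ?c u)"])
      (auto intro!: derivative_eq_intros simp: power2_eq_square algebra_simps)
  hence "((\<lambda>u. ?c u * sin (x * ?c u) - x * ((?s u)\<^sup>2 * cos (x * ?c u))) has_integral 0) {0..1}"
    using has_integral_mult_right[of _ 0 "{0..1}" "1 / (2 * pi)"] by fastforce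
  hence "bessel_J1 x = x * integral {0..1} (\<lambda>u. (?s u)\<^sup>2 * cos (x * ?c u))"
    unfolding bessel_J1_def
    by (subst integral_mult_right[symmetric], subst eq_iff_diff_eq_0, subst integral_diff[symmetric])
      (auto intro!: continuous_integrable_Icc continuous_intros integral_unique)
  moreover have "bessel_J0 x = integral {0..1} (\<lambda>u. (?s u)\<^sup>2 * cos (x * ?c u))
      + integral {0..1} (\<lambda>u. (?c u)\<^sup>2 * cos (x * ?c u))"
    unfolding bessel_J0_def
    by (subst integral_add[symmetric])
      (auto intro!: continuous_integrable_Icc continuous_intros simp: distrib_right[symmetric])
  ultimately show ?thesis using der assms by (simp add: bessel_J1_def[abs_def])
qed

lemma continuous_on_bessel_J0 [continuous_intros]:
  "continuous_on S f \<Longrightarrow> continuous_on S (\<lambda>x. bessel_J0 (f x))"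
  by (rule continuous_on_compose2[of UNIV bessel_J0])
    (auto intro!: DERIV_isCont has_derivative_bessel_J0 continuous_at_imp_continuous_on)

lemma borel_measurable_bessel_J0 [measurable]: "bessel_J0 \<in> borel_measurable borel"
  by (intro borel_measurable_continuous_onI continuous_intros)

text \<open>The mixed terms of the derivative cancel. This gives a bound on J0 over a whole
  half-line from the values of J0 and J1 at one point, without asymptotics.\<close>

lemma bessel_J0_energy_decreasing:
  assumes "0 < x" "x \<le> y"
  shows "(bessel_J0 y)\<^sup>2 + (bessel_J1 y)\<^sup>2 \<le> (bessel_J0 x)\<^sup>2 + (bessel_J1 x)\<^sup>2"
proof (rule DERIV_nonpos_imp_nonincreasing[OF assms(2)])
  fix t assume t: "x \<le> t" "t \<le> y"
  have "((\<lambda>x. (bessel_J0 x)\<^sup>2 + (bessel_J1 x)\<^sup>2) has_real_derivative - 2 * (bessel_J1 t)\<^sup>2 / t) (at t)"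
    using t assms by (auto intro!: derivative_eq_intros has_derivative_bessel_J0 has_derivative_bessel_J1
      simp: power2_eq_square field_simps)
  thus "\<exists>y. ((\<lambda>x. (bessel_J0 x)\<^sup>2 + (bessel_J1 x)\<^sup>2) has_real_derivative y) (at t) \<and> y \<le> 0"
    using t assms by (intro exI conjI) auto
qed

lemma abs_bessel_J0_le_1: "\<bar>bessel_J0 x\<bar> \<le> 1"
proof -
  have "norm (bessel_J0 x) \<le> integral {0..1} (\<lambda>u::real. 1::real)"
    unfolding bessel_J0_def
    by (intro integral_norm_bound_integral) (auto intro!: continuous_integrable_Icc continuous_intros)
  thus ?thesis by simp
qed

lemma integral_abs_cos: "integral {0..1} (\<lambda>u. \<bar>cos (pi * u)\<bar>) = 2 / pi"
proof -
  have "((\<lambda>u. cos (pi * u)) has_integral sin (pi * (1 / 2)) / pi - sin (pi * 0) / pi) {0..1 / 2}"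
    by (rule fundamental_theorem_of_calculus)
      (auto intro!: derivative_eq_intros simp: has_real_derivative_iff_has_vector_derivative[symmetric])
  hence 1: "((\<lambda>u. \<bar>cos (pi * u)\<bar>) has_integral 1 / pi) {0..1 / 2}"
    by (subst has_integral_cong[where g = "\<lambda>u. cos (pi * u)"])
      (auto intro!: abs_of_nonneg cos_ge_zero simp: mult_le_cancel_left_pos[of pi _ "1 / 2", simplified]
        intro: order_trans[of _ 0])
  have "((\<lambda>u. - cos (pi * u)) has_integral (- sin (pi * 1) / pi) - (- sin (pi * (1 / 2)) / pi)) {1 / 2..1}"
    by (rule fundamental_theorem_of_calculus)
      (auto intro!: derivative_eq_intros simp: has_real_derivative_iff_has_vector_derivative[symmetric])
  moreover have "\<bar>cos (pi * u)\<bar> = - cos (pi * u)" if "u \<in> {1 / 2..1}" for u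
  proof -
    have "cos (pi * u) = - cos (pi - pi * u)" by simp
    moreover have "pi * (1 / 2) \<le> pi * u" "pi * u \<le> pi * 1" using that by (intro mult_left_mono; simp)+
    hence "cos (pi - pi * u) \<ge> 0" using pi_gt_zero by (intro cos_ge_zero) linarith+
    ultimately show ?thesis by linarith
  qed
  ultimately have 2: "((\<lambda>u. \<bar>cos (pi * u)\<bar>) has_integral 1 / pi) {1 / 2..1}"
    by (subst has_integral_cong[where g = "\<lambda>u. - cos (pi * u)"]) auto
  show ?thesis using has_integral_combine[OF _ _ 1 2] by (simp add: integral_unique)
qed

lemma integral_abs_cos_full_period: "integral {0..1} (\<lambda>u. \<bar>cos (2 * pi * u)\<bar>) = 2 / pi"
proof -
  have "\<bar>cos (2 * pi * ((real j + v) / real 2))\<bar> = \<bar>cos (pi * v)\<bar>" for j v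
    by (induction j) (auto simp: distrib_left cos_add add_divide_distrib)
  hence "integral {0..1} (\<lambda>u. \<bar>cos (2 * pi * u)\<bar>) = (\<Sum>j<2::nat. integral {0..1} (\<lambda>v. \<bar>cos (pi * v)\<bar>)) / real 2"
    by (subst integral_split_periods[of _ 2]) (auto intro!: continuous_intros)
  thus ?thesis by (simp add: integral_abs_cos)
qed

lemma abs_bessel_J1_le: "\<bar>bessel_J1 x\<bar> \<le> 2 / pi"
proof -
  have "norm (bessel_J1 x) \<le> integral {0..1} (\<lambda>u. \<bar>cos (2 * pi * u)\<bar>)"
    unfolding bessel_J1_def
    by (intro integral_norm_bound_integral)
      (auto intro!: continuous_integrable_Icc continuous_intros mult_left_le simp: abs_mult)
  thus ?thesis by (simp add: integral_abs_cos_full_period)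
qed

section \<open>J0 as the characteristic function of a uniform point on a circle\<close>

lemma bessel_J0_circle: "integral {0..1} (\<lambda>u. cos (y + Re (A * ee u))) = cos y * bessel_J0 (cmod A)"
proof -
  have c: "integral {0..1} (\<lambda>u. cos (Re (A * ee u))) = bessel_J0 (cmod A)"
    using integral_circle_rotate[of "\<lambda>z. cos (Re z)" A]
    by (simp add: bessel_J0_def continuous_intros)
  have "integral {0..1} (\<lambda>u. sin (Re (A * ee u))) = integral {0..1} (\<lambda>u. sin (Re (A * ee (u + 1 / 2))))"
    by (rule integral_periodic_shift[symmetric]) (auto intro!: continuous_intros simp only: ee_add_1)
  also have "\<dots> = - integral {0..1} (\<lambda>u. sin (Re (A * ee u)))"
    unfolding ee_half mult_minus_right uminus_complex.sel sin_minus by (rule integral_neg)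
  finally have s: "integral {0..1} (\<lambda>u. sin (Re (A * ee u))) = 0" by simp
  have "integral {0..1} (\<lambda>u. cos (y + Re (A * ee u)))
      = integral {0..1} (\<lambda>u. cos y * cos (Re (A * ee u)) - sin y * sin (Re (A * ee u)))"
    by (simp only: cos_add)
  also have "\<dots> = cos y * integral {0..1} (\<lambda>u. cos (Re (A * ee u))) - sin y * integral {0..1} (\<lambda>u. sin (Re (A * ee u)))"
    by (subst integral_diff) (auto intro!: continuous_integrable_Icc continuous_intros)
  finally show ?thesis using c s by simp
qed

lemma bessel_J0_cmod: "bessel_J0 (cmod z) = integral {0..1} (\<lambda>u. cos (Re (z * ee u)))"
  using bessel_J0_circle[of 0 z] by simp

text \<open>Multiplicativity of characteristic functions: \<open>bessel_J0 (cmod z)\<close> is the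
  mean of \<open>cos (Re (z * ee v))\<close> over the directions v, and in a fixed direction the
  circle average factors out.\<close>

lemma bessel_J0_product:
  "integral {0..1} (\<lambda>u. bessel_J0 (cmod (w + A * ee u))) = bessel_J0 (cmod w) * bessel_J0 (cmod A)"
proof -
  have "integral {0..1} (\<lambda>u. bessel_J0 (cmod (w + A * ee u)))
      = integral {0..1} (\<lambda>u. integral {0..1} (\<lambda>v. cos (Re ((w + A * ee u) * ee v))))"
    by (simp only: bessel_J0_cmod)
  also have "\<dots> = integral {0..1} (\<lambda>v. integral {0..1} (\<lambda>u. cos (Re ((w + A * ee u) * ee v))))"
  proof -
    have "continuous_on (cbox (0,0) (1,1::real)) (\<lambda>(u, v). cos (Re ((w + A * ee u) * ee v)))"
      unfolding case_prod_beta by (intro continuous_intros)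
    from integral_swap_continuous[OF this] show ?thesis by simp
  qed
  also have "\<dots> = integral {0..1} (\<lambda>v. cos (Re (w * ee v)) * bessel_J0 (cmod A))"
  proof -
    have "(\<lambda>u. cos (Re ((w + A * ee u) * ee v))) = (\<lambda>u. cos (Re (w * ee v) + Re ((A * ee v) * ee u)))" for v
      by (simp add: algebra_simps)
    hence "integral {0..1} (\<lambda>u. cos (Re ((w + A * ee u) * ee v))) = cos (Re (w * ee v)) * bessel_J0 (cmod A)" for v
      using bessel_J0_circle[of "Re (w * ee v)" "A * ee v"] by (simp add: norm_mult)
    thus ?thesis by simp
  qed
  also have "\<dots> = bessel_J0 (cmod w) * bessel_J0 (cmod A)"
    by (simp add: bessel_J0_cmod)
  finally show ?thesis .
qed

lemma bessel_J0_0 [simp]: "bessel_J0 0 = 1"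
  by (simp add: bessel_J0_def)

text \<open>Recovers the first absolute moment from a characteristic function; on the J0 of a circle
  of radius r it gives r. Negative integrands would be cut to 0 by \<open>ennreal\<close>, so it is
  meant for functions bounded by 1.\<close>

definition haagerup_integral :: "(real \<Rightarrow> real) \<Rightarrow> ennreal" where
  "haagerup_integral g = (\<integral>\<^sup>+s. ennreal ((1 - g s) / s\<^sup>2) * indicator {0<..} s \<partial>lborel)"

lemma haagerup_integral_cong:
  "(\<And>s. s > 0 \<Longrightarrow> g s = h s) \<Longrightarrow> haagerup_integral g = haagerup_integral h"
  unfolding haagerup_integral_def by (intro nn_integral_cong) (auto split: split_indicator)

lemma haagerup_integral_scale:
  assumes [measurable]: "g \<in> borel_measurable borel" and a: "a > 0"
  shows "haagerup_integral (\<lambda>s. g (a * s)) = ennreal a * haagerup_integral g"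
proof -
  have "haagerup_integral g = ennreal a *
      (\<integral>\<^sup>+s. ennreal ((1 - g (a * s)) / (a * s)\<^sup>2) * indicator {0<..} (a * s) \<partial>lborel)"
    unfolding haagerup_integral_def using a
    by (subst nn_integral_real_affine[of _ a 0]) auto
  also have "(\<lambda>s. ennreal ((1 - g (a * s)) / (a * s)\<^sup>2) * indicator {0<..} (a * s))
      = (\<lambda>s. ennreal (1 / a\<^sup>2) * (ennreal ((1 - g (a * s)) / s\<^sup>2) * indicator {0<..} s))"
    using a by (auto simp: fun_eq_iff ennreal_mult'[symmetric] power_mult_distrib zero_less_mult_iff
        split: split_indicator)
  also have "(\<integral>\<^sup>+s. \<dots> s \<partial>lborel) = ennreal (1 / a\<^sup>2) * haagerup_integral (\<lambda>s. g (a * s))"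
    unfolding haagerup_integral_def by (rule nn_integral_cmult) measurable
  finally have "ennreal a * haagerup_integral g
      = (ennreal a * ennreal a * ennreal (1 / a\<^sup>2)) * haagerup_integral (\<lambda>s. g (a * s))"
    by (simp only: mult_ac)
  also have "ennreal a * ennreal a * ennreal (1 / a\<^sup>2) = 1"
    using a by (simp add: ennreal_mult'[symmetric] power2_eq_square)
  finally show ?thesis by simp
qed

lemma ennreal_integral_unit:
  fixes f :: "real \<Rightarrow> real"
  assumes "continuous_on UNIV f" "\<And>u. f u \<ge> 0"
  shows "ennreal (integral {0..1} f) = (\<integral>\<^sup>+u. ennreal (f u) * indicator {0..1} u \<partial>lborel)"
  using nn_integral_has_integral_lebesgue'[of "{0..1}" f "integral {0..1} f"] assms
  by (simp add: continuous_integrable_Icc integrable_integral)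

text \<open>Tonelli, applicable because the bound by 1 keeps the integrand nonnegative.\<close>

lemma haagerup_integral_average:
  fixes h :: "real \<Rightarrow> real \<Rightarrow> real"
  assumes cont: "continuous_on UNIV (\<lambda>(s, u). h s u)" and le: "\<And>s u. h s u \<le> 1"
  shows "haagerup_integral (\<lambda>s. integral {0..1} (h s))
    = (\<integral>\<^sup>+u. haagerup_integral (\<lambda>s. h s u) * indicator {0..1} u \<partial>lborel)"
proof -
  have [measurable]: "(\<lambda>p. h (fst p) (snd p)) \<in> borel_measurable (borel \<Otimes>\<^sub>M borel)"
    using borel_measurable_continuous_onI[OF cont] unfolding borel_prod case_prod_beta .
  have [measurable]: "(\<lambda>s. h s u) \<in> borel_measurable borel" for u
    using continuous_on_compose2[OF cont, of UNIV "\<lambda>s. (s, u)"]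
    by (intro borel_measurable_continuous_onI) (simp add: continuous_on_Pair)
  have ch: "continuous_on UNIV (h s)" for s
    using continuous_on_compose2[OF cont, of UNIV "\<lambda>u. (s, u)"]
    by (simp add: continuous_on_Pair)
  have "ennreal ((1 - integral {0..1} (h s)) / s\<^sup>2) * indicator {0<..} s
      = (\<integral>\<^sup>+u. ennreal ((1 - h s u) / s\<^sup>2) * indicator {0<..} s * indicator {0..1} u \<partial>lborel)" for s
  proof (cases "s > 0")
    case True
    have "(1 - integral {0..1} (h s)) / s\<^sup>2 = integral {0..1} (\<lambda>u. (1 - h s u) / s\<^sup>2)"
      using integral_diff[OF integrable_const_ivl[of 1 0 1] continuous_integrable_Icc[OF ch[of s]]] by simp
    moreover have "ennreal (integral {0..1} (\<lambda>u. (1 - h s u) / s\<^sup>2))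
        = (\<integral>\<^sup>+u. ennreal ((1 - h s u) / s\<^sup>2) * indicator {0..1} u \<partial>lborel)"
      using le[of s] True by (intro ennreal_integral_unit continuous_intros ch) auto
    ultimately show ?thesis using True by simp
  qed simp
  hence "haagerup_integral (\<lambda>s. integral {0..1} (h s)) = (\<integral>\<^sup>+s. \<integral>\<^sup>+u. ennreal ((1 - h s u) / s\<^sup>2) * 
      indicator {0<..} s * indicator {0..1} u \<partial>lborel \<partial>lborel)"
    unfolding haagerup_integral_def by simp
  also have "\<dots> = (\<integral>\<^sup>+u. \<integral>\<^sup>+s. ennreal ((1 - h s u) / s\<^sup>2) * 
      indicator {0<..} s * indicator {0..1} u \<partial>lborel \<partial>lborel)"
    by (rule lborel_pair.Fubini'[symmetric]) (unfold case_prod_beta, measurable)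
  also have "\<dots> = (\<integral>\<^sup>+u. haagerup_integral (\<lambda>s. h s u) * indicator {0..1} u \<partial>lborel)"
    unfolding haagerup_integral_def by (intro nn_integral_cong nn_integral_multc) measurable
  finally show ?thesis .
qed

section \<open>Haagerup's formula for the first absolute moment\<close>

lemma haagerup_integral_cos: "haagerup_integral cos = ennreal (pi / 2)"
proof -
  \<comment> \<open>1 / 2 is the limit at 0, where the fundamental theorem also asks for a
    derivative. \<open>F\<close>, found by parts from the sine integral, starts at 0 thanks to 0 / 0
    = 0.\<close>
  define f where "f x = (if x = 0 then 1 / 2 else (1 - cos x) / x\<^sup>2)" for x :: real
  define F where "F x = Si x - (1 - cos x) / x" for x :: real
  have "(\<integral>\<^sup>+x. ennreal (f x) * indicator {0..} x \<partial>lborel) = ennreal (pi / 2 - F 0)"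
  proof (rule nn_integral_FTC_atLeast)
    show "f \<in> borel_measurable borel" unfolding f_def by measurable
    show "0 \<le> f x" for x unfolding f_def by auto
    show "DERIV F x :> f x" if "0 \<le> x" for x
    proof (cases "x = 0")
      case False
      thus ?thesis unfolding F_def f_def
        by (auto intro!: derivative_eq_intros DERIV_Si simp: power2_eq_square field_simps)
    next
      case True
      \<comment> \<open>By the half-angle formula the difference quotient at 0 is a square of sinc,
        which is continuous.\<close>
      have "((\<lambda>h. - ((sinc (h / 2))\<^sup>2 / 2)) \<longlongrightarrow> - ((sinc (0 / 2))\<^sup>2 / 2)) (at 0)"
        by (intro isCont_tendsto_compose[OF isCont_sinc] tendsto_intros) auto
      also have "?this \<longleftrightarrow> ((\<lambda>h. (- ((1 - cos h) / h) - - ((1 - cos 0) / 0)) / (h - 0))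
          \<longlongrightarrow> - ((sinc (0 / 2))\<^sup>2 / 2)) (at 0)"
      proof (rule LIM_equal, intro allI impI)
        fix h :: real assume "h \<noteq> 0"
        thus "- ((sinc (h / 2))\<^sup>2 / 2) = (- ((1 - cos h) / h) - - ((1 - cos 0) / 0)) / (h - 0)"
          using cos_double_sin[of "h / 2"] by (simp add: field_simps power2_eq_square)
      qed
      finally have "((\<lambda>h. (- ((1 - cos h) / h) - - ((1 - cos 0) / 0)) / (h - 0)) \<longlongrightarrow> - (1 / 2 :: real)) (at 0)"
        by simp
      hence "((\<lambda>x::real. - ((1 - cos x) / x)) has_real_derivative (- (1 / 2))) (at 0)"
        unfolding has_field_derivative_iff .
      from DERIV_add[OF DERIV_Si this] show ?thesis
        unfolding F_def f_def using True by (simp add: field_simps)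
    qed
    have "((\<lambda>x::real. (1 - cos x) / x) \<longlongrightarrow> 0) at_top"
    proof (rule Lim_null_comparison)
      show "((\<lambda>x::real. 2 / x) \<longlongrightarrow> 0) at_top"
        by (rule tendsto_divide_0[OF tendsto_const filterlim_at_top_imp_at_infinity[OF filterlim_ident]])
      show "\<forall>\<^sub>F x::real in at_top. norm ((1 - cos x) / x) \<le> 2 / x"
        using eventually_gt_at_top[of 0]
      proof eventually_elim
        case (elim x)
        have "\<bar>1 - cos x\<bar> \<le> 2" using cos_ge_minus_one[of x] cos_le_one[of x] by linarith
        thus ?case using elim by (simp add: divide_right_mono)
      qed
    qed
    from tendsto_diff[OF Si_at_top this] show "(F \<longlongrightarrow> pi / 2) at_top"
      unfolding F_def by simp
  qed
  moreover have "F 0 = 0" by (simp add: F_def Si_def zero_ereal_def[symmetric])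
  moreover have "haagerup_integral cos = (\<integral>\<^sup>+x. ennreal (f x) * indicator {0..} x \<partial>lborel)"
    unfolding haagerup_integral_def using AE_lborel_singleton[of 0]
    by (intro nn_integral_cong_AE) (auto simp: f_def split: split_indicator elim!: eventually_mono)
  ultimately show ?thesis by simp
qed

lemma haagerup_integral_one [simp]: "haagerup_integral (\<lambda>s. 1) = 0"
  by (simp add: haagerup_integral_def)

lemma haagerup_integral_cos_scaled: "haagerup_integral (\<lambda>s. cos (s * c)) = ennreal (pi / 2 * \<bar>c\<bar>)"
proof (cases "c = 0")
  case False
  have "haagerup_integral (\<lambda>s. cos (s * c)) = haagerup_integral (\<lambda>s. cos (\<bar>c\<bar> * s))"
    by (intro haagerup_integral_cong) (auto simp: abs_if mult.commute)
  also have "\<dots> = ennreal \<bar>c\<bar> * ennreal (pi / 2)"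
    using False by (subst haagerup_integral_scale) (auto simp: haagerup_integral_cos)
  finally show ?thesis by (simp add: ennreal_mult'[symmetric] mult.commute)
qed simp

text \<open>The factor pi / 2 of the cosine cancels against 2 / pi, the mean of the absolute
  cosine.\<close>

lemma haagerup_integral_bessel_J0: "haagerup_integral (\<lambda>s. bessel_J0 (s * r)) = ennreal \<bar>r\<bar>"
proof -
  have "haagerup_integral (\<lambda>s. bessel_J0 (s * r))
      = haagerup_integral (\<lambda>s. integral {0..1} (\<lambda>u. cos (s * (r * cos (2 * pi * u)))))"
    by (simp add: bessel_J0_def mult.assoc)
  also have "\<dots> = (\<integral>\<^sup>+u. ennreal (pi / 2 * \<bar>r * cos (2 * pi * u)\<bar>) * indicator {0..1} u \<partial>lborel)"
    by (subst haagerup_integral_average)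
      (auto simp: case_prod_beta haagerup_integral_cos_scaled intro!: continuous_intros)
  also have "\<dots> = ennreal (integral {0..1} (\<lambda>u. pi / 2 * \<bar>r * cos (2 * pi * u)\<bar>))"
    by (rule ennreal_integral_unit[symmetric]) (auto intro!: continuous_intros)
  also have "integral {0..1} (\<lambda>u. pi / 2 * \<bar>r * cos (2 * pi * u)\<bar>)
      = pi / 2 * \<bar>r\<bar> * integral {0..1} (\<lambda>u. \<bar>cos (2 * pi * u)\<bar>)"
    by (simp only: abs_mult mult.assoc[symmetric] integral_mult_right)
  finally show ?thesis by (simp add: integral_abs_cos_full_period)
qed

text \<open>The characteristic function of the Steinhaus sum, which is radial, at radius s.\<close>

definition bessel_prod :: "complex list \<Rightarrow> real \<Rightarrow> real" where
  "bessel_prod As s = (\<Prod>A\<leftarrow>As. bessel_J0 (s * cmod A))"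

lemma bessel_prod_simps [simp]:
  "bessel_prod [] s = 1" "bessel_prod (A # As) s = bessel_J0 (s * cmod A) * bessel_prod As s"
  "bessel_prod (As @ Bs) s = bessel_prod As s * bessel_prod Bs s"
  by (simp_all add: bessel_prod_def)

lemma continuous_on_bessel_prod [continuous_intros]:
  "continuous_on S f \<Longrightarrow> continuous_on S (\<lambda>x. bessel_prod As (f x))"
  by (induction As) (auto intro!: continuous_intros)

lemma borel_measurable_bessel_prod [measurable]: "bessel_prod As \<in> borel_measurable borel"
  by (intro borel_measurable_continuous_onI continuous_intros)

lemma abs_bessel_prod_le_1: "\<bar>bessel_prod As s\<bar> \<le> 1"
proof (induction As)
  case (Cons A As)
  have "\<bar>bessel_J0 (s * cmod A)\<bar> * \<bar>bessel_prod As s\<bar> \<le> 1 * 1"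
    using Cons by (intro mult_mono abs_bessel_J0_le_1) auto
  thus ?case by (simp add: abs_mult)
qed simp

lemma abs_le_1_D: "\<bar>x :: real\<bar> \<le> 1 \<Longrightarrow> x \<le> 1" by simp

text \<open>The start w behaves like one more coefficient, with its own factor J0. An averaging over
  the head phase passes inside the functional and is evaluated by the product formula.\<close>

theorem steinhaus_mean_cmod_formula:
  "ennreal (steinhaus_mean cmod As w) = haagerup_integral (\<lambda>s. bessel_J0 (s * cmod w) * bessel_prod As s)"
proof (induction As arbitrary: w)
  case Nil
  show ?case by (simp add: haagerup_integral_bessel_J0)
next
  case (Cons A As)
  have cn: "continuous_on UNIV cmod" by (intro continuous_intros)
  have nonneg: "steinhaus_mean cmod As z \<ge> 0" for z
    using steinhaus_mean_mono[of "\<lambda>_. 0" cmod As z] cn by simp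
  let ?h = "\<lambda>s u. bessel_J0 (s * cmod (w + A * ee u)) * bessel_prod As s"
  have "ennreal (steinhaus_mean cmod (A # As) w)
      = (\<integral>\<^sup>+u. haagerup_integral (\<lambda>s. ?h s u) * indicator {0..1} u \<partial>lborel)"
    unfolding steinhaus_mean.simps
    by (subst ennreal_integral_unit)
      (auto intro!: continuous_on_circle continuous_steinhaus_mean cn nonneg simp: Cons)
  also have "\<dots> = haagerup_integral (\<lambda>s. integral {0..1} (?h s))"
  proof (rule haagerup_integral_average[symmetric])
    show "continuous_on UNIV (\<lambda>(s, u). ?h s u)"
      unfolding case_prod_beta by (intro continuous_intros)
    show "?h s u \<le> 1" for s u
    proof (rule abs_le_1_D)
      have "\<bar>bessel_J0 (s * cmod (w + A * ee u))\<bar> * \<bar>bessel_prod As s\<bar> \<le> 1 * 1"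
        by (intro mult_mono abs_bessel_J0_le_1 abs_bessel_prod_le_1) auto
      thus "\<bar>?h s u\<bar> \<le> 1" by (simp add: abs_mult)
    qed
  qed
  also have "\<dots> = haagerup_integral (\<lambda>s. bessel_J0 (s * cmod w) * bessel_prod (A # As) s)"
  proof (rule haagerup_integral_cong)
    fix s :: real assume s: "s > 0"
    have sc: "s * cmod z = cmod (complex_of_real s * z)" for z
      using s by (simp add: norm_mult)
    have "integral {0..1} (?h s)
        = integral {0..1} (\<lambda>u. bessel_J0 (cmod (s * w + (s * A) * ee u))) * bessel_prod As s"
      by (simp add: sc distrib_left mult.assoc)
    also have "\<dots> = bessel_J0 (s * cmod w) * bessel_J0 (s * cmod A) * bessel_prod As s"
      by (simp only: bessel_J0_product sc)
    finally show "integral {0..1} (?h s) = bessel_J0 (s * cmod w) * bessel_prod (A # As) s"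
      by simp
  qed
  finally show ?case .
qed

lemma steinhaus_mean_cmod_formula_0:
  "ennreal (steinhaus_mean cmod As 0) = haagerup_integral (bessel_prod As)"
  using steinhaus_mean_cmod_formula[of As 0] by simp

lemma cmod_ee_plus_ee: "cmod (ee u + ee v) = 2 * \<bar>cos (pi * (u - v))\<bar>"
proof -
  have "ee u + ee v = ee ((u + v) / 2) * (cis (pi * (u - v)) + cis (- (pi * (u - v))))"
    by (simp add: ee_def cis_mult distrib_left field_simps)
  also have "cis (pi * (u - v)) + cis (- (pi * (u - v))) = complex_of_real (2 * cos (pi * (u - v)))"
    by (simp add: complex_eq_iff)
  finally show ?thesis by (simp only: norm_mult norm_ee norm_of_real abs_mult mult_1 abs_numeral)
qed

text \<open>Two unit coefficients, where the mean modulus is elementary. This exact value controls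
  the tail of J0 and also serves a coefficient with a share slightly above one half.\<close>

lemma haagerup_integral_bessel_J0_squared:
  "haagerup_integral (\<lambda>s. (bessel_J0 s)\<^sup>2) = ennreal (4 / pi)"
proof -
  have "integral {0..1} (\<lambda>v. 2 * \<bar>cos (pi * (u - v))\<bar>) = 4 / pi" for u
  proof -
    have "integral {0..1} (\<lambda>v. \<bar>cos (pi * (v + - u))\<bar>) = integral {0..1} (\<lambda>v. \<bar>cos (pi * v)\<bar>)"
      by (rule integral_periodic_shift) (auto intro!: continuous_intros simp: distrib_left cos_add)
    moreover have "\<bar>cos (pi * (v + - u))\<bar> = \<bar>cos (pi * (u - v))\<bar>" for v
      by (metis add_uminus_conv_diff cos_minus minus_diff_eq mult_minus_right)
    ultimately have "integral {0..1} (\<lambda>v. \<bar>cos (pi * (u - v))\<bar>) = 2 / pi"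
      by (simp add: integral_abs_cos)
    thus ?thesis by simp
  qed
  hence "steinhaus_mean cmod [1, 1] 0 = 4 / pi" by (simp add: cmod_ee_plus_ee)
  moreover have "bessel_prod [1, 1] = (\<lambda>s. (bessel_J0 s)\<^sup>2)"
    by (simp add: fun_eq_iff power2_eq_square)
  ultimately show ?thesis using steinhaus_mean_cmod_formula_0[of "[1, 1]"] by simp
qed

section \<open>Estimates for the Bessel function\<close>

lemma cos_ge_Taylor6: "1 - x\<^sup>2 / 2 + x ^ 4 / 24 - x ^ 6 / 720 \<le> cos x" for x :: real
proof -
  obtain t where "cos x = (\<Sum>m<6. cos_coeff m * x ^ m) + (cos (t + 1/2 * real 6 * pi) / fact 6) * x ^ 6"
    using Maclaurin_cos_expansion[of x 6] by blast
  moreover have "(\<Sum>m<6. cos_coeff m * x ^ m) = 1 - x\<^sup>2 / 2 + x ^ 4 / 24"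
    by (simp add: cos_coeff_def lessThan_nat_numeral fact_numeral)
  moreover have "(cos (t + 1/2 * real 6 * pi) / fact 6) * x ^ 6 \<ge> (- 1 / fact 6) * x ^ 6"
    by (intro mult_right_mono divide_right_mono) auto
  ultimately show ?thesis by (simp add: fact_numeral)
qed

lemma cos_le_Taylor8: "cos x \<le> 1 - x\<^sup>2 / 2 + x ^ 4 / 24 - x ^ 6 / 720 + x ^ 8 / 40320" for x :: real
proof -
  obtain t where "cos x = (\<Sum>m<8. cos_coeff m * x ^ m) + (cos (t + 1/2 * real 8 * pi) / fact 8) * x ^ 8"
    using Maclaurin_cos_expansion[of x 8] by blast
  moreover have "(\<Sum>m<8. cos_coeff m * x ^ m) = 1 - x\<^sup>2 / 2 + x ^ 4 / 24 - x ^ 6 / 720"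
    by (simp add: cos_coeff_def lessThan_nat_numeral fact_numeral)
  moreover have "(cos (t + 1/2 * real 8 * pi) / fact 8) * x ^ 8 \<le> (1 / fact 8) * x ^ 8"
    by (intro mult_right_mono divide_right_mono) auto
  ultimately show ?thesis by (simp add: fact_numeral)
qed

lemma exp_minus_ge_Taylor3: "1 - x + x\<^sup>2 / 2 - x ^ 3 / 6 \<le> exp (- x)" for x :: real
proof -
  obtain t where "exp (- x) = (\<Sum>m<4. ((- x) ^ m) / fact m) + (exp t / fact 4) * (- x) ^ 4"
    using Maclaurin_exp_le[of "- x" 4] by blast
  moreover have "(\<Sum>m<4. ((- x) ^ m) / fact m) = 1 - x + x\<^sup>2 / 2 - x ^ 3 / 6"
    by (simp add: eval_nat_numeral)
  ultimately show ?thesis by simp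
qed

text \<open>The Wallis recursion, from integrating the derivative of
  \<open>?s u * ?c u ^ (n + 1)\<close> over a period.\<close>

lemma cos_power_moment_step:
  assumes "((\<lambda>u. cos (2 * pi * u) ^ n) has_integral m) {0..1}"
  shows "((\<lambda>u. cos (2 * pi * u) ^ (n + 2)) has_integral (n + 1) / (n + 2) * m) {0..1}"
proof -
  let ?c = "\<lambda>u. cos (2 * pi * u)" and ?s = "\<lambda>u. sin (2 * pi * u)"
  have "((\<lambda>u. 2 * pi * (?c u ^ (n + 2) - (n + 1) * (1 - (?c u)\<^sup>2) * ?c u ^ n)) has_integral 0) {0..1}"
  proof (rule has_integral_periodic_derivative[where F = "\<lambda>u. ?s u * ?c u ^ (n + 1)"])
    show "((\<lambda>u. ?s u * ?c u ^ (n + 1)) has_real_derivative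
        2 * pi * (?c u ^ (n + 2) - (n + 1) * (1 - (?c u)\<^sup>2) * ?c u ^ n)) (at u)" for u
    proof -
      have s: "(?s has_real_derivative 2 * pi * ?c u) (at u)"
        and c: "(?c has_real_derivative - (2 * pi * ?s u)) (at u)"
        by (auto intro!: derivative_eq_intros)
      have sq: "1 - (?c u)\<^sup>2 = ?s u * ?s u"
        using sin_squared_eq[of "2 * pi * u"] by (simp add: power2_eq_square)
      show ?thesis unfolding sq Suc_eq_plus1[symmetric]
        by (rule DERIV_cong[OF DERIV_mult[OF s DERIV_power_Suc[OF c, of n]]]) (simp add: algebra_simps)
    qed
  qed simp
  from has_integral_mult_right[OF this, of "1 / (2 * pi * (n + 2))"]
  have "((\<lambda>u. 1 / (2 * pi * (n + 2)) * (2 * pi * (?c u ^ (n + 2) - (n + 1) * (1 - (?c u)\<^sup>2) * ?c u ^ n)))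
      has_integral 0) {0..1}" by (simp only: mult_zero_right)
  also have "(\<lambda>u. 1 / (2 * pi * (n + 2)) * (2 * pi * (?c u ^ (n + 2) - (n + 1) * (1 - (?c u)\<^sup>2) * ?c u ^ n)))
      = (\<lambda>u. ?c u ^ (n + 2) - (n + 1) / (n + 2) * ?c u ^ n)"
    by (simp add: fun_eq_iff divide_simps power2_eq_square) (simp add: algebra_simps)
  finally have "((\<lambda>u. ?c u ^ (n + 2) - (n + 1) / (n + 2) * ?c u ^ n) has_integral 0) {0..1}" .
  from has_integral_add[OF this has_integral_mult_right[OF assms, of "(n + 1) / (n + 2)"]]
  show ?thesis by (simp add: add.commute)
qed

lemma cos_power_moments:
  "((\<lambda>u. cos (2 * pi * u) ^ 2) has_integral 1 / 2) {0..1}"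
  "((\<lambda>u. cos (2 * pi * u) ^ 4) has_integral 3 / 8) {0..1}"
  "((\<lambda>u. cos (2 * pi * u) ^ 6) has_integral 5 / 16) {0..1}"
  "((\<lambda>u. cos (2 * pi * u) ^ 8) has_integral 35 / 128) {0..1}"
proof -
  have "((\<lambda>u. cos (2 * pi * u) ^ 0) has_integral 1) {0..1}"
    using has_integral_const_real[of "1::real" 0 1] by simp
  from cos_power_moment_step[OF this]
  show 2: "((\<lambda>u. cos (2 * pi * u) ^ 2) has_integral 1 / 2) {0..1}" by (simp add: power2_eq_square)
  from cos_power_moment_step[OF 2]
  show 4: "((\<lambda>u. cos (2 * pi * u) ^ 4) has_integral 3 / 8) {0..1}" by simp
  from cos_power_moment_step[OF 4]
  show 6: "((\<lambda>u. cos (2 * pi * u) ^ 6) has_integral 5 / 16) {0..1}" by simp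
  from cos_power_moment_step[OF 6]
  show "((\<lambda>u. cos (2 * pi * u) ^ 8) has_integral 35 / 128) {0..1}" by simp
qed

lemma bessel_J0_has_integral: "((\<lambda>u. cos (x * cos (2 * pi * u))) has_integral bessel_J0 x) {0..1}"
  unfolding bessel_J0_def
  by (intro integrable_integral continuous_integrable_Icc continuous_intros)

text \<open>The Taylor bound for the cosine, averaged over the circle. In y the coefficients of the
  J0 series are those of exp squared, up to signs.\<close>

lemma bessel_J0_ge_Taylor:
  assumes "y = x\<^sup>2 / 4"
  shows "1 - y + y\<^sup>2 / 4 - y ^ 3 / 36 \<le> bessel_J0 x"
proof -
  let ?c = "\<lambda>u. cos (2 * pi * u)"
  have "((\<lambda>u. 1 - x\<^sup>2 / 2 * ?c u ^ 2 + x ^ 4 / 24 * ?c u ^ 4 - x ^ 6 / 720 * ?c u ^ 6) has_integral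
      1 - x\<^sup>2 / 2 * (1 / 2) + x ^ 4 / 24 * (3 / 8) - x ^ 6 / 720 * (5 / 16)) {0..1}"
    using has_integral_const_real[of "1::real" 0 1]
    by (intro has_integral_add has_integral_diff has_integral_mult_right cos_power_moments) simp
  hence "1 - x\<^sup>2 / 2 * (1 / 2) + x ^ 4 / 24 * (3 / 8) - x ^ 6 / 720 * (5 / 16) \<le> bessel_J0 x"
  proof (rule has_integral_le[OF _ bessel_J0_has_integral])
    show "1 - x\<^sup>2 / 2 * ?c u ^ 2 + x ^ 4 / 24 * ?c u ^ 4 - x ^ 6 / 720 * ?c u ^ 6 \<le> cos (x * ?c u)" for u
      using cos_ge_Taylor6[of "x * ?c u"] by (simp add: power_mult_distrib)
  qed
  thus ?thesis by (simp add: assms power_divide)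
qed

lemma bessel_J0_le_Taylor:
  assumes "y = x\<^sup>2 / 4"
  shows "bessel_J0 x \<le> 1 - y + y\<^sup>2 / 4 - y ^ 3 / 36 + y ^ 4 / 576"
proof -
  let ?c = "\<lambda>u. cos (2 * pi * u)"
  have "((\<lambda>u. 1 - x\<^sup>2 / 2 * ?c u ^ 2 + x ^ 4 / 24 * ?c u ^ 4 - x ^ 6 / 720 * ?c u ^ 6 + x ^ 8 / 40320 * ?c u ^ 8)
      has_integral 1 - x\<^sup>2 / 2 * (1 / 2) + x ^ 4 / 24 * (3 / 8) - x ^ 6 / 720 * (5 / 16) + x ^ 8 / 40320 * (35 / 128)) {0..1}"
    using has_integral_const_real[of "1::real" 0 1]
    by (intro has_integral_add has_integral_diff has_integral_mult_right cos_power_moments) simp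
  hence "bessel_J0 x \<le> 1 - x\<^sup>2 / 2 * (1 / 2) + x ^ 4 / 24 * (3 / 8) - x ^ 6 / 720 * (5 / 16) + x ^ 8 / 40320 * (35 / 128)"
  proof (rule has_integral_le[OF bessel_J0_has_integral])
    show "cos (x * ?c u) \<le> 1 - x\<^sup>2 / 2 * ?c u ^ 2 + x ^ 4 / 24 * ?c u ^ 4 - x ^ 6 / 720 * ?c u ^ 6 + x ^ 8 / 40320 * ?c u ^ 8" for u
      using cos_le_Taylor8[of "x * ?c u"] by (simp add: power_mult_distrib)
  qed
  thus ?thesis by (simp add: assms power_divide)
qed

text \<open>11/5 is the cutoff throughout; it lies below the first zero of J0, about 2.405, so that
  J0 is nonnegative on the main range.\<close>

lemma quarter_square_le:
  assumes "0 \<le> x" "x \<le> 11 / 5"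
  shows "x\<^sup>2 / 4 \<le> (121 / 100 :: real)"
proof -
  have "x\<^sup>2 \<le> (11 / 5)\<^sup>2" using assms by (intro power_mono)
  thus ?thesis by (simp add: power_divide)
qed

lemma bessel_Taylor_nonneg:
  assumes "0 \<le> y" "y \<le> (121 / 100 :: real)"
  shows "0 \<le> 1 - y + y\<^sup>2 / 4 - y ^ 3 / 36"
proof -
  have "y ^ 3 \<le> (121 / 100) ^ 3" using assms by (intro power_mono)
  moreover have "y ^ 3 * 1 = y\<^sup>2 * y" by (simp add: power2_eq_square power3_eq_cube)
  moreover have "y\<^sup>2 * y \<le> y\<^sup>2 * (121 / 100)" using assms by (intro mult_left_mono) auto
  moreover have "0 \<le> (y - 3 / 2)\<^sup>2" by simp
  hence "9 / 4 + y\<^sup>2 \<ge> 3 * y" by (simp add: power2_eq_square algebra_simps)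
  moreover have "0 \<le> (y - 121 / 100)\<^sup>2" by simp
  hence "2 * (121 / 100) * y \<le> y\<^sup>2 + (121 / 100)\<^sup>2" by (simp add: power2_eq_square algebra_simps)
  ultimately show ?thesis using assms by (simp add: power_divide)
qed

lemma exp_Taylor3_nonneg:
  assumes "0 \<le> y" "y \<le> (121 / 100 :: real)"
  shows "0 \<le> 1 - y + y\<^sup>2 / 2 - y ^ 3 / 6"
proof -
  have "y ^ 3 \<le> (121 / 100) ^ 3" using assms by (intro power_mono)
  moreover have "0 \<le> (1 - y)\<^sup>2" by simp
  hence "2 * y \<le> 1 + y\<^sup>2" by (simp add: power2_eq_square algebra_simps)
  ultimately show ?thesis by (simp add: power_divide)
qed

lemma bessel_J0_nonneg:
  assumes "0 \<le> x" "x \<le> 11 / 5"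
  shows "0 \<le> bessel_J0 x"
  using bessel_Taylor_nonneg[OF _ quarter_square_le[OF assms]]
  by (intro order_trans[OF _ bessel_J0_ge_Taylor[OF refl]]) simp

text \<open>The exponent is the Taylor polynomial of ln J0 up to fourth order. Its quartic term is
  the gain over the Gaussian that later pays for the tail.\<close>

lemma bessel_J0_le_exp:
  assumes x: "0 \<le> x" "x \<le> 11 / 5"
  shows "bessel_J0 x \<le> exp (- (x\<^sup>2 / 4 + x ^ 4 / 64))"
proof -
  define y where "y = x\<^sup>2 / 4"
  have y: "0 \<le> y" "y \<le> 121 / 100" using quarter_square_le[OF x] by (auto simp: y_def)
  have "y\<^sup>2 \<le> (121 / 100)\<^sup>2" using y by (intro power_mono)
  hence y2: "y\<^sup>2 / 4 \<le> 1" by (simp add: power_divide)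
  have "bessel_J0 x \<le> 1 - y + y\<^sup>2 / 4 - y ^ 3 / 36 + y ^ 4 / 576"
    by (rule bessel_J0_le_Taylor[OF y_def])
  also have "\<dots> \<le> (1 - y + y\<^sup>2 / 2 - y ^ 3 / 6) * (1 - y\<^sup>2 / 4)"
  proof -
    \<comment> \<open>The difference of the two sides is \<open>y ^ 3\<close> times a quadratic with
      vertex at 73 / 48 and positive minimum.\<close>
    have "0 \<le> (y - 73 / 48)\<^sup>2" by simp
    hence "0 \<le> (1 / 9 - 73 / 576 * y + y\<^sup>2 / 24) * 24" by (simp add: power2_eq_square algebra_simps)
    hence "0 \<le> 1 / 9 - 73 / 576 * y + y\<^sup>2 / 24" by simp
    hence "0 \<le> y ^ 3 * (1 / 9 - 73 / 576 * y + y\<^sup>2 / 24)" using y by simp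
    thus ?thesis by (simp add: field_simps eval_nat_numeral)
  qed
  also have "\<dots> \<le> exp (- y) * exp (- (y\<^sup>2 / 4))"
    using y2 exp_ge_add_one_self[of "- (y\<^sup>2 / 4)"] exp_minus_ge_Taylor3[of y] exp_Taylor3_nonneg[OF y]
    by (intro mult_mono) auto
  also have "\<dots> = exp (- (x\<^sup>2 / 4 + x ^ 4 / 64))"
    by (simp add: y_def power_divide flip: exp_add)
  finally show ?thesis .
qed

text \<open>Monotonicity of J0 squared plus J1 squared, with 1/25 + 4/9 < 49/100 at the
  cutoff.\<close>

lemma bessel_J0_tail_le:
  assumes x: "x \<ge> 11 / 5"
  shows "\<bar>bessel_J0 x\<bar> \<le> 7 / 10"
proof -
  have "bessel_J0 (11 / 5) \<le> 1 / 5"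
    using bessel_J0_le_Taylor[OF refl, of "11 / 5"] by (simp add: power_divide)
  hence 1: "(bessel_J0 (11 / 5))\<^sup>2 \<le> (1 / 5)\<^sup>2"
    using bessel_J0_nonneg[of "11 / 5"] by (intro power_mono) auto
  have "2 / pi \<le> 2 / 3" using pi_gt3 by (intro divide_left_mono) auto
  hence "\<bar>bessel_J1 (11 / 5)\<bar> \<le> 2 / 3" using abs_bessel_J1_le[of "11 / 5"] by linarith
  hence 2: "(bessel_J1 (11 / 5))\<^sup>2 \<le> (2 / 3)\<^sup>2" by (metis abs_le_square_iff abs_numeral abs_divide)
  have "(bessel_J0 x)\<^sup>2 \<le> (bessel_J0 (11 / 5))\<^sup>2 + (bessel_J1 (11 / 5))\<^sup>2"
    using bessel_J0_energy_decreasing[OF _ x] by (smt (verit) zero_le_power2 divide_pos_pos)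
  also have "\<dots> \<le> (7 / 10)\<^sup>2" using 1 2 by (simp add: power_divide)
  finally show ?thesis by (metis abs_le_square_iff abs_of_nonneg zero_le_divide_iff zero_le_numeral)
qed

text \<open>Equality at p = 2. With h = p - 2, the bound on b gives decay
  \<open>exp (- (h / 4))\<close>, and 1 + h/2 <= exp (h/2) turns this into
  \<open>sqrt (2 / p)\<close>, the factor that also appears in the scaled quartic gain.\<close>

lemma powr_tail_decay:
  assumes b: "0 \<le> b" "b \<le> 7 / 10" and p: "p \<ge> (2::real)"
  shows "b powr p \<le> sqrt (2 / p) * b\<^sup>2"
proof (cases "b = 0")
  case False
  define h where "h = p - 2"
  have h: "h \<ge> 0" using p by (simp add: h_def)
  have b0: "b > 0" using b False by simp
  have "ln b \<le> b - 1" using b0 by (rule ln_le_minus_one)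
  hence "b powr h \<le> exp (- (h / 4))"
    using b0 h b mult_left_mono[of "ln b" "- (1 / 4)" h] by (simp add: powr_def mult.commute)
  also have "\<dots> \<le> sqrt (2 / p)"
  proof (rule real_le_rsqrt)
    have "p / 2 \<le> exp (h / 2)" using exp_ge_add_one_self[of "h / 2"] by (simp add: h_def field_simps)
    hence "exp (- (h / 2)) \<le> inverse (p / 2)"
      using p by (subst exp_minus, intro le_imp_inverse_le) auto
    thus "(exp (- (h / 4)))\<^sup>2 \<le> 2 / p" by (simp add: exp_double[symmetric])
  qed
  finally have "b powr h * b\<^sup>2 \<le> sqrt (2 / p) * b\<^sup>2" by (intro mult_right_mono) auto
  moreover have "b powr p = b powr h * b\<^sup>2"
    using b0 by (simp add: h_def powr_diff)
  ultimately show ?thesis by simp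
qed simp

lemma one_minus_exp_scale:
  fixes w :: real
  assumes "0 \<le> \<theta>" "\<theta> \<le> 1"
  shows "\<theta> * (1 - exp (- w)) \<le> 1 - exp (- (\<theta> * w))"
proof -
  have "exp ((1 - \<theta>) *\<^sub>R 0 + \<theta> *\<^sub>R (- w)) \<le> (1 - \<theta>) * exp 0 + \<theta> * exp (- w)"
    by (rule convex_onD[OF exp_convex]) (use assms in auto)
  thus ?thesis by (simp add: algebra_simps)
qed

section \<open>The Bessel integral for large exponents\<close>

definition nn_int_on :: "real set \<Rightarrow> (real \<Rightarrow> real) \<Rightarrow> ennreal" where
  "nn_int_on S f = (\<integral>\<^sup>+x. ennreal (f x) * indicator S x \<partial>lborel)"

lemma nn_int_on_mono:
  "(\<And>x. x \<in> S \<Longrightarrow> f x \<le> g x) \<Longrightarrow> nn_int_on S f \<le> nn_int_on S g"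
  unfolding nn_int_on_def by (intro nn_integral_mono) (auto split: split_indicator intro: ennreal_leI)

lemma nn_int_on_add:
  assumes [measurable]: "S \<in> sets borel" "f \<in> borel_measurable borel" "g \<in> borel_measurable borel"
    and "\<And>x. x \<in> S \<Longrightarrow> 0 \<le> f x" "\<And>x. x \<in> S \<Longrightarrow> 0 \<le> g x"
  shows "nn_int_on S (\<lambda>x. f x + g x) = nn_int_on S f + nn_int_on S g"
proof -
  have "nn_int_on S (\<lambda>x. f x + g x)
      = (\<integral>\<^sup>+x. ennreal (f x) * indicator S x + ennreal (g x) * indicator S x \<partial>lborel)"
    unfolding nn_int_on_def using assms(4,5)
    by (intro nn_integral_cong) (auto split: split_indicator simp: ennreal_plus)
  thus ?thesis unfolding nn_int_on_def by (simp add: nn_integral_add)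
qed

lemma nn_int_on_cmult:
  assumes [measurable]: "S \<in> sets borel" "f \<in> borel_measurable borel" and "c \<ge> 0"
  shows "nn_int_on S (\<lambda>x. c * f x) = ennreal c * nn_int_on S f"
  unfolding nn_int_on_def using assms(3)
  by (subst nn_integral_cmult[symmetric]) (auto simp: ennreal_mult' mult.assoc)

lemma haagerup_integral_split:
  assumes [measurable]: "g \<in> borel_measurable borel" and a: "a > 0"
  shows "haagerup_integral g = nn_int_on {0<..a} (\<lambda>x. (1 - g x) / x\<^sup>2) + nn_int_on {a<..} (\<lambda>x. (1 - g x) / x\<^sup>2)"
proof -
  have "haagerup_integral g = (\<integral>\<^sup>+x. ennreal ((1 - g x) / x\<^sup>2) * indicator {0<..a} x
      + ennreal ((1 - g x) / x\<^sup>2) * indicator {a<..} x \<partial>lborel)"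
    unfolding haagerup_integral_def using a
    by (intro nn_integral_cong) (auto split: split_indicator)
  thus ?thesis unfolding nn_int_on_def by (simp add: nn_integral_add)
qed

lemma nn_int_on_inverse_square:
  assumes a: "a > 0"
  shows "nn_int_on {a<..} (\<lambda>x. 1 / x\<^sup>2) \<le> ennreal (1 / a)"
proof -
  have "nn_int_on {a<..} (\<lambda>x. 1 / x\<^sup>2) \<le> (\<integral>\<^sup>+x. ennreal (1 / x\<^sup>2) * indicator {a..} x \<partial>lborel)"
    unfolding nn_int_on_def by (intro nn_integral_mono) (auto split: split_indicator)
  also have "\<dots> = ennreal (- 0 - (- inverse a))"
  proof (rule nn_integral_FTC_atLeast)
    show "DERIV (\<lambda>x. - inverse x) x :> 1 / x\<^sup>2" if "a \<le> x" for x
      using that a by (auto intro!: derivative_eq_intros simp: power2_eq_square divide_inverse)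
    show "((\<lambda>x::real. - inverse x) \<longlongrightarrow> - 0) at_top"
      by (intro tendsto_minus tendsto_inverse_0_at_top filterlim_ident)
  qed auto
  finally show ?thesis by (simp add: inverse_eq_divide)
qed

section \<open>The Gaussian as comparison function\<close>

lemma nn_integral_gaussian:
  assumes t: "t > 0"
  shows "(\<integral>\<^sup>+s. ennreal (exp (- (t * s\<^sup>2))) * indicator {0<..} s \<partial>lborel) = ennreal (sqrt pi / 2 * t powr (- 1 / 2))"
proof -
  let ?f = "\<lambda>s::real. ennreal (exp (- s\<^sup>2)) * indicator {0<..} s"
  have "(\<integral>\<^sup>+s. ?f s \<partial>lborel) = (\<integral>\<^sup>+s. ennreal (indicator {0..} s *\<^sub>R exp (- s\<^sup>2)) \<partial>lborel)"
    using AE_lborel_singleton[of 0]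
    by (intro nn_integral_cong_AE) (auto split: split_indicator elim!: eventually_mono)
  also have "\<dots> = ennreal (sqrt pi / 2)"
    using gaussian_moment_0 by (subst nn_integral_eq_integral) (auto simp: has_bochner_integral_iff)
  also have "(\<integral>\<^sup>+s. ?f s \<partial>lborel) = ennreal (sqrt t) * (\<integral>\<^sup>+s. ?f (0 + sqrt t * s) \<partial>lborel)"
    using t by (subst nn_integral_real_affine[of ?f "sqrt t" 0]) auto
  also have "(\<lambda>s. ?f (0 + sqrt t * s)) = (\<lambda>s. ennreal (exp (- (t * s\<^sup>2))) * indicator {0<..} s)"
    using t by (auto simp: fun_eq_iff power_mult_distrib zero_less_mult_iff split: split_indicator)
  finally have eq: "ennreal (sqrt t) * (\<integral>\<^sup>+s. ennreal (exp (- (t * s\<^sup>2))) * indicator {0<..} s \<partial>lborel)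
      = ennreal (sqrt pi / 2)" .
  have one: "ennreal (1 / sqrt t) * ennreal (sqrt t) = 1"
    using t by (subst ennreal_mult'[symmetric]) auto
  have "(\<integral>\<^sup>+s. ennreal (exp (- (t * s\<^sup>2))) * indicator {0<..} s \<partial>lborel)
      = ennreal (1 / sqrt t) * (ennreal (sqrt t) * (\<integral>\<^sup>+s. ennreal (exp (- (t * s\<^sup>2))) * indicator {0<..} s \<partial>lborel))"
    by (simp only: mult.assoc[symmetric] one mult_1)
  also have "\<dots> = ennreal (1 / sqrt t * (sqrt pi / 2))"
    unfolding eq using t by (intro ennreal_mult'[symmetric]) auto
  also have "1 / sqrt t = t powr (- (1 / 2))"
    using t by (simp only: powr_minus powr_half_sqrt less_imp_le inverse_eq_divide)
  also have "- (1 / 2) = (- 1 / 2 :: real)" by simp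
  finally show ?thesis by (simp add: mult.commute)
qed

text \<open>The quotient is the integral of \<open>exp (- (t * s\<^sup>2))\<close> over t in [0,1];
  Tonelli leaves Gaussian integrals and the antiderivative of an inverse square root.\<close>

lemma haagerup_integral_exp_square: "haagerup_integral (\<lambda>s. exp (- s\<^sup>2)) = ennreal (sqrt pi)"
proof -
  have "ennreal ((1 - exp (- s\<^sup>2)) / s\<^sup>2) * indicator {0<..} s
      = (\<integral>\<^sup>+t. ennreal (exp (- (t * s\<^sup>2))) * indicator {0<..} s * indicator {0<..1} t \<partial>lborel)" for s :: real
  proof (cases "s > 0")
    case True
    have "((\<lambda>t. exp (- (t * s\<^sup>2))) has_integral (- exp (- (1 * s\<^sup>2)) / s\<^sup>2) - (- exp (- (0 * s\<^sup>2)) / s\<^sup>2)) {0..1}"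
      using True by (intro fundamental_theorem_of_calculus)
        (auto intro!: derivative_eq_intros simp: has_real_derivative_iff_has_vector_derivative[symmetric]
          eval_nat_numeral)
    hence "((\<lambda>t. exp (- (t * s\<^sup>2))) has_integral (1 - exp (- s\<^sup>2)) / s\<^sup>2) {0..1}"
      by (simp add: diff_divide_distrib)
    hence "ennreal ((1 - exp (- s\<^sup>2)) / s\<^sup>2) = (\<integral>\<^sup>+t. ennreal (exp (- (t * s\<^sup>2))) * indicator {0..1} t \<partial>lborel)"
      by (intro nn_integral_has_integral_lebesgue'[symmetric]) auto
    also have "\<dots> = (\<integral>\<^sup>+t. ennreal (exp (- (t * s\<^sup>2))) * indicator {0<..1} t \<partial>lborel)"
      using AE_lborel_singleton[of 0]
      by (intro nn_integral_cong_AE) (auto split: split_indicator elim!: eventually_mono)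
    finally show ?thesis using True by simp
  qed simp
  hence "haagerup_integral (\<lambda>s. exp (- s\<^sup>2)) = (\<integral>\<^sup>+s. \<integral>\<^sup>+t. ennreal (exp (- (t * s\<^sup>2))) * indicator {0<..} s
      * indicator {0<..1} t \<partial>lborel \<partial>lborel)"
    unfolding haagerup_integral_def by simp
  also have "\<dots> = (\<integral>\<^sup>+t. \<integral>\<^sup>+s. ennreal (exp (- (t * s\<^sup>2))) * indicator {0<..} s
      * indicator {0<..1} t \<partial>lborel \<partial>lborel)"
    by (rule lborel_pair.Fubini'[symmetric]) (unfold case_prod_beta, measurable)
  also have "\<dots> = (\<integral>\<^sup>+t. ennreal (sqrt pi / 2 * t powr (- 1 / 2)) * indicator {0<..1} t \<partial>lborel)"
    by (intro nn_integral_cong) (auto simp: nn_integral_multc nn_integral_gaussian split: split_indicator)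
  also have "\<dots> = (\<integral>\<^sup>+t. ennreal (sqrt pi / 2 * t powr (- 1 / 2)) * indicator {0..1} t \<partial>lborel)"
    using AE_lborel_singleton[of 0]
    by (intro nn_integral_cong_AE) (auto split: split_indicator elim!: eventually_mono)
  also have "\<dots> = ennreal (sqrt pi / 2 * (1 powr (- 1 / 2 + 1) / (- 1 / 2 + 1)))"
    by (intro nn_integral_has_integral_lebesgue' has_integral_mult_right has_integral_powr_from_0) auto
  finally show ?thesis by simp
qed

text \<open>This is the right-hand value for the Bessel inequality: it asserts that the p-th power
  of J0 does at least as well as its Gaussian approximation at the origin.\<close>

lemma haagerup_integral_gaussian:
  assumes p: "p > 0"
  shows "haagerup_integral (\<lambda>x. exp (- (p * (x\<^sup>2 / 4)))) = ennreal (sqrt (pi * p) / 2)"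
proof -
  have "haagerup_integral (\<lambda>x. exp (- (p * (x\<^sup>2 / 4)))) = haagerup_integral (\<lambda>x. exp (- (sqrt p / 2 * x)\<^sup>2))"
    using p by (simp add: power_mult_distrib power_divide)
  also have "\<dots> = ennreal (sqrt p / 2) * ennreal (sqrt pi)"
    using p by (subst haagerup_integral_scale[of "\<lambda>x. exp (- x\<^sup>2)"]) (auto simp: haagerup_integral_exp_square)
  finally show ?thesis using p by (simp add: ennreal_mult'[symmetric] real_sqrt_mult mult.commute)
qed

text \<open>Substituting \<open>sqrt (2 / p) * x\<close> matches the Gaussian factors. The quartic
  exponent becomes 2 / p times the one for p = 2, and convexity of exp extracts this 2 / p, which
  cancels against the rescaled square in the denominator. Only the Jacobian
  \<open>sqrt (2 / p)\<close> remains.\<close>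

lemma quartic_gain_scaling:
  assumes p: "p \<ge> 2" and a: "a > 0"
  shows "ennreal (sqrt (2 / p)) * nn_int_on {0<..a} (\<lambda>x. exp (- (x\<^sup>2 / 2)) * (1 - exp (- (x ^ 4 / 32))) / x\<^sup>2)
    \<le> nn_int_on {0<..a} (\<lambda>x. exp (- (p * (x\<^sup>2 / 4))) * (1 - exp (- (p * (x ^ 4 / 64)))) / x\<^sup>2)"
    (is "ennreal ?c * nn_int_on _ ?g2 \<le> nn_int_on _ ?gp")
proof -
  have c: "?c > 0" "?c \<le> 1" and c2: "?c\<^sup>2 = 2 / p" using p by auto
  have c4: "?c ^ 4 = 2 / p * (2 / p)"
  proof -
    have "?c ^ 4 = ?c\<^sup>2 * ?c\<^sup>2" by (simp flip: power_add)
    thus ?thesis by (simp only: c2)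
  qed
  have le: "?g2 x \<le> ?gp (?c * x)" if x: "x > 0" for x
  proof -
    have e1: "p * ((?c * x)\<^sup>2 / 4) = x\<^sup>2 / 2" using p by (simp only: power_mult_distrib c2) simp
    have e2: "p * ((?c * x) ^ 4 / 64) = 2 / p * (x ^ 4 / 32)"
      using p by (simp only: power_mult_distrib c4) (simp add: field_simps)
    have "?g2 x = exp (- (x\<^sup>2 / 2)) * (2 / p * (1 - exp (- (x ^ 4 / 32)))) / (2 / p * x\<^sup>2)"
      using p by (simp add: mult.left_commute[of _ "2 / p"] del: times_divide_eq_left times_divide_eq_right)
    also have "\<dots> \<le> exp (- (x\<^sup>2 / 2)) * (1 - exp (- (2 / p * (x ^ 4 / 32)))) / (2 / p * x\<^sup>2)"
      using p by (intro divide_right_mono mult_left_mono one_minus_exp_scale) auto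
    also have "\<dots> = ?gp (?c * x)" by (simp only: e1 e2) (simp only: power_mult_distrib c2)
    finally show ?thesis .
  qed
  have "nn_int_on {0<..a} ?g2 \<le> (\<integral>\<^sup>+x. ennreal (?gp (?c * x)) * indicator {0<..a} (?c * x) \<partial>lborel)"
    unfolding nn_int_on_def
  proof (intro nn_integral_mono)
    fix x
    show "ennreal (?g2 x) * indicator {0<..a} x \<le> ennreal (?gp (?c * x)) * indicator {0<..a} (?c * x)"
    proof (cases "x \<in> {0<..a}")
      case True
      have "?c * x \<le> 1 * a" using True c by (intro mult_mono) auto
      hence "?c * x \<in> {0<..a}" using True c by auto
      thus ?thesis using True le[of x] by (auto intro!: ennreal_leI simp del: real_sqrt_divide)
    qed simp
  qed
  hence "ennreal ?c * nn_int_on {0<..a} ?g2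
      \<le> ennreal \<bar>?c\<bar> * (\<integral>\<^sup>+x. ennreal (?gp (0 + ?c * x)) * indicator {0<..a} (0 + ?c * x) \<partial>lborel)"
    using c by (intro mult_mono) auto
  also have "\<dots> = nn_int_on {0<..a} ?gp"
    unfolding nn_int_on_def using c by (intro nn_integral_real_affine[symmetric]) auto
  finally show ?thesis .
qed

text \<open>27/1000 is the threshold: the tail loss for exponent 2 is shown to stay below the same
  number.\<close>

lemma quartic_gain_ge:
  "ennreal (27 / 1000) \<le> nn_int_on {0<..11/5} (\<lambda>x. exp (- (x\<^sup>2 / 2)) * (1 - exp (- (x ^ 4 / 32))) / x\<^sup>2)"
proof -
  \<comment> \<open>G is the product of two polynomial minorants: the square of the cubic Taylor
    polynomial of \<open>exp (- y)\<close>, and (w - w^2/2) / x^2 for the quotient. H is its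
    antiderivative.\<close>
  define G :: "real \<Rightarrow> real" where "G = (\<lambda>x. 1 / 32 * x ^ 2 - 1 / 64 * x ^ 4 + 7 / 2048 * x ^ 6 - 5 / 12288 * x ^ 8
    + 1 / 98304 * x ^ 10 + 1 / 196608 * x ^ 12 - 17 / 18874368 * x ^ 14 + 1 / 12582912 * x ^ 16 - 1 / 301989888 * x ^ 18)"
  define H :: "real \<Rightarrow> real" where "H = (\<lambda>x. 1 / 96 * x ^ 3 - 1 / 320 * x ^ 5 + 1 / 2048 * x ^ 7 - 5 / 110592 * x ^ 9
    + 1 / 1081344 * x ^ 11 + 1 / 2555904 * x ^ 13 - 17 / 283115520 * x ^ 15 + 1 / 213909504 * x ^ 17 - 1 / 5737807872 * x ^ 19)"
  have bounds: "0 \<le> G x" "G x \<le> exp (- (x\<^sup>2 / 2)) * (1 - exp (- (x ^ 4 / 32))) / x\<^sup>2"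
    if x: "0 \<le> x" "x \<le> 11 / 5" for x
  proof -
    define y where "y = x\<^sup>2 / 4"
    have y: "0 \<le> y" "y \<le> 121 / 100" using quarter_square_le[OF x] by (auto simp: y_def)
    let ?E = "1 - y + y\<^sup>2 / 2 - y ^ 3 / 6"
    define w where "w = x ^ 4 / 32"
    have w: "w = y\<^sup>2 / 2" by (simp add: w_def y_def power_divide)
    have "y\<^sup>2 \<le> (121 / 100)\<^sup>2" using y by (intro power_mono)
    hence w01: "0 \<le> w" "w \<le> 1" by (auto simp: w power_divide)
    have "G x = ?E\<^sup>2 * (x\<^sup>2 / 32 - x ^ 6 / 2048)"
      by (simp add: G_def y_def power_divide) (simp add: field_simps eval_nat_numeral)
    also have "x\<^sup>2 / 32 - x ^ 6 / 2048 = (w - w\<^sup>2 / 2) / x\<^sup>2"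
      by (cases "x = 0") (simp_all add: w_def field_simps eval_nat_numeral)
    finally have Geq: "G x = ?E\<^sup>2 * ((w - w\<^sup>2 / 2) / x\<^sup>2)" .
    have "w\<^sup>2 \<le> w" using w01 by (simp add: power2_eq_square mult_left_le)
    thus "0 \<le> G x" unfolding Geq using w01 by auto
    have "?E\<^sup>2 \<le> (exp (- y))\<^sup>2"
      using exp_minus_ge_Taylor3[of y] exp_Taylor3_nonneg[OF y] by (intro power_mono)
    moreover have "(exp (- y))\<^sup>2 = exp (- (x\<^sup>2 / 2))"
      by (simp add: y_def flip: exp_double)
    moreover have "w - w\<^sup>2 / 2 \<le> 1 - exp (- w)"
    proof -
      have "exp (- w) \<le> 1 / (1 + w + w\<^sup>2 / 2)"
        unfolding exp_minus divide_inverse[of 1] mult_1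
        using exp_lower_Taylor_quadratic[OF w01(1)] w01 by (intro le_imp_inverse_le) (auto intro: add_pos_nonneg)
      also have "\<dots> \<le> 1 - w + w\<^sup>2 / 2"
      proof -
        have "(1 - w + w\<^sup>2 / 2) * (1 + w + w\<^sup>2 / 2) = 1 + w ^ 4 / 4"
          by (simp add: field_simps eval_nat_numeral)
        hence "1 \<le> (1 - w + w\<^sup>2 / 2) * (1 + w + w\<^sup>2 / 2)" by simp
        moreover have "0 < 1 + w + w\<^sup>2 / 2" using w01 by (simp add: add_pos_nonneg)
        ultimately show ?thesis by (simp add: pos_divide_le_eq)
      qed
      finally show ?thesis by simp
    qed
    ultimately have "?E\<^sup>2 * ((w - w\<^sup>2 / 2) / x\<^sup>2) \<le> exp (- (x\<^sup>2 / 2)) * ((1 - exp (- w)) / x\<^sup>2)"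
      using w01 \<open>w\<^sup>2 \<le> w\<close> by (intro mult_mono divide_right_mono) auto
    thus "G x \<le> exp (- (x\<^sup>2 / 2)) * (1 - exp (- (x ^ 4 / 32))) / x\<^sup>2"
      unfolding Geq by (simp add: w_def)
  qed
  have "(G has_integral H (11 / 5) - H 0) {0..11 / 5}"
    unfolding G_def H_def
    by (rule fundamental_theorem_of_calculus)
      (auto intro!: derivative_eq_intros simp: has_real_derivative_iff_has_vector_derivative[symmetric])
  hence "nn_int_on {0..11/5} G = ennreal (H (11 / 5) - H 0)"
    unfolding nn_int_on_def using bounds(1) by (intro nn_integral_has_integral_lebesgue') auto
  moreover have "27 / 1000 \<le> H (11 / 5) - H 0" by (simp add: H_def power_divide)
  ultimately have "ennreal (27 / 1000) \<le> nn_int_on {0..11/5} G" by (simp add: ennreal_leI)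
  also have "\<dots> \<le> nn_int_on {0<..11/5} G"
    unfolding nn_int_on_def by (intro nn_integral_mono) (auto split: split_indicator simp: G_def)
  also have "\<dots> \<le> nn_int_on {0<..11/5} (\<lambda>x. exp (- (x\<^sup>2 / 2)) * (1 - exp (- (x ^ 4 / 32))) / x\<^sup>2)"
    using bounds(2) by (intro nn_int_on_mono) auto
  finally show ?thesis .
qed

lemma bessel_square_defect_le:
  "nn_int_on {0<..11/5} (\<lambda>x. (1 - (bessel_J0 x)\<^sup>2) / x\<^sup>2) \<le> ennreal (8421 / 10000)"
proof -
  \<comment> \<open>A is the quotient with J0 replaced by its cubic Taylor minorant in y; B is its
    antiderivative.\<close>
  define A :: "real \<Rightarrow> real" where "A = (\<lambda>x. 1 / 2 - 3 / 32 * x ^ 2 + 5 / 576 * x ^ 4 - 17 / 36864 * x ^ 6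
    + 1 / 73728 * x ^ 8 - 1 / 5308416 * x ^ 10)"
  define B :: "real \<Rightarrow> real" where "B = (\<lambda>x. 1 / 2 * x ^ 1 - 1 / 32 * x ^ 3 + 1 / 576 * x ^ 5 - 17 / 258048 * x ^ 7
    + 1 / 663552 * x ^ 9 - 1 / 58392576 * x ^ 11)"
  have bound: "(1 - (bessel_J0 x)\<^sup>2) / x\<^sup>2 \<le> A x" if x: "0 < x" "x \<le> 11 / 5" for x
  proof -
    define y where "y = x\<^sup>2 / 4"
    have y: "0 \<le> y" "y \<le> 121 / 100" using quarter_square_le[of x] x by (auto simp: y_def)
    let ?q = "1 - y + y\<^sup>2 / 4 - y ^ 3 / 36"
    have "?q\<^sup>2 \<le> (bessel_J0 x)\<^sup>2"
      by (intro power_mono bessel_J0_ge_Taylor[OF y_def] bessel_Taylor_nonneg[OF y])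
    hence "(1 - (bessel_J0 x)\<^sup>2) / x\<^sup>2 \<le> (1 - ?q\<^sup>2) / x\<^sup>2" by (intro divide_right_mono) auto
    also have "1 - ?q\<^sup>2 = A x * x\<^sup>2"
      by (simp add: A_def y_def power_divide) (simp add: field_simps eval_nat_numeral)
    finally show ?thesis using x by simp
  qed
  have nonneg: "0 \<le> A x" if x: "0 \<le> x" "x \<le> 11 / 5" for x
  proof (cases "x = 0")
    case False
    have "(bessel_J0 x)\<^sup>2 \<le> 1" using abs_bessel_J0_le_1[of x] by (simp add: abs_square_le_1)
    hence "0 \<le> (1 - (bessel_J0 x)\<^sup>2) / x\<^sup>2" by simp
    thus ?thesis using bound[of x] x False by simp
  qed (simp add: A_def)
  have "(A has_integral B (11 / 5) - B 0) {0..11 / 5}"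
    unfolding A_def B_def
    by (rule fundamental_theorem_of_calculus)
      (auto intro!: derivative_eq_intros simp: has_real_derivative_iff_has_vector_derivative[symmetric])
  hence "nn_int_on {0..11/5} A = ennreal (B (11 / 5) - B 0)"
    unfolding nn_int_on_def using nonneg by (intro nn_integral_has_integral_lebesgue') auto
  moreover have "B (11 / 5) - B 0 \<le> 8421 / 10000" by (simp add: B_def power_divide)
  ultimately have "nn_int_on {0..11/5} A \<le> ennreal (8421 / 10000)" by (simp add: ennreal_leI)
  moreover have "nn_int_on {0<..11/5} A \<le> nn_int_on {0..11/5} A"
    unfolding nn_int_on_def by (intro nn_integral_mono) (auto split: split_indicator)
  moreover have "nn_int_on {0<..11/5} (\<lambda>x. (1 - (bessel_J0 x)\<^sup>2) / x\<^sup>2) \<le> nn_int_on {0<..11/5} A"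
    using bound by (intro nn_int_on_mono) auto
  ultimately show ?thesis by (meson order_trans)
qed

text \<open>The integral is known exactly for exponent 2. Hence the oscillating tail of the Bessel function
  never has to be estimated pointwise: beyond 11/5 the loss is compared with the one for exponent 2.\<close>
lemma haagerup_integral_bessel_power:
  assumes p: "p \<ge> 2"
  shows "ennreal (sqrt (pi * p) / 2) \<le> haagerup_integral (\<lambda>x. \<bar>bessel_J0 x\<bar> powr p)"
proof -
  let ?I = "{0<..11/5::real}" and ?T = "{11/5::real<..}"
  let ?b = "\<lambda>x. \<bar>bessel_J0 x\<bar> powr p" and ?c = "sqrt (2 / p)"
  let ?gauss = "\<lambda>x::real. exp (- (p * (x\<^sup>2 / 4)))"
  \<comment> \<open>Past the cutoff the total mass W of 1 / x^2 splits into a defect T, which counts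
    in the integral, and a loss L, for exponents 2 and p alike.\<close>
  define W where "W = nn_int_on ?T (\<lambda>x. 1 / x\<^sup>2)"
  define T2 where "T2 = nn_int_on ?T (\<lambda>x. (1 - (bessel_J0 x)\<^sup>2) / x\<^sup>2)"
  define L2 where "L2 = nn_int_on ?T (\<lambda>x. (bessel_J0 x)\<^sup>2 / x\<^sup>2)"
  define Tp where "Tp = nn_int_on ?T (\<lambda>x. (1 - ?b x) / x\<^sup>2)"
  define Lp where "Lp = nn_int_on ?T (\<lambda>x. ?b x / x\<^sup>2)"
  have sq_le: "(bessel_J0 x)\<^sup>2 \<le> 1" for x
    using abs_bessel_J0_le_1[of x] by (simp add: abs_square_le_1)
  have b_le: "?b x \<le> 1" for x
    using powr_mono2[of p "\<bar>bessel_J0 x\<bar>" 1] abs_bessel_J0_le_1[of x] p by simp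
  have W2: "T2 + L2 = W"
    unfolding T2_def L2_def W_def
    by (subst nn_int_on_add[symmetric]) (auto simp: sq_le add_divide_distrib[symmetric])
  have Wp: "Tp + Lp = W"
    unfolding Tp_def Lp_def W_def
    by (subst nn_int_on_add[symmetric]) (auto simp: b_le add_divide_distrib[symmetric])
  have W_le: "W \<le> ennreal (5 / 11)"
    using nn_int_on_inverse_square[of "11/5"] by (simp add: W_def)
  \<comment> \<open>The exact total 4 / pi minus the bound on the main range forces the tail defect
    to be at least about 0.4311; as W is at most 5/11, less than 0.027 is left for the loss.\<close>
  have "L2 \<le> ennreal (27 / 1000)"
  proof -
    have "T2 \<noteq> top" "L2 \<noteq> top" using W2 W_le by (auto simp: top_unique)
    then obtain t l where t: "T2 = ennreal t" "t \<ge> 0" and l: "L2 = ennreal l" "l \<ge> 0"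
      by (metis ennreal_cases)
    have "ennreal (4 / pi) = nn_int_on ?I (\<lambda>x. (1 - (bessel_J0 x)\<^sup>2) / x\<^sup>2) + T2"
      unfolding T2_def haagerup_integral_bessel_J0_squared[symmetric]
      by (rule haagerup_integral_split) auto
    also have "\<dots> \<le> ennreal (8421 / 10000) + ennreal t"
      unfolding t(1) by (intro add_mono bessel_square_defect_le) auto
    finally have "4 / pi \<le> 8421 / 10000 + t"
      using t(2) by (simp add: ennreal_plus[symmetric] ennreal_le_iff del: ennreal_plus)
    moreover have "l + t \<le> 5 / 11"
      using W_le t l unfolding W2[symmetric]
      by (simp add: ennreal_plus[symmetric] ennreal_le_iff add.commute del: ennreal_plus)
    moreover have "4 / pi \<ge> 12732 / 10000"
      using pi_approx(2) by (simp add: le_divide_eq)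
    ultimately have "l \<le> 27 / 1000" by linarith
    thus ?thesis using l by (simp add: ennreal_leI)
  qed
  moreover have "Lp \<le> ennreal ?c * L2"
  proof -
    have "Lp \<le> nn_int_on ?T (\<lambda>x. ?c * ((bessel_J0 x)\<^sup>2 / x\<^sup>2))"
      unfolding Lp_def
    proof (rule nn_int_on_mono)
      fix x assume "x \<in> ?T"
      hence "?b x \<le> ?c * \<bar>bessel_J0 x\<bar>\<^sup>2"
        by (intro powr_tail_decay bessel_J0_tail_le p) auto
      thus "?b x / x\<^sup>2 \<le> ?c * ((bessel_J0 x)\<^sup>2 / x\<^sup>2)"
        by (simp add: divide_right_mono del: real_sqrt_divide)
    qed
    also have "\<dots> = ennreal ?c * L2"
      unfolding L2_def using p by (intro nn_int_on_cmult) auto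
    finally show ?thesis .
  qed
  ultimately have Lp: "Lp \<le> ennreal ?c * ennreal (27 / 1000)"
    by (meson mult_left_mono order_trans zero_le)
  \<comment> \<open>Both the gain here and the loss \<open>Lp\<close> carry the factor
    \<open>?c\<close>, so the comparison made for exponent 2 settles every p.\<close>
  have core: "nn_int_on ?I (\<lambda>x. (1 - ?gauss x) / x\<^sup>2) + ennreal ?c * ennreal (27 / 1000)
      \<le> nn_int_on ?I (\<lambda>x. (1 - ?b x) / x\<^sup>2)"
  proof -
    let ?g = "\<lambda>x. ?gauss x * (1 - exp (- (p * (x ^ 4 / 64)))) / x\<^sup>2"
    have "ennreal ?c * ennreal (27 / 1000) \<le> nn_int_on ?I ?g"
      by (rule order_trans[OF mult_left_mono[OF quartic_gain_ge] quartic_gain_scaling]) (use p in auto)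
    hence "nn_int_on ?I (\<lambda>x. (1 - ?gauss x) / x\<^sup>2) + ennreal ?c * ennreal (27 / 1000)
        \<le> nn_int_on ?I (\<lambda>x. (1 - ?gauss x) / x\<^sup>2) + nn_int_on ?I ?g"
      by (rule add_left_mono)
    also have "\<dots> = nn_int_on ?I (\<lambda>x. (1 - ?gauss x) / x\<^sup>2 + ?g x)"
      using p by (intro nn_int_on_add[symmetric]) auto
    also have "\<dots> \<le> nn_int_on ?I (\<lambda>x. (1 - ?b x) / x\<^sup>2)"
    proof (rule nn_int_on_mono)
      fix x assume "x \<in> ?I"
      hence x: "0 \<le> x" "x \<le> 11 / 5" by auto
      have "?b x \<le> exp (- (x\<^sup>2 / 4 + x ^ 4 / 64)) powr p"
        using bessel_J0_nonneg[OF x] bessel_J0_le_exp[OF x] p by (intro powr_mono2) auto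
      also have "\<dots> = ?gauss x * exp (- (p * (x ^ 4 / 64)))"
        by (simp add: powr_def algebra_simps flip: exp_add)
      finally have "(1 - ?gauss x * exp (- (p * (x ^ 4 / 64)))) / x\<^sup>2 \<le> (1 - ?b x) / x\<^sup>2"
        by (intro divide_right_mono) auto
      thus "(1 - ?gauss x) / x\<^sup>2 + ?g x \<le> (1 - ?b x) / x\<^sup>2"
        by (simp add: right_diff_distrib diff_divide_distrib)
    qed
    finally show ?thesis .
  qed
  have "ennreal (sqrt (pi * p) / 2) = nn_int_on ?I (\<lambda>x. (1 - ?gauss x) / x\<^sup>2) + nn_int_on ?T (\<lambda>x. (1 - ?gauss x) / x\<^sup>2)"
    using p by (subst haagerup_integral_gaussian[symmetric], simp, intro haagerup_integral_split) auto
  \<comment> \<open>The Gaussian itself is discarded past the cutoff.\<close>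
  also have "\<dots> \<le> nn_int_on ?I (\<lambda>x. (1 - ?gauss x) / x\<^sup>2) + W"
    unfolding W_def by (intro add_left_mono nn_int_on_mono divide_right_mono) auto
  also have "\<dots> \<le> (nn_int_on ?I (\<lambda>x. (1 - ?gauss x) / x\<^sup>2) + ennreal ?c * ennreal (27 / 1000)) + Tp"
    unfolding Wp[symmetric] using Lp by (simp add: add_ac add_left_mono)
  also have "\<dots> \<le> nn_int_on ?I (\<lambda>x. (1 - ?b x) / x\<^sup>2) + Tp"
    by (intro add_right_mono core)
  also have "\<dots> = haagerup_integral ?b"
    unfolding Tp_def by (rule haagerup_integral_split[symmetric]) auto
  finally show ?thesis .
qed

section \<open>The Khintchine inequality for Steinhaus variables\<close>

text \<open>Convexity of exp at the points \<open>ln (x i) / w i\<close>; a vanishing factor is set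
  apart because of the logarithm.\<close>

lemma prod_le_weighted_power_sum:
  fixes x w :: "'a \<Rightarrow> real"
  assumes fin: "finite I" and w: "\<And>i. i \<in> I \<Longrightarrow> w i > 0" "sum w I = 1" and x: "\<And>i. i \<in> I \<Longrightarrow> x i \<ge> 0"
  shows "(\<Prod>i\<in>I. x i) \<le> (\<Sum>i\<in>I. w i * x i powr (1 / w i))"
proof (cases "\<exists>i\<in>I. x i = 0")
  case True
  hence "(\<Prod>i\<in>I. x i) = 0" using fin by auto
  moreover have "0 \<le> (\<Sum>i\<in>I. w i * x i powr (1 / w i))"
    using w by (intro sum_nonneg mult_nonneg_nonneg) (auto intro: less_imp_le)
  ultimately show ?thesis by simp
next
  case False
  hence pos: "x i > 0" if "i \<in> I" for i using x that by (metis order_le_less)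
  have "I \<noteq> {}" using w(2) by auto
  have "(\<Prod>i\<in>I. x i) = exp (\<Sum>i\<in>I. w i *\<^sub>R (ln (x i) / w i))"
  proof -
    have "x i = exp (w i *\<^sub>R (ln (x i) / w i))" if "i \<in> I" for i
      using w(1)[OF that] pos[OF that] by simp
    thus ?thesis unfolding exp_sum[OF fin] by (intro prod.cong refl)
  qed
  also have "\<dots> \<le> (\<Sum>i\<in>I. w i * exp (ln (x i) / w i))"
    using w by (intro convex_on_sum[OF fin \<open>I \<noteq> {}\<close> exp_convex]) (auto intro: less_imp_le)
  also have "\<dots> = (\<Sum>i\<in>I. w i * x i powr (1 / w i))"
    using pos by (intro sum.cong) (auto simp: powr_def dest: pos)
  finally show ?thesis .
qed

text \<open>On functions bounded by 1 the functional is affine and order reversing, so a pointwise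
  upper bound on a characteristic function bounds the moment from below.\<close>

lemma haagerup_integral_convex_combination:
  assumes fin: "finite I" and w: "\<And>i. i \<in> I \<Longrightarrow> w i \<ge> 0" "sum w I = 1"
    and meas: "\<And>i. i \<in> I \<Longrightarrow> g i \<in> borel_measurable borel"
    and g: "\<And>i s. i \<in> I \<Longrightarrow> g i s \<le> 1"
    and f: "\<And>s. s > 0 \<Longrightarrow> f s \<le> (\<Sum>i\<in>I. w i * g i s)"
  shows "(\<Sum>i\<in>I. ennreal (w i) * haagerup_integral (g i)) \<le> haagerup_integral f"
proof -
  have "(\<Sum>i\<in>I. ennreal (w i) * haagerup_integral (g i))
      = (\<integral>\<^sup>+s. (\<Sum>i\<in>I. ennreal (w i) * (ennreal ((1 - g i s) / s\<^sup>2) * indicator {0<..} s)) \<partial>lborel)"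
    unfolding haagerup_integral_def using meas
    by (subst nn_integral_sum) (auto intro!: sum.cong nn_integral_cmult[symmetric])
  also have "\<dots> \<le> haagerup_integral f"
    unfolding haagerup_integral_def
  proof (rule nn_integral_mono)
    fix s :: real
    show "(\<Sum>i\<in>I. ennreal (w i) * (ennreal ((1 - g i s) / s\<^sup>2) * indicator {0<..} s))
        \<le> ennreal ((1 - f s) / s\<^sup>2) * indicator {0<..} s"
    proof (cases "s > 0")
      case True
      have "(\<Sum>i\<in>I. w i * ((1 - g i s) / s\<^sup>2)) = (sum w I - (\<Sum>i\<in>I. w i * g i s)) / s\<^sup>2"
        by (simp add: sum_subtractf[symmetric] sum_divide_distrib right_diff_distrib)
      also have "\<dots> \<le> (1 - f s) / s\<^sup>2"
        unfolding w(2) using f[OF True] by (intro divide_right_mono) auto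
      finally have "ennreal (\<Sum>i\<in>I. w i * ((1 - g i s) / s\<^sup>2)) \<le> ennreal ((1 - f s) / s\<^sup>2)"
        by (rule ennreal_leI)
      moreover have "ennreal (\<Sum>i\<in>I. w i * ((1 - g i s) / s\<^sup>2)) = (\<Sum>i\<in>I. ennreal (w i) * ennreal ((1 - g i s) / s\<^sup>2))"
      proof -
        have nn: "0 \<le> (1 - g i s) / s\<^sup>2" if "i \<in> I" for i using g[OF that] by simp
        have "(\<Sum>i\<in>I. ennreal (w i) * ennreal ((1 - g i s) / s\<^sup>2)) = (\<Sum>i\<in>I. ennreal (w i * ((1 - g i s) / s\<^sup>2)))"
          using w(1) nn by (intro sum.cong ennreal_mult[symmetric]) auto
        also have "\<dots> = ennreal (\<Sum>i\<in>I. w i * ((1 - g i s) / s\<^sup>2))"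
          using w(1) nn by (intro sum_ennreal mult_nonneg_nonneg) auto
        finally show ?thesis ..
      qed
      ultimately show ?thesis using True by simp
    qed simp
  qed
  finally show ?thesis .
qed

section \<open>No coefficient above half of the square sum\<close>

definition sqnorm :: "complex list \<Rightarrow> real" where
  "sqnorm As = (\<Sum>A\<leftarrow>As. (cmod A)\<^sup>2)"

lemma sqnorm_simps [simp]:
  "sqnorm [] = 0" "sqnorm (A # As) = (cmod A)\<^sup>2 + sqnorm As" "sqnorm (As @ Bs) = sqnorm As + sqnorm Bs"
  by (simp_all add: sqnorm_def)

lemma sqnorm_nonneg [simp]: "0 \<le> sqnorm As"
  by (induction As) auto

lemma square_le_sqnorm: "A \<in> set As \<Longrightarrow> (cmod A)\<^sup>2 \<le> sqnorm As"
  by (induction As) (auto intro: add_increasing add_increasing2)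

lemma bessel_prod_nth: "bessel_prod As s = (\<Prod>i<length As. bessel_J0 (s * cmod (As ! i)))"
  by (induction As) (simp_all add: prod.lessThan_Suc_shift del: prod.lessThan_Suc)

lemma sqnorm_nth: "sqnorm As = (\<Sum>i<length As. (cmod (As ! i))\<^sup>2)"
  by (induction As) (simp_all add: sum.lessThan_Suc_shift del: sum.lessThan_Suc)

text \<open>Scaling gives a times \<open>sqrt p\<close>, which is \<open>sqrt \<sigma>\<close>: the
  bound no longer depends on the individual coefficient.\<close>

lemma haagerup_integral_bessel_J0_powr_scaled:
  assumes a: "a > 0" and p: "p * a\<^sup>2 = \<sigma>" "p \<ge> 2"
  shows "ennreal (sqrt pi / 2 * sqrt \<sigma>) \<le> haagerup_integral (\<lambda>s. \<bar>bessel_J0 (s * a)\<bar> powr p)"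
proof -
  have "sqrt \<sigma> = a * sqrt p" using a p(1)[symmetric] by (simp add: real_sqrt_mult)
  hence "ennreal (sqrt pi / 2 * sqrt \<sigma>) = ennreal a * ennreal (sqrt (pi * p) / 2)"
    using a by (simp add: ennreal_mult'[symmetric] real_sqrt_mult mult_ac)
  also have "\<dots> \<le> ennreal a * haagerup_integral (\<lambda>s. \<bar>bessel_J0 s\<bar> powr p)"
    using p by (intro mult_left_mono haagerup_integral_bessel_power) auto
  also have "\<dots> = haagerup_integral (\<lambda>s. \<bar>bessel_J0 (s * a)\<bar> powr p)"
    using a by (subst haagerup_integral_scale[symmetric]) (auto simp: mult.commute)
  finally show ?thesis .
qed

text \<open>With the shares of the square sum as weights, balance says exactly that the exponents
  \<open>1 / w i\<close> are at least 2. All terms obey the same lower bound, so their weighted mean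
  does too.\<close>

lemma haagerup_integral_balanced_nonzero:
  assumes nz: "\<And>A. A \<in> set As \<Longrightarrow> A \<noteq> 0" and bal: "\<And>A. A \<in> set As \<Longrightarrow> 2 * (cmod A)\<^sup>2 \<le> sqnorm As"
  shows "ennreal (sqrt pi / 2 * sqrt (sqnorm As)) \<le> haagerup_integral (bessel_prod As)"
proof (cases "As = []")
  case False
  let ?I = "{..<length As}" and ?a = "\<lambda>i. cmod (As ! i)"
  define \<sigma> where "\<sigma> = sqnorm As"
  define w where "w i = (?a i)\<^sup>2 / \<sigma>" for i
  have a: "?a i > 0" if "i \<in> ?I" for i using nz[of "As ! i"] that by simp
  have \<sigma>: "\<sigma> > 0" unfolding \<sigma>_def sqnorm_nth using a False by (intro sum_pos) auto
  have w: "w i > 0" if "i \<in> ?I" for i using a[OF that] \<sigma> by (simp add: w_def)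
  have sw: "sum w ?I = 1"
    using \<sigma> unfolding w_def sum_divide_distrib[symmetric] by (simp add: \<sigma>_def sqnorm_nth)
  have each: "ennreal (sqrt pi / 2 * sqrt \<sigma>) \<le> haagerup_integral (\<lambda>s. \<bar>bessel_J0 (s * ?a i)\<bar> powr (1 / w i))"
    if i: "i \<in> ?I" for i
  proof (rule haagerup_integral_bessel_J0_powr_scaled[OF a[OF i]])
    show "1 / w i * (?a i)\<^sup>2 = \<sigma>" using a[OF i] by (simp add: w_def)
    show "2 \<le> 1 / w i" using bal[of "As ! i"] i a[OF i] by (simp add: w_def \<sigma>_def le_divide_eq)
  qed
  have "ennreal (sqrt pi / 2 * sqrt \<sigma>) = (\<Sum>i\<in>?I. ennreal (w i)) * ennreal (sqrt pi / 2 * sqrt \<sigma>)"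
    using w sw by (subst sum_ennreal) (auto intro: less_imp_le)
  also have "\<dots> \<le> (\<Sum>i\<in>?I. ennreal (w i) * haagerup_integral (\<lambda>s. \<bar>bessel_J0 (s * ?a i)\<bar> powr (1 / w i)))"
    unfolding sum_distrib_right by (intro sum_mono mult_left_mono each) auto
  also have "\<dots> \<le> haagerup_integral (bessel_prod As)"
  proof (rule haagerup_integral_convex_combination)
    show "\<bar>bessel_J0 (s * ?a i)\<bar> powr (1 / w i) \<le> 1" if "i \<in> ?I" for i s
      using powr_mono2[of "1 / w i" "\<bar>bessel_J0 (s * ?a i)\<bar>" 1] abs_bessel_J0_le_1 w[OF that] by simp
    show "bessel_prod As s \<le> (\<Sum>i\<in>?I. w i * \<bar>bessel_J0 (s * ?a i)\<bar> powr (1 / w i))" for s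
    proof -
      have "bessel_prod As s \<le> \<bar>bessel_prod As s\<bar>" by simp
      also have "\<dots> = (\<Prod>i\<in>?I. \<bar>bessel_J0 (s * ?a i)\<bar>)" by (simp add: bessel_prod_nth abs_prod)
      also have "\<dots> \<le> (\<Sum>i\<in>?I. w i * \<bar>bessel_J0 (s * ?a i)\<bar> powr (1 / w i))"
        by (rule prod_le_weighted_power_sum) (use w sw in auto)
      finally show ?thesis .
    qed
  qed (use w sw in \<open>auto intro: less_imp_le\<close>)
  finally show ?thesis by (simp add: \<sigma>_def)
qed simp

text \<open>Zero coefficients would have weight 0 and an undefined exponent; removing them changes
  neither side.\<close>

lemma haagerup_integral_balanced:
  assumes bal: "\<And>A. A \<in> set As \<Longrightarrow> 2 * (cmod A)\<^sup>2 \<le> sqnorm As"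
  shows "ennreal (sqrt pi / 2 * sqrt (sqnorm As)) \<le> haagerup_integral (bessel_prod As)"
proof -
  let ?Bs = "filter (\<lambda>A. A \<noteq> 0) As"
  have "bessel_prod ?Bs = bessel_prod As" by (rule ext, induction As) auto
  moreover have "sqnorm ?Bs = sqnorm As" by (induction As) auto
  ultimately show ?thesis using haagerup_integral_balanced_nonzero[of ?Bs] bal by auto
qed

lemma steinhaus_mean_cmod_nonneg: "0 \<le> steinhaus_mean cmod As z"
proof -
  have "continuous_on UNIV cmod" by (intro continuous_intros)
  from steinhaus_mean_mono[OF continuous_on_const this, of 0] show ?thesis by simp
qed

text \<open>After decoupling, the square of the rest's characteristic function belongs to the
  doubled list \<open>As @ As\<close>, which is always balanced, and the square of J0 has an exact
  value. The result is a bound linear in a and r.\<close>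

lemma steinhaus_khintchine_one_half:
  assumes dom: "sqnorm As \<le> (cmod A)\<^sup>2" and le: "38 * (cmod A)\<^sup>2 \<le> 62 * sqnorm As"
  shows "sqrt pi / 2 * sqrt (sqnorm (A # As)) \<le> steinhaus_mean cmod (A # As) 0"
proof -
  define a where "a = cmod A"
  define r where "r = sqrt (sqnorm As)"
  have r: "0 \<le> r" "r\<^sup>2 = sqnorm As" and a: "0 \<le> a" by (auto simp: r_def a_def)
  have ra: "r \<le> a"
    using dom unfolding r_def a_def by (intro real_le_lsqrt) auto
  \<comment> \<open>1.2774 rounds up the square root of 62/38.\<close>
  have ar: "a \<le> 12774 / 10000 * r"
  proof (rule power2_le_imp_le)
    have "(12774 / 10000 * r)\<^sup>2 = 163175076 / 100000000 * r\<^sup>2" by (simp add: power2_eq_square)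
    thus "a\<^sup>2 \<le> (12774 / 10000 * r)\<^sup>2"
      using le r(2) sqnorm_nonneg[of As] unfolding a_def[symmetric] by linarith
  qed (use r in simp)
  have "haagerup_integral (\<lambda>s. (bessel_J0 (s * a))\<^sup>2) = ennreal (a * (4 / pi))"
  proof (cases "a = 0")
    case False
    thus ?thesis using a haagerup_integral_scale[of "\<lambda>s. (bessel_J0 s)\<^sup>2" a]
      by (simp add: haagerup_integral_bessel_J0_squared ennreal_mult'[symmetric] mult.commute)
  qed simp
  moreover have "ennreal (sqrt pi / 2 * sqrt (2 * sqnorm As)) \<le> haagerup_integral (bessel_prod (As @ As))"
    using haagerup_integral_balanced[of "As @ As"] square_le_sqnorm[of _ As] by simp
  moreover have "(\<Sum>i\<in>UNIV. ennreal (1 / 2) * haagerup_integral (if i then \<lambda>s. (bessel_J0 (s * a))\<^sup>2 else bessel_prod (As @ As)))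
      \<le> haagerup_integral (bessel_prod (A # As))"
  proof (rule haagerup_integral_convex_combination)
    fix i :: bool and s :: real
    show "(if i then \<lambda>s. (bessel_J0 (s * a))\<^sup>2 else bessel_prod (As @ As)) s \<le> 1"
      using abs_bessel_J0_le_1[of "s * a"] abs_bessel_prod_le_1[of "As @ As" s]
      by (auto simp: abs_square_le_1 abs_le_iff simp del: bessel_prod_simps)
    have "0 \<le> (bessel_J0 (s * a) - bessel_prod As s)\<^sup>2" by simp
    thus "bessel_prod (A # As) s
      \<le> (\<Sum>i\<in>UNIV. 1 / 2 * (if i then \<lambda>s. (bessel_J0 (s * a))\<^sup>2 else bessel_prod (As @ As)) s)"
      by (simp add: UNIV_bool a_def power2_eq_square algebra_simps)
  qed (auto simp: UNIV_bool)
  ultimately have mid: "ennreal (1 / 2) * ennreal (sqrt pi / 2 * sqrt (2 * sqnorm As)) + ennreal (1 / 2) * ennreal (a * (4 / pi))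
      \<le> haagerup_integral (bessel_prod (A # As))"
    by (simp add: UNIV_bool del: bessel_prod_simps) (meson add_mono mult_left_mono order_refl order_trans zero_le)
  have half: "ennreal (1 / 2) * ennreal X = ennreal (1 / 2 * X)" for X
    by (rule ennreal_mult'[symmetric]) simp
  have "ennreal (1 / 2 * (sqrt pi / 2 * sqrt (2 * sqnorm As)) + 1 / 2 * (a * (4 / pi)))
      = ennreal (1 / 2 * (sqrt pi / 2 * sqrt (2 * sqnorm As))) + ennreal (1 / 2 * (a * (4 / pi)))"
    by (rule ennreal_plus) (use a in auto)
  also have "\<dots> \<le> ennreal (steinhaus_mean cmod (A # As) 0)"
    using mid by (simp only: half steinhaus_mean_cmod_formula_0)
  finally have "ennreal (1 / 2 * (sqrt pi / 2 * sqrt (2 * sqnorm As)) + 1 / 2 * (a * (4 / pi)))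
      \<le> ennreal (steinhaus_mean cmod (A # As) 0)" .
  hence lower: "1 / 2 * (sqrt pi / 2 * sqrt (2 * sqnorm As)) + 1 / 2 * (a * (4 / pi)) \<le> steinhaus_mean cmod (A # As) 0"
    using steinhaus_mean_cmod_nonneg[of "A # As" 0] by (simp only: ennreal_le_iff)
  \<comment> \<open>The coefficients round down 4 / (pi * sqrt pi) and sqrt 2 / 2, the linear lower
    bound divided by sqrt pi / 2. The product of differences below encodes that (a, r) lies in the
    cone between the rays a = r and a = 1.2774 r.\<close>
  have "sqrt (sqnorm (A # As)) \<le> 718 / 1000 * a + 707 / 1000 * r"
  proof (rule real_le_lsqrt)
    have "0 \<le> (a - r) * (12774 / 10000 * r - a)" using ra ar by simp
    moreover have "(a - r) * (12774 / 10000 * r - a) = 22774 / 10000 * (a * r) - a * a - 12774 / 10000 * (r * r)"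
      by (simp add: field_simps)
    moreover have "a * r \<le> 12774 / 10000 * r * r" using ar r by (intro mult_right_mono) auto
    moreover have "0 \<le> r * r" by simp
    moreover have "(718 / 1000 * a + 707 / 1000 * r)\<^sup>2
        = 515524 / 1000000 * (a * a) + 1015252 / 1000000 * (a * r) + 499849 / 1000000 * (r * r)"
      by (simp add: power2_eq_square field_simps)
    moreover have "sqnorm (A # As) = a * a + r * r"
      by (simp add: a_def r(2)[symmetric] power2_eq_square)
    ultimately show "sqnorm (A # As) \<le> (718 / 1000 * a + 707 / 1000 * r)\<^sup>2" by linarith
  qed (use a r in auto)
  hence "sqrt pi / 2 * sqrt (sqnorm (A # As)) \<le> sqrt pi / 2 * (718 / 1000 * a + 707 / 1000 * r)"
    by (intro mult_left_mono) auto
  also have "\<dots> = (sqrt pi / 2 * (718 / 1000)) * a + sqrt pi / 2 * (707 / 1000 * r)"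
    by (simp add: field_simps)
  also have "\<dots> \<le> (2 / pi) * a + sqrt pi / 2 * (sqrt 2 / 2 * r)"
  proof (intro add_mono mult_right_mono mult_left_mono)
    have "pi ^ 3 \<le> (3142 / 1000) ^ 3" using pi_approx(2) by (intro power_mono) auto
    also have "\<dots> \<le> 31.02" by (simp add: power3_eq_cube)
    finally have "515524 / 1000000 * pi ^ 3 \<le> 16" by simp
    moreover have "(sqrt pi * pi * (718 / 1000))\<^sup>2 = 515524 / 1000000 * pi ^ 3"
      by (simp add: power_mult_distrib power_divide) (simp add: power2_eq_square power3_eq_cube)
    ultimately have "(sqrt pi * pi * (718 / 1000))\<^sup>2 \<le> 4\<^sup>2" by simp
    hence "sqrt pi * pi * (718 / 1000) \<le> 4" by (rule power2_le_imp_le) simp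
    thus "sqrt pi / 2 * (718 / 1000) \<le> 2 / pi" by (simp add: field_simps)
    show "707 / 1000 \<le> sqrt 2 / 2" using real_le_rsqrt[of "1414 / 1000" 2] by (simp add: power_divide)
  qed (use a r in auto)
  also have "\<dots> = 1 / 2 * (sqrt pi / 2 * sqrt (2 * sqnorm As)) + 1 / 2 * (a * (4 / pi))"
    by (simp add: r_def real_sqrt_mult)
  finally show ?thesis using lower by simp
qed

section \<open>A dominant coefficient: moments of the remaining sum\<close>

lemma steinhaus_mean_shift: "steinhaus_mean f As (w + z) = steinhaus_mean (\<lambda>z. f (w + z)) As z"
  by (induction As arbitrary: z) (simp_all add: add.assoc)

text \<open>A factor - i turns Im into Re, and rotation reduces even powers to cosine moments; odd
  powers cancel under a half-period shift.\<close>

lemma circle_Im_moments: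
  "((\<lambda>u. Im (A * ee u)) has_integral 0) {0..1}"
  "((\<lambda>u. (Im (A * ee u))\<^sup>2) has_integral (cmod A)\<^sup>2 / 2) {0..1}"
  "((\<lambda>u. (Im (A * ee u)) ^ 3) has_integral 0) {0..1}"
  "((\<lambda>u. (Im (A * ee u)) ^ 4) has_integral 3 / 8 * (cmod A) ^ 4) {0..1}"
proof -
  have int: "((\<lambda>u. h (A * ee u)) has_integral integral {0..1} (\<lambda>u. h (A * ee u))) {0..1}"
    if "continuous_on UNIV h" for h :: "complex \<Rightarrow> real"
    using continuous_on_circle[OF that, of UNIV 0 A]
    by (intro integrable_integral continuous_integrable_Icc) simp
  have even: "((\<lambda>u. (Im (A * ee u)) ^ n) has_integral m * (cmod A) ^ n) {0..1}"
    if m: "((\<lambda>u. cos (2 * pi * u) ^ n) has_integral m) {0..1}" for n m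
  proof -
    let ?h = "\<lambda>z. (Im z) ^ n"
    have c: "continuous_on UNIV (\<lambda>z. (Re z) ^ n)" "continuous_on UNIV ?h" by (intro continuous_intros)+
    have "integral {0..1} (\<lambda>u. ?h (A * ee u)) = integral {0..1} (\<lambda>u. (Re ((- \<i> * A) * ee u)) ^ n)"
    proof -
      have "Im z = Re (- \<i> * z)" for z by simp
      thus ?thesis by (simp only: mult.assoc)
    qed
    also have "\<dots> = integral {0..1} (\<lambda>u. (Re (complex_of_real (cmod (- \<i> * A)) * ee u)) ^ n)"
      by (rule integral_circle_rotate[OF c(1)])
    also have "\<dots> = integral {0..1} (\<lambda>u. (cmod A) ^ n * cos (2 * pi * u) ^ n)"
      by (simp add: norm_mult power_mult_distrib)
    also have "\<dots> = m * (cmod A) ^ n" using m by (simp add: integral_unique mult.commute)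
    finally show ?thesis using int[OF c(2)] by simp
  qed
  have odd: "((\<lambda>u. (Im (A * ee u)) ^ n) has_integral 0) {0..1}" if n: "odd n" for n
  proof -
    let ?h = "\<lambda>z. (Im z) ^ n"
    have c: "continuous_on UNIV ?h" by (intro continuous_intros)
    have "integral {0..1} (\<lambda>u. ?h (A * ee u)) = integral {0..1} (\<lambda>u. ?h (A * ee (u + 1 / 2)))"
      by (rule integral_periodic_shift[symmetric])
        (auto intro!: continuous_intros simp only: ee_add_1)
    also have "\<dots> = - integral {0..1} (\<lambda>u. ?h (A * ee u))"
      unfolding ee_half mult_minus_right uminus_complex.sel power_minus_odd[OF n] by (rule integral_neg)
    finally show ?thesis using int[OF c] by simp
  qed
  show "((\<lambda>u. Im (A * ee u)) has_integral 0) {0..1}" using odd[of 1] by simp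
  show "((\<lambda>u. (Im (A * ee u)) ^ 3) has_integral 0) {0..1}" using odd[of 3] by simp
  show "((\<lambda>u. (Im (A * ee u))\<^sup>2) has_integral (cmod A)\<^sup>2 / 2) {0..1}"
    using even[OF cos_power_moments(1)] by simp
  show "((\<lambda>u. (Im (A * ee u)) ^ 4) has_integral 3 / 8 * (cmod A) ^ 4) {0..1}"
    using even[OF cos_power_moments(2)] by simp
qed

lemma circle_Im_square: "((\<lambda>u. (x + Im (A * ee u))\<^sup>2) has_integral x\<^sup>2 + (cmod A)\<^sup>2 / 2) {0..1}"
proof -
  have "((\<lambda>u. x\<^sup>2 + 2 * x * Im (A * ee u) + (Im (A * ee u))\<^sup>2) has_integral x\<^sup>2 + 2 * x * 0 + (cmod A)\<^sup>2 / 2) {0..1}"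
    using has_integral_const_real[of "x\<^sup>2" 0 1]
    by (intro has_integral_add has_integral_mult_right circle_Im_moments) simp
  thus ?thesis by (simp add: power2_sum add_ac)
qed

lemma circle_Im_fourth:
  "((\<lambda>u. (x + Im (A * ee u)) ^ 4) has_integral x ^ 4 + 3 * x\<^sup>2 * (cmod A)\<^sup>2 + 3 / 8 * (cmod A) ^ 4) {0..1}"
proof -
  have "((\<lambda>u. x ^ 4 + 4 * x ^ 3 * Im (A * ee u) + 6 * x\<^sup>2 * (Im (A * ee u))\<^sup>2 + 4 * x * (Im (A * ee u)) ^ 3
      + (Im (A * ee u)) ^ 4) has_integral
      x ^ 4 + 4 * x ^ 3 * 0 + 6 * x\<^sup>2 * ((cmod A)\<^sup>2 / 2) + 4 * x * 0 + 3 / 8 * (cmod A) ^ 4) {0..1}"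
    using has_integral_const_real[of "x ^ 4" 0 1]
    by (intro has_integral_add has_integral_mult_right circle_Im_moments) simp
  moreover have "x ^ 4 + 4 * x ^ 3 * y + 6 * x\<^sup>2 * y\<^sup>2 + 4 * x * y ^ 3 + y ^ 4 = (x + y) ^ 4" for y
    by (simp add: eval_nat_numeral algebra_simps)
  ultimately show ?thesis by (simp add: mult.assoc del: times_complex.sel)
qed

lemma steinhaus_mean_Im_square:
  assumes "cmod \<omega> = 1"
  shows "steinhaus_mean (\<lambda>z. (Im (\<omega> * z))\<^sup>2) As z = (Im (\<omega> * z))\<^sup>2 + sqnorm As / 2"
proof (induction As arbitrary: z)
  case (Cons A As)
  have I: "((\<lambda>u. (Im (\<omega> * (z + A * ee u)))\<^sup>2 + sqnorm As / 2) has_integral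
      (Im (\<omega> * z))\<^sup>2 + (cmod (\<omega> * A))\<^sup>2 / 2 + sqnorm As / 2) {0..1}"
    using has_integral_add[OF circle_Im_square[of "Im (\<omega> * z)" "\<omega> * A"] has_integral_const_real[of "sqnorm As / 2" 0 1]]
    by (simp add: distrib_left mult.assoc del: times_complex.sel)
  have "steinhaus_mean (\<lambda>z. (Im (\<omega> * z))\<^sup>2) (A # As) z = (Im (\<omega> * z))\<^sup>2 + (cmod (\<omega> * A))\<^sup>2 / 2 + sqnorm As / 2"
    unfolding steinhaus_mean.simps Cons by (rule integral_unique[OF I])
  thus ?case using assms by (simp add: norm_mult add_divide_distrib del: times_complex.sel)
qed simp

text \<open>The bound is the fourth moment of a Gaussian with the same mean and variance; each
  coefficient falls short of it by 3/8 of its fourth power.\<close>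

lemma steinhaus_mean_Im_fourth:
  assumes "cmod \<omega> = 1"
  shows "steinhaus_mean (\<lambda>z. (Im (\<omega> * z)) ^ 4) As z
    \<le> (Im (\<omega> * z)) ^ 4 + 3 * (Im (\<omega> * z))\<^sup>2 * sqnorm As + 3 / 4 * (sqnorm As)\<^sup>2"
proof (induction As arbitrary: z)
  case (Cons A As)
  let ?x = "Im (\<omega> * z)" and ?t = "sqnorm As"
  have cf: "continuous_on UNIV (\<lambda>z. (Im (\<omega> * z)) ^ 4)" by (intro continuous_intros)
  have "((\<lambda>u. (Im (\<omega> * (z + A * ee u))) ^ 4 + 3 * (Im (\<omega> * (z + A * ee u)))\<^sup>2 * ?t + 3 / 4 * ?t\<^sup>2) has_integral
      (?x ^ 4 + 3 * ?x\<^sup>2 * (cmod (\<omega> * A))\<^sup>2 + 3 / 8 * (cmod (\<omega> * A)) ^ 4)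
      + 3 * ?t * (?x\<^sup>2 + (cmod (\<omega> * A))\<^sup>2 / 2) + 3 / 4 * ?t\<^sup>2) {0..1}"
    using has_integral_add[OF has_integral_add[OF circle_Im_fourth[of ?x "\<omega> * A"]
        has_integral_mult_right[OF circle_Im_square[of ?x "\<omega> * A"], of "3 * ?t"]]
        has_integral_const_real[of "3 / 4 * ?t\<^sup>2" 0 1]]
    by (simp add: distrib_left mult.assoc mult.left_commute[of _ ?t] mult.commute[of _ ?t] del: times_complex.sel)
  hence "steinhaus_mean (\<lambda>z. (Im (\<omega> * z)) ^ 4) (A # As) z
      \<le> (?x ^ 4 + 3 * ?x\<^sup>2 * (cmod (\<omega> * A))\<^sup>2 + 3 / 8 * (cmod (\<omega> * A)) ^ 4)
      + 3 * ?t * (?x\<^sup>2 + (cmod (\<omega> * A))\<^sup>2 / 2) + 3 / 4 * ?t\<^sup>2"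
    unfolding steinhaus_mean.simps
    by (rule has_integral_le[OF integrable_integral[OF steinhaus_mean_integrable[OF cf]]]) (rule Cons)
  also have "\<dots> = ?x ^ 4 + 3 * ?x\<^sup>2 * sqnorm (A # As) + 3 / 4 * (sqnorm (A # As))\<^sup>2 - 3 / 8 * (cmod A) ^ 4"
    using assms by (simp add: norm_mult power2_eq_square power4_eq_xxxx field_simps del: times_complex.sel)
  also have "\<dots> \<le> ?x ^ 4 + 3 * ?x\<^sup>2 * sqnorm (A # As) + 3 / 4 * (sqnorm (A # As))\<^sup>2" by simp
  finally show ?case .
qed simp

text \<open>A quadratic minorant nearly tangent at v = 0.92. The Taylor coefficients 1/2 and 1/8
  would lose too much through the fourth moment when the rest is 0.613 times the dominant
  square.\<close>

lemma sqrt_one_plus_ge: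
  assumes v: "v \<ge> (0::real)"
  shows "1 + 477 / 1000 * v - 634 / 10000 * v\<^sup>2 \<le> sqrt (1 + v)"
proof (cases "v \<le> 13")
  case True
  let ?\<gamma> = "634 / 10000 :: real"
  show ?thesis
  proof (rule real_le_rsqrt)
    \<comment> \<open>The near double root of the difference at 0.92; the linear factor stays
      negative up to 13, and beyond 13 the minorant itself is negative.\<close>
    have "(v - 92 / 100)\<^sup>2 * (?\<gamma>\<^sup>2 * v - 53 / 1000) \<le> 0"
      using True by (intro mult_nonneg_nonpos) (auto simp: power_divide)
    hence "v * ((v - 92 / 100)\<^sup>2 * (?\<gamma>\<^sup>2 * v - 53 / 1000)) \<le> 0"
      using v by (simp add: mult_nonneg_nonpos)
    moreover have "1 + v - (1 + 477 / 1000 * v - ?\<gamma> * v\<^sup>2)\<^sup>2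
        = 13689 / 156250000 * v ^ 3 + 377257 / 1953125000 * v\<^sup>2 + 713 / 625000 * v - v * ((v - 92 / 100)\<^sup>2 * (?\<gamma>\<^sup>2 * v - 53 / 1000))"
      by (simp add: field_simps eval_nat_numeral)
    moreover have "0 \<le> 13689 / 156250000 * v ^ 3 + 377257 / 1953125000 * v\<^sup>2 + 713 / 625000 * v" using v by simp
    ultimately show "(1 + 477 / 1000 * v - ?\<gamma> * v\<^sup>2)\<^sup>2 \<le> 1 + v" by linarith
  qed
next
  case False
  have "1 + 477 / 1000 * v - 634 / 10000 * v\<^sup>2 \<le> 0"
  proof -
    have "13 * v \<le> v * v" using False by (intro mult_right_mono) auto
    thus ?thesis using False unfolding power2_eq_square by linarith
  qed
  also have "0 \<le> sqrt (1 + v)" using v by simp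
  finally show ?thesis .
qed

text \<open>Rotate w to the positive axis. In the symmetrised sum only the component of z orthogonal
  to w survives, so the second-order growth of the modulus becomes visible.\<close>

lemma cmod_symmetric_sum_ge:
  assumes w: "w \<noteq> 0" and \<omega>: "\<omega> = cnj w / cmod w"
  shows "sqrt ((cmod w)\<^sup>2 + (Im (\<omega> * z))\<^sup>2) \<le> (cmod (w + z) + cmod (w - z)) / 2"
proof -
  let ?a = "complex_of_real (cmod w)" and ?\<zeta> = "\<omega> * z"
  have \<omega>w: "\<omega> * w = ?a" and n: "cmod \<omega> = 1"
    using w complex_norm_square[of w] by (auto simp: \<omega> power2_eq_square norm_divide field_simps)
  have "cmod (w + z) = cmod (\<omega> * (w + z))" by (simp add: norm_mult n)
  hence 1: "cmod (w + z) = cmod (?a + ?\<zeta>)" by (simp only: distrib_left \<omega>w)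
  have "cmod (w - z) = cmod (\<omega> * (w - z))" by (simp add: norm_mult n)
  \<comment> \<open>Conjugating the second vector makes the real parts of \<open>?\<zeta>\<close>
    cancel while the imaginary parts add up.\<close>
  also have "\<dots> = cmod (cnj (?a - ?\<zeta>))" by (simp only: right_diff_distrib \<omega>w complex_mod_cnj)
  finally have 2: "cmod (w - z) = cmod (?a - cnj ?\<zeta>)" by simp
  have "cmod ((?a + ?\<zeta>) + (?a - cnj ?\<zeta>)) \<le> cmod (w + z) + cmod (w - z)"
    unfolding 1 2 by (rule norm_triangle_ineq)
  moreover have "(?a + ?\<zeta>) + (?a - cnj ?\<zeta>) = 2 * Complex (cmod w) (Im ?\<zeta>)"
    by (simp add: complex_eq_iff)
  ultimately show ?thesis by (simp add: norm_mult complex_norm)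
qed

text \<open>Symmetrise, apply the quadratic minorant, and take second and fourth moments: 477/2000
  is half of 0.477, and 4755/100000 is 3/4 of 0.0634.\<close>

lemma steinhaus_mean_large_start:
  assumes w: "w \<noteq> 0"
  shows "cmod w + 477 / 2000 * sqnorm As / cmod w - 4755 / 100000 * (sqnorm As)\<^sup>2 / (cmod w) ^ 3
    \<le> steinhaus_mean cmod As w"
proof -
  define a where "a = cmod w"
  define \<omega> where "\<omega> = cnj w / cmod w"
  have a: "a > 0" and n: "cmod \<omega> = 1" using w by (auto simp: a_def \<omega>_def norm_divide)
  let ?V = "\<lambda>z. Im (\<omega> * z)"
  let ?q = "\<lambda>z. 477 / 1000 / a * (?V z)\<^sup>2 + (- 634 / 10000 / a ^ 3) * (?V z) ^ 4"
  have pointwise: "a * 1 + 1 * ?q z \<le> 1 / 2 * cmod (w + z) + 1 / 2 * cmod (w - z)" for z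
  proof -
    define v where "v = (?V z)\<^sup>2 / a\<^sup>2"
    have "a * 1 + 1 * ?q z = a * (1 + 477 / 1000 * v - 634 / 10000 * v\<^sup>2)"
      using a by (simp add: v_def power_divide field_simps eval_nat_numeral)
    also have "\<dots> \<le> a * sqrt (1 + v)" using a by (intro mult_left_mono sqrt_one_plus_ge) (auto simp: v_def)
    also have "\<dots> = sqrt (a\<^sup>2 * (1 + v))" using a by (simp add: real_sqrt_mult)
    also have "a\<^sup>2 * (1 + v) = (cmod w)\<^sup>2 + (?V z)\<^sup>2" using a by (simp add: v_def a_def field_simps)
    also have "sqrt \<dots> \<le> (cmod (w + z) + cmod (w - z)) / 2" by (rule cmod_symmetric_sum_ge[OF w \<omega>_def])
    finally show ?thesis by (simp add: add_divide_distrib)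
  qed
  have c1: "continuous_on UNIV (\<lambda>z. cmod (w + z))" and c2: "continuous_on UNIV (\<lambda>z. cmod (w - z))"
    and c3: "continuous_on UNIV (\<lambda>z. (?V z)\<^sup>2)" and c4: "continuous_on UNIV (\<lambda>z. (?V z) ^ 4)"
    by (intro continuous_intros)+
  have cq: "continuous_on UNIV ?q" by (intro continuous_intros)
  have "steinhaus_mean cmod As w = steinhaus_mean (\<lambda>z. cmod (w + z)) As 0"
    using steinhaus_mean_shift[of cmod As w 0] by simp
  moreover have "steinhaus_mean (\<lambda>z. cmod (w - z)) As 0 = steinhaus_mean (\<lambda>z. cmod (w + z)) As 0"
    using steinhaus_mean_minus[OF c1, of As 0] by simp
  ultimately have "steinhaus_mean cmod As w
      = steinhaus_mean (\<lambda>z. 1 / 2 * cmod (w + z) + 1 / 2 * cmod (w - z)) As 0"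
    by (subst steinhaus_mean_lin[OF c1 c2]) simp
  also have "\<dots> \<ge> steinhaus_mean (\<lambda>z. a * 1 + 1 * ?q z) As 0"
    by (rule steinhaus_mean_mono[OF _ _ pointwise]) (intro continuous_intros)+
  also have "steinhaus_mean (\<lambda>z. a * 1 + 1 * ?q z) As 0 = a + steinhaus_mean ?q As 0"
    by (subst steinhaus_mean_lin[OF continuous_on_const cq]) simp
  also have "steinhaus_mean ?q As 0 = 477 / 1000 / a * (sqnorm As / 2)
      + (- 634 / 10000 / a ^ 3) * steinhaus_mean (\<lambda>z. (?V z) ^ 4) As 0"
    by (subst steinhaus_mean_lin[OF c3 c4], subst steinhaus_mean_Im_square[OF n]) simp
  finally have lower: "a + (477 / 1000 / a * (sqnorm As / 2)
      + (- 634 / 10000 / a ^ 3) * steinhaus_mean (\<lambda>z. (?V z) ^ 4) As 0) \<le> steinhaus_mean cmod As w" .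
  have "steinhaus_mean (\<lambda>z. (?V z) ^ 4) As 0 \<le> 3 / 4 * (sqnorm As)\<^sup>2"
    using steinhaus_mean_Im_fourth[OF n, of As 0] by simp
  hence "(- 634 / 10000 / a ^ 3) * (3 / 4 * (sqnorm As)\<^sup>2)
      \<le> (- 634 / 10000 / a ^ 3) * steinhaus_mean (\<lambda>z. (?V z) ^ 4) As 0"
    using a by (intro mult_left_mono_neg) auto
  with lower have "a + (477 / 1000 / a * (sqnorm As / 2) + (- 634 / 10000 / a ^ 3) * (3 / 4 * (sqnorm As)\<^sup>2))
      \<le> steinhaus_mean cmod As w" by linarith
  moreover have "a + (477 / 1000 / a * (sqnorm As / 2) + (- 634 / 10000 / a ^ 3) * (3 / 4 * (sqnorm As)\<^sup>2))
      = a + 477 / 2000 * sqnorm As / a - 4755 / 100000 * (sqnorm As)\<^sup>2 / a ^ 3"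
    by simp
  ultimately show ?thesis by (simp only: a_def)
qed

lemma steinhaus_khintchine_dominant:
  assumes le: "62 * sqnorm As \<le> 38 * (cmod A)\<^sup>2"
  shows "sqrt pi / 2 * sqrt (sqnorm (A # As)) \<le> steinhaus_mean cmod (A # As) 0"
proof (cases "A = 0")
  case True
  hence "sqnorm (A # As) = 0" using le sqnorm_nonneg[of As] by simp
  moreover have "0 \<le> steinhaus_mean cmod (A # As) 0" by (rule steinhaus_mean_cmod_nonneg)
  ultimately show ?thesis by simp
next
  case False
  define a where "a = cmod A"
  define t where "t = sqnorm As / a\<^sup>2"
  have a: "a > 0" using False by (simp add: a_def)
  \<comment> \<open>0.613 rounds up 38/62, the threshold where the other method stops.\<close>
  have "sqnorm As \<le> 613 / 1000 * a\<^sup>2" using le zero_le_power2[of a] unfolding a_def[symmetric] by linarith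
  hence t: "0 \<le> t" "t \<le> 613 / 1000" using a by (auto simp: t_def pos_divide_le_eq)
  have sq: "sqnorm As = t * a\<^sup>2" using a by (simp add: t_def)
  define B where "B = a * (1 + 477 / 2000 * t - 4755 / 100000 * t\<^sup>2)"
  have "B \<le> steinhaus_mean cmod As (0 + A * ee u)" for u
    using steinhaus_mean_large_start[of "0 + A * ee u" As] False a ee_nonzero[of u]
    by (simp add: B_def norm_mult a_def[symmetric] sq field_simps eval_nat_numeral)
  hence "integral {0..1} (\<lambda>u::real. B) \<le> steinhaus_mean cmod (A # As) 0"
    unfolding steinhaus_mean.simps
    by (intro integral_le steinhaus_mean_integrable) (auto intro!: continuous_intros)
  hence lower: "B \<le> steinhaus_mean cmod (A # As) 0" by (simp del: steinhaus_mean.simps)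
  have "sqrt pi / 2 * sqrt (sqnorm (A # As)) = a * sqrt (pi / 4 * (1 + t))"
  proof -
    have "sqnorm (A # As) = a\<^sup>2 * (1 + t)" using sq by (simp add: a_def[symmetric] algebra_simps)
    thus ?thesis using a by (simp add: real_sqrt_mult real_sqrt_divide)
  qed
  also have "\<dots> \<le> B"
    unfolding B_def
  proof (intro mult_left_mono real_le_lsqrt)
    have "t\<^sup>2 \<le> 613 / 1000 * t"
      using mult_right_mono[OF t(2) t(1)] by (simp only: power2_eq_square)
    \<comment> \<open>The slope 0.2093 rounds down 0.2385 - 0.04755 * 0.613; the comparison is
      tightest at t = 0.613, which is why the square is completed there.\<close>
    hence f: "1 + 2093 / 10000 * t \<le> 1 + 477 / 2000 * t - 4755 / 100000 * t\<^sup>2" using t by simp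
    have "pi / 4 * (1 + t) \<le> 7854 / 10000 * (1 + t)" using t pi_approx(2) by (intro mult_right_mono) auto
    also have "\<dots> \<le> (1 + 2093 / 10000 * t)\<^sup>2"
    proof -
      have "0 \<le> (613 / 1000 - t)\<^sup>2" by simp
      thus ?thesis using t by (simp add: power2_eq_square field_simps)
    qed
    also have "\<dots> \<le> (1 + 477 / 2000 * t - 4755 / 100000 * t\<^sup>2)\<^sup>2" using f t by (intro power_mono) auto
    finally show "pi / 4 * (1 + t) \<le> (1 + 477 / 2000 * t - 4755 / 100000 * t\<^sup>2)\<^sup>2" .
    show "0 \<le> 1 + 477 / 2000 * t - 4755 / 100000 * t\<^sup>2" using f t by (auto intro: order_trans[rotated])
  qed (use a t in auto)
  finally show ?thesis using lower by simp
qed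

theorem steinhaus_khintchine: "sqrt pi / 2 * sqrt (sqnorm As) \<le> steinhaus_mean cmod As 0"
proof (cases "\<forall>A\<in>set As. 2 * (cmod A)\<^sup>2 \<le> sqnorm As")
  case True
  have "ennreal (sqrt pi / 2 * sqrt (sqnorm As)) \<le> ennreal (steinhaus_mean cmod As 0)"
    unfolding steinhaus_mean_cmod_formula_0 by (rule haagerup_integral_balanced) (use True in auto)
  moreover have "0 \<le> steinhaus_mean cmod As 0" by (rule steinhaus_mean_cmod_nonneg)
  ultimately show ?thesis by (simp add: ennreal_le_iff)
next
  case False
  then obtain A where A: "A \<in> set As" "2 * (cmod A)\<^sup>2 > sqnorm As" by auto
  then obtain Bs Cs where As: "As = Bs @ A # Cs" by (meson split_list)
  have "steinhaus_mean cmod As 0 = steinhaus_mean cmod (A # Bs @ Cs) 0"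
    unfolding As by (rule steinhaus_mean_front) (intro continuous_intros)
  moreover have "sqnorm As = sqnorm (A # Bs @ Cs)" by (simp add: As)
  moreover have "sqnorm (Bs @ Cs) \<le> (cmod A)\<^sup>2" using A(2) by (simp add: As)
  ultimately show ?thesis
    using steinhaus_khintchine_one_half[of "Bs @ Cs" A] steinhaus_khintchine_dominant[of "Bs @ Cs" A]
    by (metis linear)
qed

section \<open>Lower bound for the polynomials with spectrum in V\<close>

lemma cauchy_schwarz_2: "a * x + b * y \<le> sqrt (a\<^sup>2 + b\<^sup>2) * sqrt (x\<^sup>2 + y\<^sup>2)" for a b x y :: real
proof -
  have "0 \<le> (a * y - b * x)\<^sup>2" by simp
  hence "(a * x + b * y)\<^sup>2 \<le> (a\<^sup>2 + b\<^sup>2) * (x\<^sup>2 + y\<^sup>2)"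
    by (simp add: power2_eq_square algebra_simps)
  thus ?thesis by (simp add: real_le_rsqrt real_sqrt_mult[symmetric])
qed

text \<open>The ratio of consecutive frequencies, since (k+1)^2 - k^2 = 2k + 1.\<close>

definition gap :: "nat \<Rightarrow> nat" where "gap k = 2 ^ (2 * k + 1)"

lemma gap_pos: "gap k > 0" by (simp add: gap_def)

text \<open>Consecutive gaps quadruple, so Cauchy-Schwarz meets the geometric sum of 16^(-j), whose
  square root is 4 / sqrt 15; the induction applies it one term at a time.\<close>

lemma lacunary_error_gap:
  "lacunary_error gap m As \<le> sqrt (sqnorm As) * (2 * pi / (3 * real (gap m)) * (4 / sqrt 15))"
proof (induction As arbitrary: m)
  case (Cons A As)
  let ?x = "2 * pi / (3 * real (gap m))"
  have next_gap: "2 * pi / (3 * real (gap (Suc m))) = ?x / 4" by (simp add: gap_def)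
  have "lacunary_error gap m (A # As) \<le> cmod A * ?x + sqrt (sqnorm As) * (?x / sqrt 15)"
    using Cons[of "Suc m"] unfolding next_gap by simp
  also have "\<dots> \<le> sqrt ((cmod A)\<^sup>2 + (sqrt (sqnorm As))\<^sup>2) * sqrt (?x\<^sup>2 + (?x / sqrt 15)\<^sup>2)"
    by (rule cauchy_schwarz_2)
  also have "?x\<^sup>2 + (?x / sqrt 15)\<^sup>2 = (?x * (4 / sqrt 15))\<^sup>2"
    by (simp only: power_mult_distrib power_divide real_sqrt_pow2) (simp add: field_simps)
  also have "sqrt \<dots> = ?x * (4 / sqrt 15)" by (subst real_sqrt_abs) simp
  finally show ?case by simp
qed simp

text \<open>The preceding bound at the first gap, \<open>gap 4\<close> = 2^9.\<close>

definition transfer_const :: real where "transfer_const = pi / (192 * sqrt 15)"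

lemma lacunary_error_transfer: "lacunary_error gap 4 As \<le> sqrt (sqnorm As) * transfer_const"
  using lacunary_error_gap[of 4 As] by (simp add: gap_def transfer_const_def)

lemma lacunary_sum_squares:
  "lacunary_sum gap m (map f [m..<m + n]) (2 ^ (m\<^sup>2) * v) = (\<Sum>k=m..<m + n. f k * ee (2 ^ (k\<^sup>2) * v))"
proof (induction n arbitrary: m)
  case (Suc n)
  have "(Suc m)\<^sup>2 = 2 * m + 1 + m\<^sup>2" by (simp add: power2_eq_square)
  hence arg: "real (gap m) * (2 ^ (m\<^sup>2) * v) = 2 ^ ((Suc m)\<^sup>2) * v"
    by (simp add: gap_def power_add)
  have list: "[m..<m + Suc n] = m # [Suc m..<Suc m + n]" by (subst upt_conv_Cons) simp_all
  have sum: "(\<Sum>k=m..<m + Suc n. f k * ee (2 ^ (k\<^sup>2) * v))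
      = f m * ee (2 ^ (m\<^sup>2) * v) + (\<Sum>k=Suc m..<Suc m + n. f k * ee (2 ^ (k\<^sup>2) * v))"
    by (subst sum.atLeast_Suc_lessThan) simp_all
  show ?case unfolding list sum list.map lacunary_sum.simps arg Suc[of "Suc m"] ..
qed simp

lemma lacunary_sum_affine:
  "lacunary_sum q m (map (\<lambda>k. f k + g k * z) ks) v
    = lacunary_sum q m (map f ks) v + z * lacunary_sum q m (map g ks) v"
  by (induction ks arbitrary: m v) (simp_all add: algebra_simps)

text \<open>The L1 mean is at most the L2 mean, here through the pointwise bound of the modulus by
  half of |z|^2 / l + l; the factor \<open>\<i>\<close> supplies the real part.\<close>

lemma steinhaus_mean_cmod_le:
  assumes "sqnorm As \<le> l\<^sup>2" "l > 0"
  shows "steinhaus_mean cmod As 0 \<le> l"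
proof -
  have c1: "continuous_on UNIV (\<lambda>z. (Im (1 * z))\<^sup>2)" and c2: "continuous_on UNIV (\<lambda>z. (Im (\<i> * z))\<^sup>2)"
    and c3: "continuous_on UNIV (\<lambda>z. 1 * (Im (1 * z))\<^sup>2 + 1 * (Im (\<i> * z))\<^sup>2)"
    and c4: "continuous_on UNIV cmod"
    by (intro continuous_intros)+
  have "cmod z \<le> 1 / (2 * l) * (1 * (Im (1 * z))\<^sup>2 + 1 * (Im (\<i> * z))\<^sup>2) + l / 2 * 1" for z
  proof -
    have "0 \<le> (cmod z - l)\<^sup>2" by simp
    hence "2 * l * cmod z \<le> (cmod z)\<^sup>2 + l\<^sup>2" by (simp add: power2_eq_square algebra_simps)
    moreover have "(cmod z)\<^sup>2 = (Im z)\<^sup>2 + (Re z)\<^sup>2" by (simp add: cmod_power2)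
    ultimately show ?thesis using assms(2) by (simp add: field_simps power2_eq_square)
  qed
  hence "steinhaus_mean cmod As 0
      \<le> steinhaus_mean (\<lambda>z. 1 / (2 * l) * (1 * (Im (1 * z))\<^sup>2 + 1 * (Im (\<i> * z))\<^sup>2) + l / 2 * 1) As 0"
    by (intro steinhaus_mean_mono c4) (intro continuous_intros)
  also have "\<dots> = 1 / (2 * l) * (1 * (sqnorm As / 2) + 1 * (sqnorm As / 2)) + l / 2 * 1"
    by (subst steinhaus_mean_lin[OF c3 continuous_on_const], subst steinhaus_mean_lin[OF c1 c2],
        subst steinhaus_mean_Im_square, simp, subst steinhaus_mean_Im_square, simp, simp)
  also have "\<dots> \<le> l" using assms by (simp add: field_simps power2_eq_square)
  finally show ?thesis .
qed

lemma sqrt_convex_combination: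
  assumes l: "0 \<le> l" "l \<le> 1" and s: "0 \<le> s"
  shows "1 - l + l * s \<le> sqrt (1 - l + l * s\<^sup>2)"
proof (rule real_le_rsqrt)
  have "0 \<le> l * (1 - l) * (1 - s)\<^sup>2" using l by simp
  thus "(1 - l + l * s)\<^sup>2 \<le> 1 - l + l * s\<^sup>2" by (simp add: power2_eq_square algebra_simps)
qed

text \<open>Concavity of the square root in \<open>\<mu>\<close> interpolates between mean 1 at
  \<open>\<mu>\<close> = 0 and mean 2 sqrt 2 / pi at \<open>\<mu>\<close> = 1, where the integrand
  is l sqrt 2 times an absolute cosine. The second is the worst case.\<close>

lemma integral_sqrt_trig_ge:
  assumes W: "cmod W \<le> l\<^sup>2" and l: "l > 0"
  shows "2 * sqrt 2 / pi * l \<le> integral {0..1} (\<lambda>t. sqrt (l\<^sup>2 + Re (W * ee t)))"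
proof -
  define \<mu> where "\<mu> = cmod W / l\<^sup>2"
  have \<mu>: "0 \<le> \<mu>" "\<mu> \<le> 1" "cmod W = \<mu> * l\<^sup>2" using W l by (auto simp: \<mu>_def)
  have pointwise: "l * (1 - \<mu>) + l * \<mu> * sqrt 2 * \<bar>cos (pi * t)\<bar> \<le> sqrt (l\<^sup>2 + Re (complex_of_real (cmod W) * ee t))" for t
  proof -
    have "(sqrt 2 * \<bar>cos (pi * t)\<bar>)\<^sup>2 = 1 + cos (2 * pi * t)"
      using cos_double_cos[of "pi * t"] by (simp add: power_mult_distrib mult.assoc)
    hence "l * (1 - \<mu> + \<mu> * (sqrt 2 * \<bar>cos (pi * t)\<bar>)) \<le> l * sqrt (1 - \<mu> + \<mu> * (1 + cos (2 * pi * t)))"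
      using sqrt_convex_combination[OF \<mu>(1,2), of "sqrt 2 * \<bar>cos (pi * t)\<bar>"] l by (intro mult_left_mono) auto
    also have "1 - \<mu> + \<mu> * (1 + cos (2 * pi * t)) = 1 + \<mu> * cos (2 * pi * t)"
      by (simp add: algebra_simps)
    also have "l * sqrt (1 + \<mu> * cos (2 * pi * t)) = sqrt (l\<^sup>2 * (1 + \<mu> * cos (2 * pi * t)))"
      using l by (simp only: real_sqrt_mult real_sqrt_abs abs_of_pos)
    also have "l\<^sup>2 * (1 + \<mu> * cos (2 * pi * t)) = l\<^sup>2 + Re (complex_of_real (cmod W) * ee t)"
      by (simp add: \<mu>(3) algebra_simps)
    finally show ?thesis by (simp add: algebra_simps)
  qed
  have "2 * sqrt 2 / pi \<le> 1"
  proof -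
    have "sqrt 2 \<le> 1.5" by (rule real_le_lsqrt) (auto simp: power2_eq_square)
    thus ?thesis using pi_gt3 by (simp add: divide_le_eq)
  qed
  hence "l * (1 - \<mu>) * (2 * sqrt 2 / pi) \<le> l * (1 - \<mu>) * 1" using l \<mu> by (intro mult_left_mono) auto
  moreover have "2 * sqrt 2 / pi * l = l * (1 - \<mu>) * (2 * sqrt 2 / pi) + l * \<mu> * sqrt 2 * (2 / pi)"
    by (simp add: field_simps)
  ultimately have "2 * sqrt 2 / pi * l \<le> l * (1 - \<mu>) + l * \<mu> * sqrt 2 * (2 / pi)" by linarith
  also have "\<dots> = integral {0..1} (\<lambda>t. l * (1 - \<mu>) + l * \<mu> * sqrt 2 * \<bar>cos (pi * t)\<bar>)"
    by (subst integral_add)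
      (auto intro!: continuous_integrable_Icc continuous_intros simp: integral_abs_cos)
  also have "\<dots> \<le> integral {0..1} (\<lambda>t. sqrt (l\<^sup>2 + Re (complex_of_real (cmod W) * ee t)))"
    by (intro integral_le continuous_integrable_Icc continuous_intros pointwise)
  also have "\<dots> = integral {0..1} (\<lambda>t. sqrt (l\<^sup>2 + Re (W * ee t)))"
    by (rule integral_circle_rotate[of "\<lambda>z. sqrt (l\<^sup>2 + Re z)", symmetric]) (intro continuous_intros)
  finally show ?thesis .
qed

lemma sqnorm_map: "sqnorm (map f ks) = (\<Sum>k\<leftarrow>ks. (cmod (f k))\<^sup>2)"
  by (simp add: sqnorm_def comp_def)

lemma sqnorm_affine:
  assumes "cmod z = 1"
  shows "sqnorm (map (\<lambda>k. a k + b k * z) ks)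
    = sqnorm (map a ks) + sqnorm (map b ks) + Re ((\<Sum>k\<leftarrow>ks. 2 * cnj (a k) * b k) * z)"
proof (induction ks)
  case (Cons k ks)
  have "(cmod (a k + b k * z))\<^sup>2 = (cmod (a k))\<^sup>2 + (cmod (b k * z))\<^sup>2 + Re (2 * cnj (a k) * (b k * z))"
    unfolding cmod_power2 by (simp add: power2_eq_square algebra_simps)
  thus ?case using Cons assms by (simp add: norm_mult distrib_right mult.assoc del: times_complex.sel)
qed simp

text \<open>Keeps the oscillating part of the square sum within its mean, as the preceding average
  requires.\<close>

lemma cmod_cross_sum_le:
  "cmod (\<Sum>k\<leftarrow>ks. 2 * cnj (a k) * b k) \<le> sqnorm (map a ks) + sqnorm (map b ks)"
proof (induction ks)
  case (Cons k ks)
  have "0 \<le> (cmod (a k) - cmod (b k))\<^sup>2" by simp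
  hence "cmod (2 * cnj (a k) * b k) \<le> (cmod (a k))\<^sup>2 + (cmod (b k))\<^sup>2"
    by (simp add: norm_mult power2_eq_square algebra_simps)
  thus ?case using Cons norm_triangle_ineq[of "2 * cnj (a k) * b k" "\<Sum>k\<leftarrow>ks. 2 * cnj (a k) * b k"]
    by simp
qed simp

text \<open>Two scales: on a cell of length 2^(-16) the phase \<open>ee t\<close> moves by at most 2
  pi / 2^16, at a cost proportional to the L1 mean of \<open>Sb\<close>. That mean is in turn at
  most (1 + \<open>transfer_const\<close>) l, by the same transfer used as an upper bound.\<close>

lemma two_block_L1_lower_bound:
  fixes a b :: "nat \<Rightarrow> complex" and n :: nat
  defines "ks \<equiv> [4..<4 + n]"
  assumes l: "l\<^sup>2 = sqnorm (map a ks) + sqnorm (map b ks)" "l > 0"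
  shows "((sqrt pi / 2 - transfer_const) * (2 * sqrt 2 / pi) - 2 * pi / 2 ^ 16 * (1 + transfer_const)) * l
    \<le> integral {0..1} (\<lambda>t. cmod (\<Sum>k=4..<4 + n. (a k + b k * ee t) * ee (2 ^ (k\<^sup>2) * t)))"
proof -
  let ?D = transfer_const
  define Sa where "Sa = lacunary_sum gap 4 (map a ks)"
  define Sb where "Sb = lacunary_sum gap 4 (map b ks)"
  define P where "P t = map (\<lambda>k. a k + b k * ee t) ks" for t
  define S where "S t = sqnorm (P t)" for t
  define W where "W = (\<Sum>k\<leftarrow>ks. 2 * cnj (a k) * b k)"
  define F where "F t = cmod (\<Sum>k=4..<4 + n. (a k + b k * ee t) * ee (2 ^ (k\<^sup>2) * t))" for t
  have cS: "continuous_on T Sa" "continuous_on T Sb" for T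
    unfolding Sa_def Sb_def by (intro continuous_intros)+
  have lac: "lacunary_sum gap 4 (P t) v = Sa v + ee t * Sb v" for t v
    unfolding P_def Sa_def Sb_def by (rule lacunary_sum_affine)
  have S_eq: "S t = l\<^sup>2 + Re (W * ee t)" for t
    unfolding S_def P_def W_def l(1) by (rule sqnorm_affine) simp
  have cW: "cmod W \<le> l\<^sup>2" unfolding W_def l(1) by (rule cmod_cross_sum_le)
  have contS: "continuous_on T (\<lambda>t. S (f t))" if "continuous_on T f" for T f
    unfolding S_eq using that by (intro continuous_intros)
  have D0: "0 \<le> ?D" by (simp add: transfer_const_def)
  have D1: "?D \<le> sqrt pi / 2"
  proof -
    have "?D \<le> 4 / (192 * 1)"
      unfolding transfer_const_def using pi_less_4 by (intro frac_le mult_left_mono) auto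
    also have "\<dots> \<le> 1 / 2" by simp
    also have "\<dots> \<le> sqrt pi / 2" using pi_gt3 by simp
    finally show ?thesis .
  qed
  \<comment> \<open>2^16 is the lowest block frequency, so on a cell every fast phase depends on the
    cell variable alone.\<close>
  define N :: real where "N = real (2 ^ 16)"
  have N: "N > 0" "N = 2 ^ 16" by (simp_all add: N_def)
  have F_eq: "F ((real j + v) / N) = cmod (Sa v + ee ((real j + v) / N) * Sb v)" for j v
  proof -
    have "(\<Sum>k=4..<4 + n. (a k + b k * ee ((real j + v) / N)) * ee (2 ^ (k\<^sup>2) * ((real j + v) / N)))
        = lacunary_sum gap 4 (P ((real j + v) / N)) (2 ^ (4\<^sup>2) * ((real j + v) / N))"
      unfolding P_def ks_def by (rule lacunary_sum_squares[symmetric])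
    also have "2 ^ (4\<^sup>2) * ((real j + v) / N) = v + real j" by (simp add: N(2))
    also have "lacunary_sum gap 4 (P ((real j + v) / N)) (v + real j) = lacunary_sum gap 4 (P ((real j + v) / N)) v"
      by (rule lacunary_sum_periodic)
    finally show ?thesis by (simp add: F_def lac)
  qed
  have int_Sb: "integral {0..1} (\<lambda>v. cmod (Sb v)) \<le> (1 + ?D) * l"
  proof -
    have le: "sqnorm (map b ks) \<le> l\<^sup>2" by (simp add: l(1))
    have "integral {0..1} (\<lambda>v. cmod (0 + lacunary_sum gap 4 (map b ks) v))
        \<le> steinhaus_mean cmod (map b ks) 0 + lacunary_error gap 4 (map b ks)"
      using lacunary_decoupling[of gap 0 4 "map b ks", OF gap_pos] by linarith
    also have "\<dots> \<le> l + sqrt (sqnorm (map b ks)) * ?D"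
      by (intro add_mono steinhaus_mean_cmod_le lacunary_error_transfer le l)
    also have "sqrt (sqnorm (map b ks)) \<le> l"
      using l(2) le by (intro real_le_lsqrt) auto
    finally show ?thesis using D0 by (simp add: Sb_def algebra_simps mult_right_mono)
  qed
  have frozen: "(sqrt pi / 2 - ?D) * sqrt (S t) \<le> integral {0..1} (\<lambda>v. cmod (Sa v + ee t * Sb v))" for t
  proof -
    have "(sqrt pi / 2 - ?D) * sqrt (S t) \<le> steinhaus_mean cmod (P t) 0 - lacunary_error gap 4 (P t)"
      using steinhaus_khintchine[of "P t"] lacunary_error_transfer[of "P t"]
      by (simp add: S_def algebra_simps)
    also have "\<dots> \<le> integral {0..1} (\<lambda>v. cmod (0 + lacunary_sum gap 4 (P t) v))"
      using lacunary_decoupling[of gap 0 4 "P t", OF gap_pos] by linarith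
    finally show ?thesis by (simp add: lac)
  qed
  have piece: "integral {0..1} (\<lambda>w. (sqrt pi / 2 - ?D) * sqrt (S ((real j + w) / N))) - 2 * pi / N * ((1 + ?D) * l)
      \<le> integral {0..1} (\<lambda>v. F ((real j + v) / N))" for j
  proof -
    have "(sqrt pi / 2 - ?D) * sqrt (S ((real j + w) / N)) - 2 * pi / N * ((1 + ?D) * l)
        \<le> integral {0..1} (\<lambda>v. F ((real j + v) / N))" if w: "w \<in> {0..1}" for w
    proof -
      let ?t = "(real j + w) / N"
      have close: "cmod (Sa v + ee ?t * Sb v) - 2 * pi / N * cmod (Sb v) \<le> F ((real j + v) / N)"
        if v: "v \<in> {0..1}" for v
      proof -
        have "cmod (ee ?t - ee ((real j + v) / N)) \<le> 2 * pi * \<bar>?t - (real j + v) / N\<bar>"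
          by (rule cmod_ee_diff_le)
        also have "?t - (real j + v) / N = (w - v) / N" by (simp add: diff_divide_distrib add_divide_distrib)
        also have "2 * pi * \<bar>(w - v) / N\<bar> \<le> 2 * pi * (1 / N)"
          using v w N(1) by (intro mult_left_mono) (auto simp: abs_divide divide_right_mono)
        finally have "cmod ((ee ?t - ee ((real j + v) / N)) * Sb v) \<le> 2 * pi / N * cmod (Sb v)"
          unfolding norm_mult by (intro mult_right_mono) auto
        moreover have "cmod (Sa v + ee ?t * Sb v)
            \<le> cmod (Sa v + ee ((real j + v) / N) * Sb v) + cmod ((ee ?t - ee ((real j + v) / N)) * Sb v)"
          using norm_triangle_ineq[of "Sa v + ee ((real j + v) / N) * Sb v" "(ee ?t - ee ((real j + v) / N)) * Sb v"]
          by (simp add: algebra_simps)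
        ultimately show ?thesis by (simp add: F_eq)
      qed
      have i1: "(\<lambda>v. cmod (Sa v + ee ?t * Sb v)) integrable_on {0..1}"
        and i2: "(\<lambda>v. 2 * pi / N * cmod (Sb v)) integrable_on {0..1}"
        and i3: "(\<lambda>v. F ((real j + v) / N)) integrable_on {0..1}"
        unfolding F_eq using N(1) by (auto intro!: continuous_integrable_Icc continuous_intros cS)
      have "2 * pi / N * integral {0..1} (\<lambda>v. cmod (Sb v)) \<le> 2 * pi / N * ((1 + ?D) * l)"
        using int_Sb N(1) by (intro mult_left_mono) auto
      hence "(sqrt pi / 2 - ?D) * sqrt (S ?t) - 2 * pi / N * ((1 + ?D) * l)
          \<le> integral {0..1} (\<lambda>v. cmod (Sa v + ee ?t * Sb v)) - 2 * pi / N * integral {0..1} (\<lambda>v. cmod (Sb v))"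
        using frozen[of ?t] by linarith
      also have "\<dots> = integral {0..1} (\<lambda>v. cmod (Sa v + ee ?t * Sb v) - 2 * pi / N * cmod (Sb v))"
        using i1 i2 by (simp only: integral_diff integral_mult_right)
      also have "\<dots> \<le> integral {0..1} (\<lambda>v. F ((real j + v) / N))"
        using close by (intro integral_le integrable_diff i1 i2 i3) auto
      finally show ?thesis .
    qed
    hence "integral {0..1} (\<lambda>w. (sqrt pi / 2 - ?D) * sqrt (S ((real j + w) / N)) - 2 * pi / N * ((1 + ?D) * l))
        \<le> integral {0..1} (\<lambda>w::real. integral {0..1} (\<lambda>v. F ((real j + v) / N)))"
      using N(1) by (intro integral_le) (auto intro!: continuous_integrable_Icc continuous_intros contS)
    moreover have "integral {0..1} (\<lambda>w. (sqrt pi / 2 - ?D) * sqrt (S ((real j + w) / N)) - 2 * pi / N * ((1 + ?D) * l))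
        = integral {0..1} (\<lambda>w. (sqrt pi / 2 - ?D) * sqrt (S ((real j + w) / N))) - 2 * pi / N * ((1 + ?D) * l)"
      using N(1) by (subst integral_diff)
        (auto intro!: continuous_integrable_Icc continuous_intros contS)
    ultimately show ?thesis by simp
  qed
  have cF: "continuous_on UNIV F" unfolding F_def by (intro continuous_intros)
  have "((sqrt pi / 2 - ?D) * (2 * sqrt 2 / pi) - 2 * pi / N * (1 + ?D)) * l
      = (sqrt pi / 2 - ?D) * (2 * sqrt 2 / pi * l) - 2 * pi / N * ((1 + ?D) * l)"
    by (simp add: algebra_simps)
  also have "\<dots> \<le> (sqrt pi / 2 - ?D) * integral {0..1} (\<lambda>t. sqrt (S t)) - 2 * pi / N * ((1 + ?D) * l)"
    using integral_sqrt_trig_ge[OF cW l(2)] D1 unfolding S_eq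
    by (intro diff_right_mono mult_left_mono) auto
  also have "\<dots> = integral {0..1} (\<lambda>t. (sqrt pi / 2 - ?D) * sqrt (S t)) - 2 * pi / N * ((1 + ?D) * l)"
    by simp
  also have "integral {0..1} (\<lambda>t. (sqrt pi / 2 - ?D) * sqrt (S t))
      = (\<Sum>j<2 ^ 16. integral {0..1} (\<lambda>w. (sqrt pi / 2 - ?D) * sqrt (S ((real j + w) / N)))) / N"
    unfolding N_def by (intro integral_split_periods continuous_intros contS) simp
  also have "\<dots> - 2 * pi / N * ((1 + ?D) * l)
      = (\<Sum>j<2 ^ 16. integral {0..1} (\<lambda>w. (sqrt pi / 2 - ?D) * sqrt (S ((real j + w) / N)))
        - 2 * pi / N * ((1 + ?D) * l)) / N"
    using N by (simp add: sum_subtractf diff_divide_distrib)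
  also have "\<dots> \<le> (\<Sum>j<2 ^ 16. integral {0..1} (\<lambda>v. F ((real j + v) / N))) / N"
    using N(1) piece by (intro divide_right_mono sum_mono) auto
  also have "\<dots> = integral {0..1} F"
    unfolding N_def by (intro integral_split_periods[symmetric] cF) simp
  finally show ?thesis by (simp add: F_def[abs_def] N(2))
qed

text \<open>As pi / (64 sqrt 15) is three times \<open>transfer_const\<close>, the claimed constant
  allows 3 / sqrt 6 of these, more than the 2 sqrt 2 / pi spent; this surplus absorbs the larger
  loss in the slow factor.\<close>

lemma lower_bound_constant:
  "sqrt (2 / pi) - 1 / sqrt 6 * (pi / 32768 + pi / (64 * sqrt 15))
    \<le> (sqrt pi / 2 - transfer_const) * (2 * sqrt 2 / pi) - 2 * pi / 2 ^ 16 * (1 + transfer_const)"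
proof -
  have s2: "sqrt 2 \<le> 3 / 2" by (rule real_le_lsqrt) (auto simp: power2_eq_square)
  have s6: "sqrt 6 \<le> 5 / 2" by (rule real_le_lsqrt) (auto simp: power2_eq_square)
  have s15: "3 \<le> sqrt 15" "sqrt 15 \<le> 4" by (auto intro: real_le_rsqrt real_le_lsqrt)
  have D: "0 \<le> transfer_const" by (simp add: transfer_const_def)
  have "transfer_const \<le> 4 / (192 * 1)"
    unfolding transfer_const_def using pi_less_4 s15 by (intro frac_le mult_left_mono) auto
  hence D1: "transfer_const \<le> 1 / 48" by simp
  define Y where "Y = 1 / sqrt 6 * (pi / 32768 + pi / (64 * sqrt 15))"
  define E where "E = 2 * pi / 2 ^ 16 * (1 + transfer_const)"
  have main: "sqrt pi / 2 * (2 * sqrt 2 / pi) = sqrt (2 / pi)"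
    by (simp add: real_sqrt_divide field_simps)
  define Z where "Z = transfer_const * (2 * sqrt 2 / pi)"
  have "Z \<le> transfer_const * 1"
    unfolding Z_def using s2 pi_gt3 D by (intro mult_left_mono) (auto simp: divide_le_eq)
  moreover have "E \<le> 2 * pi / 2 ^ 16 * (49 / 48)"
    unfolding E_def using D1 by (intro mult_left_mono) auto
  hence "E \<le> pi * (49 / 1572864)" by simp
  moreover have "2 / 5 * (pi / 32768 + 3 * transfer_const) \<le> Y"
  proof -
    have "pi / (64 * sqrt 15) = 3 * transfer_const" by (simp add: transfer_const_def)
    moreover have "2 / 5 * (pi / 32768 + pi / (64 * sqrt 15)) \<le> Y"
      unfolding Y_def using s6 by (intro mult_right_mono) (auto simp: divide_simps)
    ultimately show ?thesis by simp
  qed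
  \<comment> \<open>A lower bound on \<open>transfer_const\<close>, so that its surplus really
    covers \<open>E\<close>.\<close>
  moreover have "pi / 4 \<le> pi / sqrt 15" using s15 by (intro divide_left_mono) auto
  hence "pi / 4 / 192 \<le> pi / sqrt 15 / 192" by (rule divide_right_mono) simp
  hence "pi / 768 \<le> transfer_const" by (simp add: transfer_const_def mult.commute)
  ultimately have "Z + E \<le> Y" using pi_gt3 by (simp add: field_simps)
  thus ?thesis
    unfolding left_diff_distrib main Y_def[symmetric] Z_def[symmetric] E_def[symmetric] by linarith
qed

lemma constant_bounds:
  "1 / 1.262 < sqrt (2 / pi) - 1 / sqrt 6 * (pi / 32768 + pi / (64 * sqrt 15))"
proof -
  have s2: "0.79788 \<le> sqrt (2 / pi)"
    using pi_approx(2) by (intro real_le_rsqrt) (simp add: power2_eq_square le_divide_eq)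
  have s6: "2.4494 \<le> sqrt 6" by (rule real_le_rsqrt) (simp add: power2_eq_square)
  have s15: "3.8729 \<le> sqrt 15" by (rule real_le_rsqrt) (simp add: power2_eq_square)
  define Y where "Y = 1 / sqrt 6 * (pi / 32768 + pi / (64 * sqrt 15))"
  have "Y \<le> 1 / 2.4494 * (3.1416 / 32768 + 3.1416 / (64 * 3.8729))"
    unfolding Y_def using pi_approx(2) by (intro mult_mono add_mono frac_le s6 s15 mult_left_mono) auto
  also have "\<dots> \<le> 0.00522" by simp
  finally show ?thesis using s2 unfolding Y_def[symmetric] by simp
qed

section \<open>From coefficient families on the spectrum to block sums\<close>

lemma exp_eq_ee: "exp (2 * of_real pi * \<i> * of_int n * of_real t) = ee (of_int n * t)"
  by (simp add: ee_def cis_conv_exp mult_ac)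

lemma V_sq_block_representation:
  assumes c: "c \<in> c00 V_sq"
  obtains n where "\<And>t. trig_poly c t = (\<Sum>k=4..<4 + n. (c (2 ^ (k\<^sup>2)) + c (2 ^ (k\<^sup>2) + 1) * ee t) * ee (2 ^ (k\<^sup>2) * t))"
    and "(l2_norm c)\<^sup>2 = (\<Sum>k=4..<4 + n. (cmod (c (2 ^ (k\<^sup>2))))\<^sup>2) + (\<Sum>k=4..<4 + n. (cmod (c (2 ^ (k\<^sup>2) + 1)))\<^sup>2)"
proof -
  let ?X = "{n. c n \<noteq> 0}"
  define f :: "nat \<Rightarrow> int" where "f k = 2 ^ (k\<^sup>2)" for k
  define g :: "nat \<Rightarrow> int" where "g k = 2 ^ (k\<^sup>2) + 1" for k
  \<comment> \<open>A crude cutoff: a block index is below its frequencies, and each frequency in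
    the support is at most the sum of all of them.\<close>
  define n where "n = Suc (\<Sum>x\<in>?X. nat x)"
  let ?K = "{4..<4 + n}"
  have fin: "finite ?X" and sub: "?X \<subseteq> V_sq" using c by (auto simp: c00_def)
  have supp: "?X \<subseteq> f ` ?K \<union> g ` ?K"
  proof
    fix x assume x: "x \<in> ?X"
    then obtain k where k: "k \<ge> 4" "x = f k \<or> x = g k" using sub by (auto simp: V_sq_def f_def g_def)
    have "k \<le> k\<^sup>2" by (simp add: power2_eq_square)
    also have "k\<^sup>2 < 2 ^ (k\<^sup>2)" by (rule less_exp)
    finally have "int k < f k" unfolding f_def by (metis of_nat_less_iff of_nat_numeral of_nat_power)
    hence "int k < x" using k by (auto simp: f_def g_def)
    hence "k < nat x" by (simp only: zless_nat_eq_int_zless)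
    also have "nat x \<le> (\<Sum>x\<in>?X. nat x)" by (rule member_le_sum) (use x fin in auto)
    finally have "k \<in> ?K" using k by (simp add: n_def)
    thus "x \<in> f ` ?K \<union> g ` ?K" using k by auto
  qed
  have inj: "inj_on f ?K" "inj_on g ?K"
    by (auto simp: inj_on_def f_def g_def)
  have disj: "f ` ?K \<inter> g ` ?K = {}"
  proof -
    \<comment> \<open>Parity separates the two halves of the spectrum; it relies on the exponents
      being positive.\<close>
    have "even (f k)" "odd (g k)" if "k \<in> ?K" for k using that by (auto simp: f_def g_def)
    thus ?thesis by fastforce
  qed
  have sums: "(\<Sum>x\<in>?X. h x) = (\<Sum>k\<in>?K. h (f k)) + (\<Sum>k\<in>?K. h (g k))"
    if "\<And>x. c x = 0 \<Longrightarrow> h x = 0" for h :: "int \<Rightarrow> 'b::comm_monoid_add"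
  proof -
    have "(\<Sum>x\<in>?X. h x) = (\<Sum>x\<in>f ` ?K \<union> g ` ?K. h x)"
      by (rule sum.mono_neutral_left) (use supp that in auto)
    also have "\<dots> = (\<Sum>x\<in>f ` ?K. h x) + (\<Sum>x\<in>g ` ?K. h x)"
      by (rule sum.union_disjoint) (use disj in auto)
    finally show ?thesis using inj by (simp add: sum.reindex)
  qed
  show ?thesis
  proof (rule that[of n])
    fix t
    have "trig_poly c t = (\<Sum>k\<in>?K. c (f k) * ee (of_int (f k) * t)) + (\<Sum>k\<in>?K. c (g k) * ee (of_int (g k) * t))"
      unfolding trig_poly_def exp_eq_ee by (rule sums) simp
    also have "\<dots> = (\<Sum>k\<in>?K. (c (f k) + c (g k) * ee t) * ee (2 ^ (k\<^sup>2) * t))"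
    proof -
      have "ee (of_int (f k) * t) = ee (2 ^ (k\<^sup>2) * t)" "ee (of_int (g k) * t) = ee (2 ^ (k\<^sup>2) * t) * ee t" for k
        by (simp_all add: f_def g_def distrib_right ee_add)
      thus ?thesis by (simp only: sum.distrib[symmetric]) (simp add: algebra_simps)
    qed
    finally show "trig_poly c t = (\<Sum>k=4..<4 + n. (c (2 ^ (k\<^sup>2)) + c (2 ^ (k\<^sup>2) + 1) * ee t) * ee (2 ^ (k\<^sup>2) * t))"
      by (simp add: f_def g_def)
  next
    have "(l2_norm c)\<^sup>2 = (\<Sum>x\<in>?X. (cmod (c x))\<^sup>2)"
      unfolding l2_norm_def by (simp add: sum_nonneg)
    also have "\<dots> = (\<Sum>k\<in>?K. (cmod (c (f k)))\<^sup>2) + (\<Sum>k\<in>?K. (cmod (c (g k)))\<^sup>2)"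
      by (rule sums) simp
    finally show "(l2_norm c)\<^sup>2 = (\<Sum>k=4..<4 + n. (cmod (c (2 ^ (k\<^sup>2))))\<^sup>2) + (\<Sum>k=4..<4 + n. (cmod (c (2 ^ (k\<^sup>2) + 1)))\<^sup>2)"
      by (simp add: f_def g_def)
  qed
qed

lemma Z2_V_sq: "Z2 V_sq = \<infinity>"
proof -
  let ?S = "{(a, b). a \<in> V_sq \<and> b \<in> V_sq \<and> b - a = 1}"
  have "inj_on (\<lambda>k::nat. (2 ^ (k\<^sup>2) :: int, 2 ^ (k\<^sup>2) + 1 :: int)) {4..}"
    by (auto simp: inj_on_def)
  hence "infinite ((\<lambda>k::nat. (2 ^ (k\<^sup>2) :: int, 2 ^ (k\<^sup>2) + 1 :: int)) ` {4..})"
    using infinite_Ici[of "4::nat"] finite_imageD by blast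
  moreover have "(\<lambda>k::nat. (2 ^ (k\<^sup>2) :: int, 2 ^ (k\<^sup>2) + 1 :: int)) ` {4..} \<subseteq> ?S"
    by (auto simp: V_sq_def)
  ultimately have "infinite ?S" by (meson finite_subset)
  hence "ecard ?S = \<infinity>" by (simp add: ecard_def)
  moreover have "ecard ?S \<le> Z2 V_sq" unfolding Z2_def by (rule SUP_upper) simp
  ultimately show ?thesis by (simp add: top_enat_def[symmetric] top_unique)
qed

theorem corollary5p16:
  shows "Z2 V_sq = \<infinity> \<and>
    alpha1 V_sq \<le> ennreal (inverse (sqrt (2 / pi)
      - 1 / sqrt 6 * (pi / 32768 + pi / (64 * sqrt 15)))) \<and>
    inverse (sqrt (2 / pi)
      - 1 / sqrt 6 * (pi / 32768 + pi / (64 * sqrt 15))) < (1.262 :: real) \<and>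
    (1.262 :: real) < sqrt 2"
proof (intro conjI)
  let ?T = "sqrt (2 / pi) - 1 / sqrt 6 * (pi / 32768 + pi / (64 * sqrt 15))"
  have T: "1 / 1.262 < ?T" by (rule constant_bounds)
  hence T0: "?T > 0" by (rule order_less_trans[rotated]) simp
  show "Z2 V_sq = \<infinity>" by (rule Z2_V_sq)
  show "inverse ?T < 1.262"
    using less_imp_inverse_less[OF T] by simp
  show "(1.262 :: real) < sqrt 2" by (rule real_less_rsqrt) (simp add: power2_eq_square)
  show "alpha1 V_sq \<le> ennreal (inverse ?T)"
    unfolding alpha1_def
  proof (rule SUP_least)
    fix c assume c: "c \<in> c00 V_sq - {\<lambda>_. 0}"
    let ?l = "l2_norm c" and ?I = "integral {0..1} (\<lambda>t. cmod (trig_poly c t))"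
    obtain n where n: "\<And>t. trig_poly c t = (\<Sum>k=4..<4 + n. (c (2 ^ (k\<^sup>2)) + c (2 ^ (k\<^sup>2) + 1) * ee t) * ee (2 ^ (k\<^sup>2) * t))"
      and l: "?l\<^sup>2 = (\<Sum>k=4..<4 + n. (cmod (c (2 ^ (k\<^sup>2))))\<^sup>2) + (\<Sum>k=4..<4 + n. (cmod (c (2 ^ (k\<^sup>2) + 1)))\<^sup>2)"
      using V_sq_block_representation c by blast
    have "c \<noteq> (\<lambda>_. 0)" and fin: "finite {n. c n \<noteq> 0}" using c by (auto simp: c00_def)
    then obtain m where "c m \<noteq> 0" by auto
    hence l0: "?l > 0"
      unfolding l2_norm_def real_sqrt_gt_0_iff using fin by (intro sum_pos) auto
    have "?T * ?l \<le> ((sqrt pi / 2 - transfer_const) * (2 * sqrt 2 / pi) - 2 * pi / 2 ^ 16 * (1 + transfer_const)) * ?l"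
      using lower_bound_constant l0 by (intro mult_right_mono) auto
    also have "\<dots> \<le> ?I"
      unfolding n using l l0
      by (intro two_block_L1_lower_bound) (simp_all add: sqnorm_map interv_sum_list_conv_sum_set_nat)
    finally have I: "?T * ?l \<le> ?I" .
    \<comment> \<open>A positive denominator turns the extended quotient into an ordinary real
      one.\<close>
    hence "?I > 0" using T0 l0 by (meson mult_pos_pos order_less_le_trans)
    hence "ennreal ?l / ennreal ?I = ennreal (?l / ?I)" using l0 by (intro divide_ennreal) auto
    also have "?l / ?I \<le> inverse ?T"
      using I T0 \<open>?I > 0\<close> by (simp add: field_simps)
    finally show "ennreal ?l / ennreal ?I \<le> ennreal (inverse ?T)" by (simp add: ennreal_leI)
  qed
qed

end
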